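(* Let $Q$ be a smooth $n$-dimensional manifold with Riemannian metric $\mathscr{G}$, let $\mathscr{A}=X+\mathscr{D}$ be an affine distribution on $Q$, where $X\in\mathfrak{X}(Q)$ and the model distribution $\mathscr{D}$ is nonintegrable of constant rank $r$ with $1<r<n$, and put $m=n-r$. Consider the mechanical control system $$\nabla^{\mathscr{G}}_{\dot q(t)}\dot q(t)=Y^{0}(q(t),\dot q(t))+\sum_{a=1}^{m}u_a(t)\,Y^{a}(q(t)),$$ where $Y^0=\sharp(F^0)$ for an external force $F^0:TQ\to T^*Q$ and $Y^a=\sharp(f^a)$ for $1$-forms $f^1,\dots,f^m\in\Omega^1(Q)$, and let $\mathscr{F}$ be its input distribution, generated by $Y^1,\dots,Y^m$. If $\mathscr{A}$ and $\mathscr{F}$ are transversal, then there exists a unique control function $\hat u:\mathscr{A}\to\mathbb{R}^m$ making $\mathscr{A}$ a virtual affine nonholonomic constraint associated with this mechanical control system.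
   Context: All manifolds, vector fields, forms, distributions, forces and control functions are smooth. $\mathfrak{X}(Q)$ and $\Omega^1(Q)$ denote the vector fields and $1$-forms on $Q$; $\nabla^{\mathscr{G}}$ is the Levi-Civita connection of $\mathscr{G}$. The isomorphism $\flat:\mathfrak{X}(Q)\to\Omega^1(Q)$ is $\flat(X)(Y)=\mathscr{G}(X,Y)$, and $\sharp=\flat^{-1}$ (also used fibrewise $T^*Q\to TQ$). An external force $F^0:TQ\to T^*Q$ is a fibre-preserving map. Affine distribution: $\mathscr{A}_q=X(q)+\mathscr{D}_q\subseteq T_qQ$ for every $q\in Q$, with $X$ a vector field and $\mathscr{D}$ a distribution on $Q$ (the model distribution); $\mathscr{A}$ is also regarded as the subset (a submanifold) $\bigcup_q\mathscr{A}_q$ of $TQ$. Transversality: the dimension of an affine subspace of a vector space is the dimension of its model vector subspace. Two affine subspaces $W_1,W_2$ of a vector space $V$ are transversal if $V=W_1+W_2$ and $\dim V=\dim W_1+\dim W_2$. $\mathscr{A}$ and $\mathscr{F}$ are transversal if $\mathscr{A}_q$ and $\mathscr{F}_q$ are transversal in $T_qQ$ for every $q\in Q$. Vertical lift: for $X\in\mathfrak{X}(Q)$ and $v_q\in T_qQ$, $X^V_{v_q}=\left.\frac{d}{dt}\right|_{t=0}(v_q+tX(q))\in T_{v_q}(TQ)$. Closed-loop system: let $G$ be the second-order vector field on $TQ$ whose integral curves are the velocity curves of solutions of $\nabla^{\mathscr{G}}_{\dot q}\dot q=Y^0(q,\dot q)$. With control function $\hat u$, the closed-loop system is given by the vector field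 $\Gamma(v_q)=G(v_q)+\sum_{a=1}^m\hat u_a(v_q)(Y^a)^V_{v_q}$. Virtual affine nonholonomic constraint: an affine distribution $\mathscr{A}\subseteq TQ$ that is controlled invariant for the mechanical control system, i.e. there is a control function $\hat u:\mathscr{A}\to\mathbb{R}^m$ such that the flow $\psi_t$ of the closed-loop system satisfies $\psi_t(\mathscr{A})\subseteq\mathscr{A}$ (for all $t$ for which it is defined). Since $\hat u$ is only defined on $\mathscr{A}$, this is read as: for every $v_q\in\mathscr{A}$, the closed-loop solution (integral curve of $\Gamma$, with $\hat u$ extended smoothly near $\mathscr{A}$ if desired) starting at $v_q$ remains in $\mathscr{A}$ as long as it is defined. Such a $\hat u$ is said to make $\mathscr{A}$ a virtual affine nonholonomic constraint. *)

theory Defs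
  imports "HOL-Analysis.Analysis" "HOL-Library.Function_Algebras"
begin

(* Tangent vectors are represented below by functions on charts, so tangent spaces inherit
   their linear structure, and the library notions subspace, span and dim, from this instance. *)
instantiation "fun" :: (type, real_vector) real_vector
begin

definition scaleR_fun :: "real \<Rightarrow> ('a \<Rightarrow> 'b) \<Rightarrow> 'a \<Rightarrow> 'b" where
  "scaleR_fun c f = (\<lambda>x. c *\<^sub>R f x)"

instance
  by standard (auto simp: scaleR_fun_def fun_eq_iff algebra_simps)

end


section \<open>Smooth manifolds\<close>

(* Only meaningful for open S. *)
fun Ck_on :: "nat \<Rightarrow> 'a::real_normed_vector set \<Rightarrow> ('a \<Rightarrow> 'b::real_normed_vector) \<Rightarrow> bool" where
  "Ck_on 0 S f \<longleftrightarrow> continuous_on S f"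
| "Ck_on (Suc k) S f \<longleftrightarrow> (\<forall>x\<in>S. f differentiable (at x)) \<and>
     (\<forall>v. Ck_on k S (\<lambda>x. frechet_derivative f (at x) v))"

definition smooth_on :: "'a::real_normed_vector set \<Rightarrow> ('a \<Rightarrow> 'b::real_normed_vector) \<Rightarrow> bool" where
  "smooth_on S f \<longleftrightarrow> (\<forall>k. Ck_on k S f)"

(* A chart is a pair of its domain and a coordinate map; the values of the map outside the
   domain are irrelevant. A manifold is given by an atlas M, its points are the elements of the
   chart domains, and its topology is the one induced by the charts. *)
type_synonym ('p, 'e) chart = "'p set \<times> ('p \<Rightarrow> 'e)"

definition carrier :: "('p, 'e) chart set \<Rightarrow> 'p set" where
  "carrier M = (\<Union>c\<in>M. fst c)"

definition chart_inv :: "('p, 'e) chart \<Rightarrow> 'e \<Rightarrow> 'p" where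
  "chart_inv c = inv_into (fst c) (snd c)"

definition is_chart :: "('p, 'e::euclidean_space) chart \<Rightarrow> bool" where
  "is_chart c \<longleftrightarrow> inj_on (snd c) (fst c) \<and> open (snd c ` fst c)"

definition compatible :: "('p, 'e::euclidean_space) chart \<Rightarrow> ('p, 'e) chart \<Rightarrow> bool" where
  "compatible c c' \<longleftrightarrow>
     open (snd c ` (fst c \<inter> fst c')) \<and> open (snd c' ` (fst c \<inter> fst c')) \<and>
     smooth_on (snd c ` (fst c \<inter> fst c')) (snd c' \<circ> chart_inv c) \<and>
     smooth_on (snd c' ` (fst c \<inter> fst c')) (snd c \<circ> chart_inv c')"

definition mtop :: "('p, 'e::euclidean_space) chart set \<Rightarrow> 'p topology" where
  "mtop M = topology (\<lambda>W. W \<subseteq> carrier M \<and> (\<forall>c\<in>M. open (snd c ` (W \<inter> fst c))))"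

lemma openin_mtop:
  assumes "\<forall>c\<in>M. is_chart c"
  shows "openin (mtop M) W \<longleftrightarrow> W \<subseteq> carrier M \<and> (\<forall>c\<in>M. open (snd c ` (W \<inter> fst c)))"
proof -
  have "istopology (\<lambda>W. W \<subseteq> carrier M \<and> (\<forall>c\<in>M. open (snd c ` (W \<inter> fst c))))"
    unfolding istopology_def
  proof (intro conjI allI impI ballI)
    fix S T c
    assume S: "S \<subseteq> carrier M \<and> (\<forall>c\<in>M. open (snd c ` (S \<inter> fst c)))"
      and T: "T \<subseteq> carrier M \<and> (\<forall>c\<in>M. open (snd c ` (T \<inter> fst c)))" and c: "c \<in> M"
    have "inj_on (snd c) (fst c)"
      using assms c by (auto simp: is_chart_def)
    then have "snd c ` (S \<inter> T \<inter> fst c) = snd c ` (S \<inter> fst c) \<inter> snd c ` (T \<inter> fst c)"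
      by (auto simp: inj_on_def)
    then show "open (snd c ` (S \<inter> T \<inter> fst c))"
      using S T c by auto
  next
    fix K c
    assume K: "\<forall>W\<in>K. W \<subseteq> carrier M \<and> (\<forall>c\<in>M. open (snd c ` (W \<inter> fst c)))" and c: "c \<in> M"
    have "snd c ` (\<Union>K \<inter> fst c) = (\<Union>W\<in>K. snd c ` (W \<inter> fst c))"
      by auto
    then show "open (snd c ` (\<Union>K \<inter> fst c))"
      using K c by auto
  qed auto
  then show ?thesis
    by (simp add: mtop_def)
qed

definition smooth_manifold :: "('p, 'e::euclidean_space) chart set \<Rightarrow> bool" where
  "smooth_manifold M \<longleftrightarrow>
     (\<forall>c\<in>M. is_chart c) \<and> (\<forall>c\<in>M. \<forall>c'\<in>M. compatible c c') \<and>
     Hausdorff_space (mtop M) \<and> second_countable (mtop M)"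

(* The charts of the maximal atlas. *)
definition smooth_chart :: "('p, 'e::euclidean_space) chart set \<Rightarrow> ('p, 'e) chart \<Rightarrow> bool" where
  "smooth_chart M c \<longleftrightarrow> is_chart c \<and> fst c \<subseteq> carrier M \<and> (\<forall>c'\<in>M. compatible c c')"

(* For W open in M. *)
definition smooth_fun_on ::
  "('p, 'e::euclidean_space) chart set \<Rightarrow> 'p set \<Rightarrow> ('p \<Rightarrow> 'b::real_normed_vector) \<Rightarrow> bool" where
  "smooth_fun_on M W f \<longleftrightarrow> (\<forall>c\<in>M. smooth_on (snd c ` (W \<inter> fst c)) (f \<circ> chart_inv c))"

(* Smoothness on an arbitrary subset S: local smooth extendability. For an embedded submanifold S
   this is smoothness for its induced manifold structure. *)
definition smooth_fun_on_subset ::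
  "('p, 'e::euclidean_space) chart set \<Rightarrow> 'p set \<Rightarrow> ('p \<Rightarrow> 'b::real_normed_vector) \<Rightarrow> bool" where
  "smooth_fun_on_subset M S f \<longleftrightarrow>
     (\<forall>p\<in>S. \<exists>W h. openin (mtop M) W \<and> p \<in> W \<and> smooth_fun_on M W h \<and> (\<forall>x\<in>W \<inter> S. h x = f x))"


section \<open>Tangent vectors, vector fields and curves\<close>

(* A tangent vector at q is the family of its coordinate representations in the charts around q,
   which transform by the derivatives of the coordinate changes; the entries at all other
   charts are set to 0. *)
type_synonym ('p, 'e) tvec = "('p, 'e) chart \<Rightarrow> 'e"

type_synonym ('p, 'e) vfield = "'p \<Rightarrow> ('p, 'e) tvec"

definition tangent_space :: "('p, 'e::euclidean_space) chart set \<Rightarrow> 'p \<Rightarrow> ('p, 'e) tvec set" where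
  "tangent_space M q = {v.
     (\<forall>c\<in>M. \<forall>c'\<in>M. q \<in> fst c \<inter> fst c' \<longrightarrow>
        v c' = frechet_derivative (snd c' \<circ> chart_inv c) (at (snd c q)) (v c)) \<and>
     (\<forall>c. \<not> (c \<in> M \<and> q \<in> fst c) \<longrightarrow> v c = 0)}"

(* The tangent vector at q whose representation in the chart c is y. *)
definition coord_vec ::
  "('p, 'e::euclidean_space) chart set \<Rightarrow> ('p, 'e) chart \<Rightarrow> 'p \<Rightarrow> 'e \<Rightarrow> ('p, 'e) tvec" where
  "coord_vec M c q y = (\<lambda>c'. if c' \<in> M \<and> q \<in> fst c'
     then frechet_derivative (snd c' \<circ> chart_inv c) (at (snd c q)) y else 0)"

definition smooth_vfield_on ::
  "('p, 'e::euclidean_space) chart set \<Rightarrow> 'p set \<Rightarrow> ('p, 'e) vfield \<Rightarrow> bool" where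
  "smooth_vfield_on M W X \<longleftrightarrow>
     (\<forall>q\<in>W. X q \<in> tangent_space M q) \<and> (\<forall>c\<in>M. smooth_fun_on M (W \<inter> fst c) (\<lambda>q. X q c))"

abbreviation smooth_vfield :: "('p, 'e::euclidean_space) chart set \<Rightarrow> ('p, 'e) vfield \<Rightarrow> bool" where
  "smooth_vfield M \<equiv> smooth_vfield_on M (carrier M)"

(* The derivative of the function f along the tangent vector v at q. *)
definition deriv_along ::
  "('p, 'e::euclidean_space) chart set \<Rightarrow> ('p \<Rightarrow> real) \<Rightarrow> 'p \<Rightarrow> ('p, 'e) tvec \<Rightarrow> real" where
  "deriv_along M f q v =
     (let c = SOME c. c \<in> M \<and> q \<in> fst c
      in frechet_derivative (f \<circ> chart_inv c) (at (snd c q)) (v c))"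

abbreviation vf_deriv ::
  "('p, 'e::euclidean_space) chart set \<Rightarrow> ('p, 'e) vfield \<Rightarrow> ('p \<Rightarrow> real) \<Rightarrow> 'p \<Rightarrow> real" where
  "vf_deriv M X f \<equiv> (\<lambda>q. deriv_along M f q (X q))"

definition differentiable_curve ::
  "('p, 'e::euclidean_space) chart set \<Rightarrow> real set \<Rightarrow> (real \<Rightarrow> 'p) \<Rightarrow> bool" where
  "differentiable_curve M J \<gamma> \<longleftrightarrow> \<gamma> ` J \<subseteq> carrier M \<and>
     (\<forall>c\<in>M. open {t\<in>J. \<gamma> t \<in> fst c} \<and> (snd c \<circ> \<gamma>) differentiable_on {t\<in>J. \<gamma> t \<in> fst c})"

definition smooth_curve ::
  "('p, 'e::euclidean_space) chart set \<Rightarrow> real set \<Rightarrow> (real \<Rightarrow> 'p) \<Rightarrow> bool" where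
  "smooth_curve M J \<gamma> \<longleftrightarrow> \<gamma> ` J \<subseteq> carrier M \<and>
     (\<forall>c\<in>M. open {t\<in>J. \<gamma> t \<in> fst c} \<and> smooth_on {t\<in>J. \<gamma> t \<in> fst c} (snd c \<circ> \<gamma>))"

definition velocity ::
  "('p, 'e::euclidean_space) chart set \<Rightarrow> (real \<Rightarrow> 'p) \<Rightarrow> real \<Rightarrow> ('p, 'e) tvec" where
  "velocity M \<gamma> t = (\<lambda>c. if c \<in> M \<and> \<gamma> t \<in> fst c then vector_derivative (snd c \<circ> \<gamma>) (at t) else 0)"

definition open_interval :: "real set \<Rightarrow> bool" where
  "open_interval J \<longleftrightarrow> open J \<and> is_interval J"

definition integral_curve ::
  "('p, 'e::euclidean_space) chart set \<Rightarrow> ('p, 'e) vfield \<Rightarrow> real set \<Rightarrow> (real \<Rightarrow> 'p) \<Rightarrow> bool" where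
  "integral_curve M Z J \<gamma> \<longleftrightarrow>
     differentiable_curve M J \<gamma> \<and> (\<forall>t\<in>J. velocity M \<gamma> t = Z (\<gamma> t))"


section \<open>The tangent bundle\<close>

type_synonym ('p, 'e) tpoint = "'p \<times> ('p, 'e) tvec"

definition tangent_chart ::
  "('p, 'e::euclidean_space) chart set \<Rightarrow> ('p, 'e) chart \<Rightarrow> (('p, 'e) tpoint, 'e \<times> 'e) chart" where
  "tangent_chart M c =
     (Sigma (fst c) (tangent_space M), \<lambda>v. (snd c (fst v), snd v c))"

(* The tangent bundle is again a manifold, modelled on the product space, so that the notions
   above apply to it: a vector field on TQ is a vector field of the manifold TQ. *)
definition tangent_bundle ::
  "('p, 'e::euclidean_space) chart set \<Rightarrow> (('p, 'e) tpoint, 'e \<times> 'e) chart set" where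
  "tangent_bundle M = tangent_chart M ` M"

definition velocity_curve ::
  "('p, 'e::euclidean_space) chart set \<Rightarrow> (real \<Rightarrow> 'p) \<Rightarrow> real \<Rightarrow> ('p, 'e) tpoint" where
  "velocity_curve M q t = (q t, velocity M q t)"

definition vertical_lift ::
  "('p, 'e::euclidean_space) chart set \<Rightarrow> ('p, 'e) vfield \<Rightarrow> (('p, 'e) tpoint, 'e \<times> 'e) vfield" where
  "vertical_lift M X v = velocity (tangent_bundle M) (\<lambda>t. (fst v, snd v + t *\<^sub>R X (fst v))) 0"


section \<open>Covectors, forces and metrics\<close>

(* Covectors at q matter only on the tangent space at q; their values elsewhere are junk. *)
definition covector ::
  "('p, 'e::euclidean_space) chart set \<Rightarrow> 'p \<Rightarrow> (('p, 'e) tvec \<Rightarrow> real) \<Rightarrow> bool" where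
  "covector M q \<alpha> \<longleftrightarrow>
     (\<forall>v\<in>tangent_space M q. \<forall>w\<in>tangent_space M q. \<alpha> (v + w) = \<alpha> v + \<alpha> w) \<and>
     (\<forall>s. \<forall>v\<in>tangent_space M q. \<alpha> (s *\<^sub>R v) = s * \<alpha> v)"

definition one_form ::
  "('p, 'e::euclidean_space) chart set \<Rightarrow> ('p \<Rightarrow> ('p, 'e) tvec \<Rightarrow> real) \<Rightarrow> bool" where
  "one_form M \<alpha> \<longleftrightarrow> (\<forall>q\<in>carrier M. covector M q (\<alpha> q)) \<and>
     (\<forall>c\<in>M. \<forall>y. smooth_fun_on M (fst c) (\<lambda>q. \<alpha> q (coord_vec M c q y)))"

(* A smooth fibre-preserving map from TQ to T*Q: F v is a covector at the base point of v. *)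
definition external_force ::
  "('p, 'e::euclidean_space) chart set \<Rightarrow> (('p, 'e) tpoint \<Rightarrow> ('p, 'e) tvec \<Rightarrow> real) \<Rightarrow> bool" where
  "external_force M F \<longleftrightarrow>
     (\<forall>v\<in>carrier (tangent_bundle M). covector M (fst v) (F v)) \<and>
     (\<forall>c\<in>M. \<forall>y. smooth_fun_on (tangent_bundle M) (fst (tangent_chart M c))
        (\<lambda>v. F v (coord_vec M c (fst v) y)))"

definition riemannian_metric ::
  "('p, 'e::euclidean_space) chart set \<Rightarrow> ('p \<Rightarrow> ('p, 'e) tvec \<Rightarrow> ('p, 'e) tvec \<Rightarrow> real) \<Rightarrow> bool" where
  "riemannian_metric M g \<longleftrightarrow>
     (\<forall>q\<in>carrier M. \<forall>v\<in>tangent_space M q.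
        covector M q (g q v) \<and> (\<forall>w\<in>tangent_space M q. g q v w = g q w v) \<and>
        (v \<noteq> 0 \<longrightarrow> 0 < g q v v)) \<and>
     (\<forall>c\<in>M. \<forall>y z. smooth_fun_on M (fst c) (\<lambda>q. g q (coord_vec M c q y) (coord_vec M c q z)))"

(* The inverse of the flat map, fibrewise. *)
definition sharp ::
  "('p, 'e::euclidean_space) chart set \<Rightarrow> ('p \<Rightarrow> ('p, 'e) tvec \<Rightarrow> ('p, 'e) tvec \<Rightarrow> real) \<Rightarrow>
   'p \<Rightarrow> (('p, 'e) tvec \<Rightarrow> real) \<Rightarrow> ('p, 'e) tvec" where
  "sharp M g q \<alpha> = (THE v. v \<in> tangent_space M q \<and> (\<forall>w\<in>tangent_space M q. g q v w = \<alpha> w))"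


section \<open>The Levi-Civita connection and mechanical systems\<close>

definition affine_connection ::
  "('p, 'e::euclidean_space) chart set \<Rightarrow> (('p, 'e) vfield \<Rightarrow> ('p, 'e) vfield \<Rightarrow> ('p, 'e) vfield) \<Rightarrow> bool"
  where
  "affine_connection M nabla \<longleftrightarrow>
     (\<forall>X Y. smooth_vfield M X \<longrightarrow> smooth_vfield M Y \<longrightarrow> smooth_vfield M (nabla X Y)) \<and>
     (\<forall>X X' Y. smooth_vfield M X \<longrightarrow> smooth_vfield M X' \<longrightarrow> smooth_vfield M Y \<longrightarrow>
        (\<forall>q\<in>carrier M. nabla (\<lambda>p. X p + X' p) Y q = nabla X Y q + nabla X' Y q \<and>
                       nabla Y (\<lambda>p. X p + X' p) q = nabla Y X q + nabla Y X' q)) \<and>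
     (\<forall>f X Y. smooth_fun_on M (carrier M) f \<longrightarrow> smooth_vfield M X \<longrightarrow> smooth_vfield M Y \<longrightarrow>
        (\<forall>q\<in>carrier M. nabla (\<lambda>p. f p *\<^sub>R X p) Y q = f q *\<^sub>R nabla X Y q \<and>
                       nabla X (\<lambda>p. f p *\<^sub>R Y p) q = vf_deriv M X f q *\<^sub>R Y q + f q *\<^sub>R nabla X Y q))"

(* Torsion-freeness says that nabla X Y - nabla Y X is the Lie bracket of X and Y, the latter
   being given by its action on smooth functions. *)
definition levi_civita ::
  "('p, 'e::euclidean_space) chart set \<Rightarrow> ('p \<Rightarrow> ('p, 'e) tvec \<Rightarrow> ('p, 'e) tvec \<Rightarrow> real) \<Rightarrow>
   (('p, 'e) vfield \<Rightarrow> ('p, 'e) vfield \<Rightarrow> ('p, 'e) vfield) \<Rightarrow> bool" where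
  "levi_civita M g nabla \<longleftrightarrow> affine_connection M nabla \<and>
     (\<forall>X Y f. smooth_vfield M X \<longrightarrow> smooth_vfield M Y \<longrightarrow> smooth_fun_on M (carrier M) f \<longrightarrow>
        (\<forall>q\<in>carrier M. deriv_along M f q (nabla X Y q - nabla Y X q) =
           vf_deriv M X (vf_deriv M Y f) q - vf_deriv M Y (vf_deriv M X f) q)) \<and>
     (\<forall>X Y Z. smooth_vfield M X \<longrightarrow> smooth_vfield M Y \<longrightarrow> smooth_vfield M Z \<longrightarrow>
        (\<forall>q\<in>carrier M. vf_deriv M X (\<lambda>p. g p (Y p) (Z p)) q =
           g q (nabla X Y q) (Z q) + g q (Y q) (nabla X Z q)))"

(* The covariant derivative at time t of the velocity of the curve q along q. Near t the velocity
   is written as a combination of vector fields with coefficients depending on time; by the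
   Leibniz rule the value a does not depend on the chosen representation, and a representation
   exists for every smooth curve (extend a coordinate frame by a bump function). *)
definition has_covariant_acceleration ::
  "('p, 'e::euclidean_space) chart set \<Rightarrow> (('p, 'e) vfield \<Rightarrow> ('p, 'e) vfield \<Rightarrow> ('p, 'e) vfield) \<Rightarrow>
   (real \<Rightarrow> 'p) \<Rightarrow> real \<Rightarrow> ('p, 'e) tvec \<Rightarrow> bool" where
  "has_covariant_acceleration M nabla q t a \<longleftrightarrow>
     (\<exists>(E :: 'e \<Rightarrow> ('p, 'e) vfield) (h :: 'e \<Rightarrow> real \<Rightarrow> real) \<epsilon>.
        0 < \<epsilon> \<and> (\<forall>i\<in>Basis. smooth_vfield M (E i) \<and> smooth_on (ball t \<epsilon>) (h i)) \<and>
        (\<forall>s\<in>ball t \<epsilon>. velocity M q s = (\<Sum>i\<in>Basis. h i s *\<^sub>R E i (q s))) \<and>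
        a = (\<Sum>i\<in>Basis. deriv (h i) t *\<^sub>R E i (q t)) +
            (\<Sum>j\<in>Basis. \<Sum>i\<in>Basis. (h j t * h i t) *\<^sub>R nabla (E j) (E i) (q t)))"

definition solution ::
  "('p, 'e::euclidean_space) chart set \<Rightarrow> (('p, 'e) vfield \<Rightarrow> ('p, 'e) vfield \<Rightarrow> ('p, 'e) vfield) \<Rightarrow>
   (('p, 'e) tpoint \<Rightarrow> ('p, 'e) tvec) \<Rightarrow> real set \<Rightarrow> (real \<Rightarrow> 'p) \<Rightarrow> bool" where
  "solution M nabla Y0 J q \<longleftrightarrow> smooth_curve M J q \<and>
     (\<forall>t\<in>J. has_covariant_acceleration M nabla q t (Y0 (velocity_curve M q t)))"

(* G is the vector field on TQ whose integral curves are the velocity curves of solutions. *)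
definition dynamics_field ::
  "('p, 'e::euclidean_space) chart set \<Rightarrow> (('p, 'e) vfield \<Rightarrow> ('p, 'e) vfield \<Rightarrow> ('p, 'e) vfield) \<Rightarrow>
   (('p, 'e) tpoint \<Rightarrow> ('p, 'e) tvec) \<Rightarrow> (('p, 'e) tpoint, 'e \<times> 'e) vfield \<Rightarrow> bool" where
  "dynamics_field M nabla Y0 G \<longleftrightarrow> smooth_vfield (tangent_bundle M) G \<and>
     (\<forall>J \<gamma>. open_interval J \<longrightarrow>
        (integral_curve (tangent_bundle M) G J \<gamma> \<longleftrightarrow>
         (\<exists>q. solution M nabla Y0 J q \<and> (\<forall>t\<in>J. \<gamma> t = velocity_curve M q t))))"

definition closed_loop ::
  "('p, 'e::euclidean_space) chart set \<Rightarrow> (('p, 'e) tpoint, 'e \<times> 'e) vfield \<Rightarrow>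
   ('m::finite \<Rightarrow> ('p, 'e) vfield) \<Rightarrow> (('p, 'e) tpoint \<Rightarrow> real ^ 'm) \<Rightarrow>
   (('p, 'e) tpoint, 'e \<times> 'e) vfield" where
  "closed_loop M G Y u v = G v + (\<Sum>a\<in>UNIV. (u v $ a) *\<^sub>R vertical_lift M (Y a) v)"


section \<open>Distributions\<close>

definition distribution ::
  "('p, 'e::euclidean_space) chart set \<Rightarrow> nat \<Rightarrow> ('p \<Rightarrow> ('p, 'e) tvec set) \<Rightarrow> bool" where
  "distribution M r D \<longleftrightarrow>
     (\<forall>q\<in>carrier M. subspace (D q) \<and> D q \<subseteq> tangent_space M q \<and> dim (D q) = r) \<and>
     (\<forall>q\<in>carrier M. \<exists>W (X :: nat \<Rightarrow> ('p, 'e) vfield). openin (mtop M) W \<and> q \<in> W \<and>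
        (\<forall>i<r. smooth_vfield_on M W (X i)) \<and> (\<forall>p\<in>W. D p = span ((\<lambda>i. X i p) ` {..<r})))"

(* Local slice condition; the slices are taken in charts of the maximal atlas. *)
definition embedded_submanifold ::
  "('p, 'e::euclidean_space) chart set \<Rightarrow> nat \<Rightarrow> 'p set \<Rightarrow> bool" where
  "embedded_submanifold M k N \<longleftrightarrow> N \<subseteq> carrier M \<and>
     (\<forall>p\<in>N. \<exists>c I. smooth_chart M c \<and> p \<in> fst c \<and> I \<subseteq> Basis \<and> card I = k \<and>
        (\<forall>x\<in>fst c. x \<in> N \<longleftrightarrow> (\<forall>b\<in>Basis - I. snd c x \<bullet> b = snd c p \<bullet> b)))"

definition tangent_vectors_to ::
  "('p, 'e::euclidean_space) chart set \<Rightarrow> 'p set \<Rightarrow> 'p \<Rightarrow> ('p, 'e) tvec set" where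
  "tangent_vectors_to M N p =
     {velocity M \<gamma> 0 |\<gamma> \<epsilon>. 0 < \<epsilon> \<and> smooth_curve M {-\<epsilon><..<\<epsilon>} \<gamma> \<and> \<gamma> ` {-\<epsilon><..<\<epsilon>} \<subseteq> N \<and> \<gamma> 0 = p}"

(* Through every point passes an integral manifold. Immersed integral manifolds give the same
   notion, since a small piece of one around a given point is embedded. *)
definition integrable_distribution ::
  "('p, 'e::euclidean_space) chart set \<Rightarrow> nat \<Rightarrow> ('p \<Rightarrow> ('p, 'e) tvec set) \<Rightarrow> bool" where
  "integrable_distribution M r D \<longleftrightarrow>
     (\<forall>q\<in>carrier M. \<exists>N. q \<in> N \<and> embedded_submanifold M r N \<and>
        (\<forall>p\<in>N. tangent_vectors_to M N p = D p))"

definition affine_distribution ::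
  "('p, 'e) vfield \<Rightarrow> ('p \<Rightarrow> ('p, 'e::euclidean_space) tvec set) \<Rightarrow> 'p \<Rightarrow> ('p, 'e) tvec set" where
  "affine_distribution X D q = {X q + d |d. d \<in> D q}"

definition total_set ::
  "('p, 'e::euclidean_space) chart set \<Rightarrow> ('p \<Rightarrow> ('p, 'e) tvec set) \<Rightarrow> ('p, 'e) tpoint set" where
  "total_set M A = Sigma (carrier M) A"

definition input_distribution ::
  "('m::finite \<Rightarrow> ('p, 'e::euclidean_space) vfield) \<Rightarrow> 'p \<Rightarrow> ('p, 'e) tvec set" where
  "input_distribution Y q = span (range (\<lambda>a. Y a q))"

definition model_subspace :: "'v::real_vector set \<Rightarrow> 'v set" where
  "model_subspace W = {w - w' |w w'. w \<in> W \<and> w' \<in> W}"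

(* For affine subspaces W1 and W2 of V. *)
definition transversal_in :: "'v::real_vector set \<Rightarrow> 'v set \<Rightarrow> 'v set \<Rightarrow> bool" where
  "transversal_in V W1 W2 \<longleftrightarrow> V = {w1 + w2 |w1 w2. w1 \<in> W1 \<and> w2 \<in> W2} \<and>
     dim V = dim (model_subspace W1) + dim (model_subspace W2)"

definition transversal ::
  "('p, 'e::euclidean_space) chart set \<Rightarrow> ('p \<Rightarrow> ('p, 'e) tvec set) \<Rightarrow> ('p \<Rightarrow> ('p, 'e) tvec set) \<Rightarrow> bool"
  where
  "transversal M A F \<longleftrightarrow> (\<forall>q\<in>carrier M. transversal_in (tangent_space M q) (A q) (F q))"


section \<open>Virtual affine nonholonomic constraints\<close>

(* Control functions are defined on the set S of TQ only; they are made unique as HOL functions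
   by requiring them to be undefined outside S. *)
definition control_function ::
  "('p, 'e::euclidean_space) chart set \<Rightarrow> ('p, 'e) tpoint set \<Rightarrow> (('p, 'e) tpoint \<Rightarrow> real ^ 'm) \<Rightarrow> bool"
  where
  "control_function M S u \<longleftrightarrow> u \<in> extensional S \<and> smooth_fun_on_subset (tangent_bundle M) S u"

(* Every closed-loop solution that starts in S remains in S as long as it is defined. As u lives
   on S only, the closed loop is formed with any smooth extension w of u to an open set W;
   smooth control functions have such extensions around every point of S. *)
definition makes_virtual_constraint ::
  "('p, 'e::euclidean_space) chart set \<Rightarrow> (('p, 'e) tpoint, 'e \<times> 'e) vfield \<Rightarrow>
   ('m::finite \<Rightarrow> ('p, 'e) vfield) \<Rightarrow> ('p, 'e) tpoint set \<Rightarrow> (('p, 'e) tpoint \<Rightarrow> real ^ 'm) \<Rightarrow> bool"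
  where
  "makes_virtual_constraint M G Y S u \<longleftrightarrow>
     (\<forall>W w J \<gamma>. openin (mtop (tangent_bundle M)) W \<longrightarrow> smooth_fun_on (tangent_bundle M) W w \<longrightarrow>
        (\<forall>v\<in>W \<inter> S. w v = u v) \<longrightarrow> open_interval J \<longrightarrow> 0 \<in> J \<longrightarrow> \<gamma> ` J \<subseteq> W \<longrightarrow>
        integral_curve (tangent_bundle M) (closed_loop M G Y w) J \<gamma> \<longrightarrow> \<gamma> 0 \<in> S \<longrightarrow>
        \<gamma> ` J \<subseteq> S)"

end

theory Submission
  imports Defs
begin

text \<open>Since \<open>T Q\<close> is the direct sum of \<open>\<D>\<close> and the input distribution, every tangent vector \<open>v\<close> at
  \<open>q\<close> has coefficients \<open>y(q)(v)\<close> along \<open>Y\<^sup>1, \<dots>, Y\<^sup>m\<close>, with kernel \<open>\<D>\<^sub>q\<close>. The affine distribution is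
  the zero set of the smooth map \<open>\<Phi>(q, v) = y(q)(v - X(q))\<close> on \<open>TQ\<close>, whose derivative along the
  vertical lift of \<open>Y\<^sup>a\<close> is the \<open>a\<close>-th unit vector. So \<open>\<Phi>\<close> changes along a closed-loop solution at the
  rate \<open>d\<Phi>(G) + u\<close>, and the only candidate for the control is \<open>u = - d\<Phi>(G)\<close> on the zero set. For an
  arbitrary smooth extension \<open>w\<close> of this \<open>u\<close> the rate is bounded by a multiple of \<open>|\<Phi>|\<close> near the zero
  set, so Gronwall's inequality keeps solutions in it. Conversely, for an invariant control, the
  closed-loop solution through a point of the zero set (Picard-Lindelof) has vanishing rate there.\<close>

section \<open>Smooth maps between Euclidean spaces\<close>

text \<open>What makes \<open>\<Phi>\<close> a smooth function on \<open>TQ\<close>: the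
  distribution \<open>\<D>\<close> has only local frames, but the coefficients along
  \<open>Y\<^sup>a\<close> refer to \<open>\<D>\<close> itself and to no frame, so local
  computations glue by themselves. In a frame they are components of the solution of a linear system
  whose matrix depends smoothly on the point and is injective; \<open>sharp\<close>, hence
  \<open>Y\<^sup>a\<close>, solves such a system too, with the Gram matrix of the metric. One lemma
  on such systems serves both; instead of inverting a variable matrix it uses a left inverse at a
  single point.

  What makes Gronwall applicable: \<open>d\<Phi>(G)\<close> is defined on all of \<open>TQ\<close>,
  so \<open>w + d\<Phi>(G)\<close> is a smooth function on an open set that vanishes on the zero set
  of \<open>\<Phi>\<close>. Such a function is locally \<open>O(|\<Phi>|)\<close>, because from a
  nearby point the zero set is reached by a vertical step of length \<open>O(|\<Phi>|)\<close>. The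
  constant is local, so invariance along a whole solution needs a connectedness argument on its time
  interval.\<close>

lemma linear_eq_sum_Basis:
  fixes f :: "'a::euclidean_space \<Rightarrow> 'b::real_vector"
  assumes "linear f"
  shows "f v = (\<Sum>i\<in>Basis. (v \<bullet> i) *\<^sub>R f i)"
  using linear_sum[OF assms, of "\<lambda>i. (v \<bullet> i) *\<^sub>R i" Basis]
  by (simp add: linear_cmul[OF assms] euclidean_representation)

section \<open>Calculus of \<open>Ck_on\<close>: sums, products, compositions\<close>

lemma Ck_on_SucD:
  assumes "Ck_on (Suc k) S f" "x \<in> S"
  shows "(f has_derivative frechet_derivative f (at x)) (at x)"
  using assms by (simp add: frechet_derivative_works)

text \<open>Derivatives see a neighbourhood, so functions that agree on an open set also have the
  same derivatives there, and the induction can continue with these.\<close>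

lemma Ck_on_cong:
  assumes "open S" "\<And>x. x \<in> S \<Longrightarrow> f x = g x" "Ck_on k S f"
  shows "Ck_on k S g"
  using assms
proof (induction k arbitrary: f g)
  case 0
  then show ?case
    using continuous_on_cong[of S S f g] by simp
next
  case (Suc k)
  have der: "(g has_derivative frechet_derivative f (at x)) (at x)" if "x \<in> S" for x
    using Ck_on_SucD[OF Suc.prems(3) that] Suc.prems(1) that Suc.prems(2)
    by (rule has_derivative_transform_within_open)
  have "Ck_on k S (\<lambda>x. frechet_derivative g (at x) v)" for v
  proof (rule Suc.IH[OF Suc.prems(1)])
    show "Ck_on k S (\<lambda>x. frechet_derivative f (at x) v)"
      using Suc.prems(3) by simp
    show "frechet_derivative f (at x) v = frechet_derivative g (at x) v" if "x \<in> S" for x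
      using frechet_derivative_at[OF der[OF that]] by simp
  qed
  moreover have "g differentiable (at x)" if "x \<in> S" for x
    using der[OF that] by (auto simp: differentiable_def)
  ultimately show ?case
    by simp
qed

text \<open>Derivatives are unique, so any explicit formula \<open>f'\<close> may stand in for
  \<open>frechet_derivative\<close>. The closure lemmas below use it to turn the sum, product and
  chain rules into induction steps.\<close>

lemma Ck_on_SucI:
  assumes "open S" "\<And>x. x \<in> S \<Longrightarrow> (f has_derivative f' x) (at x)"
    and "\<And>v. Ck_on k S (\<lambda>x. f' x v)"
  shows "Ck_on (Suc k) S f"
proof -
  have "Ck_on k S (\<lambda>x. frechet_derivative f (at x) v)" for v
    by (rule Ck_on_cong[OF assms(1) _ assms(3)[of v]])
      (use frechet_derivative_at[OF assms(2)] in simp)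
  then show ?thesis
    using assms(2) by (auto simp: differentiable_def)
qed

lemma Ck_on_subset: "Ck_on k S f \<Longrightarrow> T \<subseteq> S \<Longrightarrow> Ck_on k T f"
  by (induction k arbitrary: f) (auto intro: continuous_on_subset)

text \<open>At level 0 this is continuity of differentiable functions. It is needed because the
  product and chain rules leave undifferentiated factors, which the induction must see at the lower
  order.\<close>

lemma Ck_on_Suc_imp: "Ck_on (Suc k) S f \<Longrightarrow> Ck_on k S f"
proof (induction k arbitrary: f)
  case 0
  then show ?case
    by (auto intro!: continuous_at_imp_continuous_on differentiable_imp_continuous_within)
next
  case (Suc k)
  have "Ck_on k S (\<lambda>x. frechet_derivative f (at x) v)" for v
    using Suc.prems by (intro Suc.IH) auto
  then show ?case
    using Suc.prems by auto
qed

lemma Ck_on_local: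
  assumes "\<And>x. x \<in> S \<Longrightarrow> \<exists>U. open U \<and> x \<in> U \<and> Ck_on k U f"
  shows "Ck_on k S f"
  using assms
proof (induction k arbitrary: f)
  case 0
  have "isCont f x" if "x \<in> S" for x
    using 0[OF that] continuous_on_eq_continuous_at by auto
  then show ?case
    by (simp add: continuous_at_imp_continuous_on)
next
  case (Suc k)
  have "Ck_on k S (\<lambda>x. frechet_derivative f (at x) v)" for v
  proof (rule Suc.IH)
    fix x assume "x \<in> S"
    from Suc.prems[OF this]
    show "\<exists>U. open U \<and> x \<in> U \<and> Ck_on k U (\<lambda>x. frechet_derivative f (at x) v)"
      by auto
  qed
  moreover have "f differentiable (at x)" if "x \<in> S" for x
    using Suc.prems[OF that] by auto
  ultimately show ?case
    by simp
qed

lemma Ck_on_const: "Ck_on k S (\<lambda>x. c)"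
  by (induction k arbitrary: c) auto

lemma Ck_on_bounded_linear:
  assumes "open S" "bounded_linear L" "Ck_on k S f"
  shows "Ck_on k S (\<lambda>x. L (f x))"
  using assms(3)
proof (induction k arbitrary: f)
  case 0
  then show ?case
    using assms(2) by (auto intro: bounded_linear.continuous_on)
next
  case (Suc k)
  show ?case
  proof (rule Ck_on_SucI[OF assms(1)])
    show "((\<lambda>x. L (f x)) has_derivative (\<lambda>v. L (frechet_derivative f (at x) v))) (at x)"
      if "x \<in> S" for x
      using bounded_linear.has_derivative[OF assms(2) Ck_on_SucD[OF Suc.prems that]] .
    show "Ck_on k S (\<lambda>x. L (frechet_derivative f (at x) v))" for v
      using Suc.prems by (intro Suc.IH) simp
  qed
qed

lemma Ck_on_ident: "open S \<Longrightarrow> Ck_on k S (\<lambda>x. x)"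
proof (induction k)
  case (Suc k)
  show ?case
    by (rule Ck_on_SucI[OF Suc.prems, where f' = "\<lambda>x v. v"])
      (auto intro: has_derivative_ident Ck_on_const)
qed simp

lemma Ck_on_add:
  assumes "open S" "Ck_on k S f" "Ck_on k S g"
  shows "Ck_on k S (\<lambda>x. f x + g x)"
  using assms(2,3)
proof (induction k arbitrary: f g)
  case 0
  then show ?case
    by (auto intro: continuous_on_add)
next
  case (Suc k)
  show ?case
  proof (rule Ck_on_SucI[OF assms(1)])
    show "((\<lambda>x. f x + g x) has_derivative
        (\<lambda>v. frechet_derivative f (at x) v + frechet_derivative g (at x) v)) (at x)" if "x \<in> S" for x
      using Suc.prems that by (intro has_derivative_add Ck_on_SucD)
    show "Ck_on k S (\<lambda>x. frechet_derivative f (at x) v + frechet_derivative g (at x) v)" for v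
      using Suc.prems by (intro Suc.IH) simp_all
  qed
qed

lemma Ck_on_diff:
  assumes "open S" "Ck_on k S f" "Ck_on k S g"
  shows "Ck_on k S (\<lambda>x. f x - g x)"
  using Ck_on_add[OF assms(1,2)
      Ck_on_bounded_linear[OF assms(1) bounded_linear_minus[OF bounded_linear_ident] assms(3)]]
  by simp

lemma Ck_on_bilinear:
  assumes "open S" "bounded_bilinear p" "Ck_on k S f" "Ck_on k S g"
  shows "Ck_on k S (\<lambda>x. p (f x) (g x))"
  using assms(3,4)
proof (induction k arbitrary: f g)
  case 0
  then show ?case
    using assms(2) by (auto intro: bounded_bilinear.continuous_on)
next
  case (Suc k)
  note low = Suc.prems[THEN Ck_on_Suc_imp]
  show ?case
  proof (rule Ck_on_SucI[OF assms(1)])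
    show "((\<lambda>x. p (f x) (g x)) has_derivative
        (\<lambda>v. p (f x) (frechet_derivative g (at x) v) + p (frechet_derivative f (at x) v) (g x))) (at x)"
      if "x \<in> S" for x
      using Suc.prems that by (intro bounded_bilinear.FDERIV[OF assms(2)] Ck_on_SucD)
    show "Ck_on k S (\<lambda>x. p (f x) (frechet_derivative g (at x) v) +
        p (frechet_derivative f (at x) v) (g x))" for v
      using Suc.prems low by (intro Ck_on_add[OF assms(1)] Suc.IH) simp_all
  qed
qed

lemma Ck_on_sum:
  assumes "open S" "\<And>i. i \<in> I \<Longrightarrow> Ck_on k S (f i)"
  shows "Ck_on k S (\<lambda>x. \<Sum>i\<in>I. f i x)"
  using assms(2)
  by (induction I rule: infinite_finite_induct) (auto intro: Ck_on_add[OF assms(1)] Ck_on_const)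

lemma Ck_on_compose:
  fixes f :: "'b::euclidean_space \<Rightarrow> 'c::real_normed_vector"
    and g :: "'a::real_normed_vector \<Rightarrow> 'b"
  assumes "open S" "open T" "g ` S \<subseteq> T" "Ck_on k T f" "Ck_on k S g"
  shows "Ck_on k S (f \<circ> g)"
  using assms(4,5)
proof (induction k arbitrary: f)
  case 0
  then show ?case
    using assms(3) continuous_on_compose[of S g f] continuous_on_subset[of T f "g ` S"] by simp
next
  case (Suc k)
  note low = Suc.prems(2)[THEN Ck_on_Suc_imp]
  show ?case
  proof (rule Ck_on_SucI[OF assms(1)])
    fix x assume x: "x \<in> S"
    then have f: "(f has_derivative frechet_derivative f (at (g x))) (at (g x))"
      using assms(3) Suc.prems(1) by (intro Ck_on_SucD) auto
    \<comment> \<open>The chain rule differentiates \<open>f\<close> in a direction that varies with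
      \<open>x\<close>, whereas \<open>Ck_on\<close> speaks of fixed directions. Expanding in the
      basis leaves products of a scalar function with a fixed directional derivative of
      \<open>f\<close> composed with \<open>g\<close>, to which the induction hypothesis
      applies.\<close>
    have "frechet_derivative f (at (g x)) \<circ> frechet_derivative g (at x) =
        (\<lambda>v. \<Sum>b\<in>Basis. (frechet_derivative g (at x) v \<bullet> b) *\<^sub>R frechet_derivative f (at (g x)) b)"
    proof
      fix v
      have lin: "linear (frechet_derivative f (at (g x)))"
        using f has_derivative_linear by blast
      show "(frechet_derivative f (at (g x)) \<circ> frechet_derivative g (at x)) v =
        (\<Sum>b\<in>Basis. (frechet_derivative g (at x) v \<bullet> b) *\<^sub>R frechet_derivative f (at (g x)) b)"
        using linear_eq_sum_Basis[OF lin, of "frechet_derivative g (at x) v"] by (simp only: o_apply)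
    qed
    then show "(f \<circ> g has_derivative
        (\<lambda>v. \<Sum>b\<in>Basis. (frechet_derivative g (at x) v \<bullet> b) *\<^sub>R frechet_derivative f (at (g x)) b)) (at x)"
      using diff_chain_at[OF Ck_on_SucD[OF Suc.prems(2) x] f] by simp
  next
    fix v
    show "Ck_on k S (\<lambda>x. \<Sum>b\<in>Basis. (frechet_derivative g (at x) v \<bullet> b) *\<^sub>R
        frechet_derivative f (at (g x)) b)"
    proof (rule Ck_on_sum[OF assms(1)], rule Ck_on_bilinear[OF assms(1) bounded_bilinear_scaleR])
      fix b :: 'b
      show "Ck_on k S (\<lambda>x. frechet_derivative g (at x) v \<bullet> b)"
        using Suc.prems(2) by (intro Ck_on_bounded_linear[OF assms(1) bounded_linear_inner_left]) simp
      have "Ck_on k S ((\<lambda>y. frechet_derivative f (at y) b) \<circ> g)"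
        using Suc.prems(1) low by (intro Suc.IH) simp_all
      then show "Ck_on k S (\<lambda>x. frechet_derivative f (at (g x)) b)"
        by (simp add: o_def)
    qed
  qed
qed

section \<open>Linear systems with varying coefficients\<close>

lemma isCont_linear_solve:
  fixes A :: "'a::real_normed_vector \<Rightarrow> 'b::euclidean_space \<Rightarrow> 'c::euclidean_space"
  assumes lin: "\<And>x. x \<in> S \<Longrightarrow> linear (A x)" and "open S" "x0 \<in> S" "inj (A x0)"
    and A: "\<And>y. isCont (\<lambda>x. A x y) x0" and b: "isCont b x0"
    and eq: "\<And>x. x \<in> S \<Longrightarrow> A x (z x) = b x"
  shows "isCont z x0"
proof -
  obtain L where L: "linear L" "L \<circ> A x0 = id"
    using linear_injective_left_inverse[OF lin[OF assms(3)] assms(4)] by blast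
  have LA: "L (A x0 y) = y" for y
    using L(2) by (simp add: fun_eq_iff)
  have bL: "bounded_linear L"
    using L(1) by (simp add: linear_conv_bounded_linear)
  \<comment> \<open>\<open>A\<close> is continuous in \<open>x\<close> only for each fixed argument.
    The finitely many basis vectors still control the operator norm of
    \<open>L \<circ> (A x - A x0)\<close>, by \<open>E x\<close>, which tends to 0.\<close>
  define E where "E x = (\<Sum>i\<in>Basis. norm (L (A x i - A x0 i)))" for x
  have E0: "(E \<longlongrightarrow> 0) (at x0)"
  proof -
    have "(E \<longlongrightarrow> (\<Sum>i\<in>(Basis::'b set). norm (L (A x0 i - A x0 i)))) (at x0)"
      unfolding E_def
      by (intro tendsto_intros bounded_linear.tendsto[OF bL]) (use A in \<open>simp add: isCont_def\<close>)
    then show ?thesis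
      by (simp add: linear_0[OF L(1)])
  qed
  define N where "N x = norm (L (b x - b x0))" for x
  have N0: "(N \<longlongrightarrow> 0) (at x0)"
  proof -
    have "(N \<longlongrightarrow> norm (L (b x0 - b x0))) (at x0)"
      unfolding N_def
      by (intro tendsto_intros bounded_linear.tendsto[OF bL]) (use b in \<open>simp add: isCont_def\<close>)
    then show ?thesis
      by (simp add: linear_0[OF L(1)])
  qed
  \<comment> \<open>The left inverse \<open>L\<close> of the single map \<open>A x0\<close> rewrites
    the system as a perturbation of \<open>z x0\<close>. The last term involves the unknown
    \<open>z x\<close>, about which nothing is known yet, but with a small factor.\<close>
  have id: "z x = z x0 + L (b x - b x0) - L (A x (z x) - A x0 (z x))" if "x \<in> S" for x
    using eq[OF that] eq[OF assms(3)] LA[of "z x"] LA[of "z x0"]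
    by (simp add: linear_diff[OF L(1)])
  have bd: "norm (L (A x y - A x0 y)) \<le> E x * norm y" if "x \<in> S" for x y
  proof -
    have lin2: "linear (\<lambda>y. L (A x y - A x0 y))"
      using linear_compose[OF linear_compose_sub[OF lin[OF that] lin[OF assms(3)]] L(1)]
      by (simp add: o_def)
    then have bl: "bounded_linear (\<lambda>y. L (A x y - A x0 y))"
      by (simp add: linear_conv_bounded_linear)
    have "norm (L (A x y - A x0 y)) \<le> onorm (\<lambda>y. L (A x y - A x0 y)) * norm y"
      using onorm[OF bl] by simp
    also have "\<dots> \<le> E x * norm y"
      using onorm_componentwise[OF bl] unfolding E_def by (intro mult_right_mono) auto
    finally show ?thesis .
  qed
  have evS: "\<forall>\<^sub>F x in at x0. x \<in> S"
    using assms(2,3) by (rule eventually_at_in_open')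
  have ev: "\<forall>\<^sub>F x in at x0. norm (z x - z x0) \<le> N x + E x * (2 * (norm (z x0) + 1))"
  proof -
    have "\<forall>\<^sub>F x in at x0. E x < 1/2" "\<forall>\<^sub>F x in at x0. N x < 1"
      using order_tendstoD(2)[OF E0, of "1/2"] order_tendstoD(2)[OF N0, of 1] by simp_all
    \<comment> \<open>Once \<open>E x < 1/2\<close>, the unknown term is absorbed into the left-hand
      side, which bounds \<open>norm (z x)\<close> by \<open>2 * (norm (z x0) + 1)\<close>.
      Inserting this bound into \<open>id\<close> again gives the estimate that tends to 0.\<close>
    with evS show ?thesis
    proof eventually_elim
      case (elim x)
      have "norm (z x) \<le> norm (z x0) + N x + norm (L (A x (z x) - A x0 (z x)))"
        unfolding N_def
        using norm_triangle_ineq4[of "z x0 + L (b x - b x0)" "L (A x (z x) - A x0 (z x))"]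
          norm_triangle_ineq[of "z x0" "L (b x - b x0)"]
        by (subst id[OF elim(1)]) linarith
      also have "\<dots> \<le> norm (z x0) + 1 + E x * norm (z x)"
        using bd[OF elim(1), of "z x"] elim(3) by linarith
      also have "\<dots> \<le> norm (z x0) + 1 + 1/2 * norm (z x)"
        using elim(2) by (intro add_left_mono mult_right_mono) auto
      finally have zb: "norm (z x) \<le> 2 * (norm (z x0) + 1)"
        by simp
      have E_nn: "0 \<le> E x"
        unfolding E_def by (simp add: sum_nonneg)
      have "norm (z x - z x0) = norm (L (b x - b x0) - L (A x (z x) - A x0 (z x)))"
        using id[OF elim(1)] by (metis add.commute add_diff_cancel_right' add_diff_eq)
      also have "\<dots> \<le> N x + norm (L (A x (z x) - A x0 (z x)))"
        unfolding N_def by (rule norm_triangle_ineq4)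
      also have "\<dots> \<le> N x + E x * norm (z x)"
        using bd[OF elim(1), of "z x"] by linarith
      also have "\<dots> \<le> N x + E x * (2 * (norm (z x0) + 1))"
        using zb E_nn by (intro add_left_mono mult_left_mono)
      finally show ?case .
    qed
  qed
  have "((\<lambda>x. N x + E x * (2 * (norm (z x0) + 1))) \<longlongrightarrow> 0 + 0 * (2 * (norm (z x0) + 1))) (at x0)"
    by (intro tendsto_intros N0 E0)
  then have lim0: "((\<lambda>x. N x + E x * (2 * (norm (z x0) + 1))) \<longlongrightarrow> 0) (at x0)"
    by simp
  have "((\<lambda>x. norm (z x - z x0)) \<longlongrightarrow> 0) (at x0)"
    by (rule tendsto_sandwich[OF _ ev tendsto_const lim0]) simp
  then have "((\<lambda>x. z x - z x0) \<longlongrightarrow> 0) (at x0)"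
    by (rule tendsto_norm_zero_cancel)
  then show ?thesis
    unfolding isCont_def by (rule LIM_zero_cancel)
qed

text \<open>A product rule for a factor \<open>f\<close> that is merely continuous: as
  \<open>g\<close> vanishes at \<open>x\<close>, the remainder splits into \<open>f y\<close> times
  the remainder of \<open>g\<close>, and \<open>f y - f x\<close> times a term of order
  \<open>norm (y - x)\<close>. It yields differentiability of a solution known only to be
  continuous.\<close>

lemma has_derivative_scaleR_vanishing:
  fixes f :: "'a::real_normed_vector \<Rightarrow> real" and g :: "'a \<Rightarrow> 'b::real_normed_vector"
  assumes f: "isCont f x" and g: "(g has_derivative g') (at x)" and "g x = 0"
  shows "((\<lambda>y. f y *\<^sub>R g y) has_derivative (\<lambda>v. f x *\<^sub>R g' v)) (at x)"
proof -
  have bl: "bounded_linear g'"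
    using g by (rule has_derivative_bounded_linear)
  obtain K where K: "\<And>h. norm (g' h) \<le> norm h * K"
    using bounded_linear.bounded[OF bl] by blast
  have g0: "((\<lambda>y. norm (g y - g x - g' (y - x)) / norm (y - x)) \<longlongrightarrow> 0) (at x)"
    using g by (simp add: has_derivative_iff_norm)
  have f0: "((\<lambda>y. f y - f x) \<longlongrightarrow> 0) (at x)"
    using f by (simp add: isCont_def LIM_zero)
  have "((\<lambda>y. \<bar>f y\<bar> * (norm (g y - g x - g' (y - x)) / norm (y - x)) + \<bar>f y - f x\<bar> * \<bar>K\<bar>)
      \<longlongrightarrow> \<bar>f x\<bar> * 0 + \<bar>0\<bar> * \<bar>K\<bar>) (at x)"
    by (intro tendsto_intros g0 f0) (use f in \<open>simp add: isCont_def\<close>)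
  then have lim: "((\<lambda>y. \<bar>f y\<bar> * (norm (g y - g x - g' (y - x)) / norm (y - x)) + \<bar>f y - f x\<bar> * \<bar>K\<bar>)
      \<longlongrightarrow> 0) (at x)"
    by simp
  have le: "norm (f y *\<^sub>R g y - f x *\<^sub>R g x - f x *\<^sub>R g' (y - x)) / norm (y - x)
      \<le> \<bar>f y\<bar> * (norm (g y - g x - g' (y - x)) / norm (y - x)) + \<bar>f y - f x\<bar> * \<bar>K\<bar>"
    if "y \<noteq> x" for y
  proof -
    have pos: "norm (y - x) > 0"
      using that by simp
    have "f y *\<^sub>R g y - f x *\<^sub>R g x - f x *\<^sub>R g' (y - x)
        = f y *\<^sub>R (g y - g x - g' (y - x)) + (f y - f x) *\<^sub>R g' (y - x)"
      using assms(3) by (simp add: algebra_simps)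
    then have "norm (f y *\<^sub>R g y - f x *\<^sub>R g x - f x *\<^sub>R g' (y - x))
        \<le> \<bar>f y\<bar> * norm (g y - g x - g' (y - x)) + \<bar>f y - f x\<bar> * norm (g' (y - x))"
      by (metis norm_scaleR norm_triangle_ineq)
    also have "\<dots> \<le> \<bar>f y\<bar> * norm (g y - g x - g' (y - x)) + \<bar>f y - f x\<bar> * (norm (y - x) * \<bar>K\<bar>)"
    proof -
      have "norm (g' (y - x)) \<le> norm (y - x) * \<bar>K\<bar>"
        using K[of "y - x"] by (smt (verit) mult_left_mono norm_ge_zero)
      then show ?thesis
        by (intro add_left_mono mult_left_mono) auto
    qed
    finally show ?thesis
      using pos by (simp add: field_simps)
  qed
  have ev: "\<forall>\<^sub>F y in at x. norm (f y *\<^sub>R g y - f x *\<^sub>R g x - f x *\<^sub>R g' (y - x)) / norm (y - x)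
      \<le> \<bar>f y\<bar> * (norm (g y - g x - g' (y - x)) / norm (y - x)) + \<bar>f y - f x\<bar> * \<bar>K\<bar>"
    unfolding eventually_at_filter by (intro always_eventually allI impI le)
  have "((\<lambda>y. norm (f y *\<^sub>R g y - f x *\<^sub>R g x - f x *\<^sub>R g' (y - x)) / norm (y - x)) \<longlongrightarrow> 0) (at x)"
    by (rule tendsto_sandwich[OF _ ev tendsto_const lim]) simp
  moreover have "bounded_linear (\<lambda>v. f x *\<^sub>R g' v)"
    using bl by (rule bounded_linear_const_scaleR)
  ultimately show ?thesis
    by (simp add: has_derivative_iff_norm)
qed

text \<open>The derivative of the solution \<open>z\<close> solves \<open>A z' = b' - A' z\<close>, a system with the same
  matrix, so regularity is gained one order at a time.\<close>

lemma Ck_on_linear_solve: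
  fixes A :: "'a::euclidean_space \<Rightarrow> 'b::euclidean_space \<Rightarrow> 'c::euclidean_space"
  assumes lin: "\<And>x. x \<in> S \<Longrightarrow> linear (A x)" and S: "open S" and inj: "\<And>x. x \<in> S \<Longrightarrow> inj (A x)"
    and A: "\<And>y. smooth_on S (\<lambda>x. A x y)" and b: "Ck_on k S b"
    and eq: "\<And>x. x \<in> S \<Longrightarrow> A x (z x) = b x"
  shows "Ck_on k S z"
  using b eq
proof (induction k arbitrary: b z)
  case 0
  have "isCont z x" if x: "x \<in> S" for x
  proof (rule isCont_linear_solve[where A = A and b = b, OF lin S x inj[OF x]])
    show "isCont (\<lambda>x. A x y) x" for y
      using A[of y] S x by (metis smooth_on_def Ck_on.simps(1) continuous_on_eq_continuous_at)
    show "isCont b x"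
      using 0(1) S x by (metis Ck_on.simps(1) continuous_on_eq_continuous_at)
  qed (use 0(2) in auto)
  then show ?case
    by (simp add: continuous_at_imp_continuous_on)
next
  case (Suc k)
  \<comment> \<open>The right-hand side of the differentiated system contains \<open>z\<close>
    itself, so \<open>z\<close> is needed at order \<open>k\<close> first.\<close>
  have zk: "Ck_on k S z"
    using Suc.IH[OF Ck_on_Suc_imp[OF Suc.prems(1)] Suc.prems(2)] .
  have zdiff: "z differentiable (at x0)" if x0: "x0 \<in> S" for x0
  proof -
    have "isCont z x0"
    proof (rule isCont_linear_solve[where A = A and b = b, OF lin S x0 inj[OF x0]])
      show "isCont (\<lambda>x. A x y) x0" for y
        using A[of y] S x0 by (metis smooth_on_def Ck_on.simps(1) continuous_on_eq_continuous_at)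
      show "isCont b x0"
        using Suc.prems(1) x0 differentiable_imp_continuous_within by fastforce
    qed (use Suc.prems(2) in auto)
    obtain L where L: "linear L" "L \<circ> A x0 = id"
      using linear_injective_left_inverse[OF lin[OF x0] inj[OF x0]] by blast
    have bL: "bounded_linear L"
      using L(1) by (simp add: linear_conv_bounded_linear)
    have LA: "L (A x0 y) = y" for y
      using L(2) by (simp add: fun_eq_iff)
    \<comment> \<open>The system \<open>A x (z x) = b x\<close> rewritten around \<open>x0\<close>
      with the left inverse. The unknown occurs here only as the factor
      \<open>z x \<bullet> i\<close> of \<open>A x i - A x0 i\<close>, which vanishes at
      \<open>x0\<close>, so continuity of \<open>z\<close> is enough to differentiate
      \<open>w\<close> there.\<close>
    define w where "w x = L (b x) - L (\<Sum>i\<in>Basis. (z x \<bullet> i) *\<^sub>R (A x i - A x0 i))" for x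
    have "w differentiable (at x0)"
    proof -
      have "(\<lambda>x. (z x \<bullet> i) *\<^sub>R (A x i - A x0 i)) differentiable (at x0)" for i
      proof -
        have "((\<lambda>x. A x i) has_derivative frechet_derivative (\<lambda>x. A x i) (at x0)) (at x0)"
          using A[of i] x0 Ck_on_SucD unfolding smooth_on_def by blast
        then have "((\<lambda>x. A x i - A x0 i) has_derivative frechet_derivative (\<lambda>x. A x i) (at x0)) (at x0)"
          by (auto intro!: derivative_eq_intros)
        from has_derivative_scaleR_vanishing[OF _ this, of "\<lambda>x. z x \<bullet> i"] \<open>isCont z x0\<close>
        show ?thesis
          by (auto simp: differentiable_def)
      qed
      then have "(\<lambda>x. \<Sum>i\<in>Basis. (z x \<bullet> i) *\<^sub>R (A x i - A x0 i)) differentiable (at x0)"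
        by (intro differentiable_sum) auto
      moreover have "b differentiable (at x0)"
        using Suc.prems(1) x0 by simp
      moreover have "(\<lambda>x. L (h x)) differentiable (at x0)" if "h differentiable (at x0)" for h
        using that bounded_linear.has_derivative[OF bL] unfolding differentiable_def by blast
      ultimately show ?thesis
        unfolding w_def by (intro differentiable_diff)
    qed
    moreover have "w x = z x" if "x \<in> S" for x
    proof -
      have "(\<Sum>i\<in>Basis. (z x \<bullet> i) *\<^sub>R (A x i - A x0 i)) = A x (z x) - A x0 (z x)"
        using linear_eq_sum_Basis[OF lin[OF that], of "z x"] linear_eq_sum_Basis[OF lin[OF x0], of "z x"]
        by (simp add: scaleR_diff_right sum_subtractf)
      then show ?thesis
        using Suc.prems(2)[OF that] LA by (simp add: w_def linear_diff[OF L(1)])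
    qed
    ultimately show ?thesis
      using S x0 unfolding differentiable_def
      by (meson has_derivative_transform_within_open)
  qed
  have "Ck_on k S (\<lambda>x. frechet_derivative z (at x) v)" for v
  proof (rule Suc.IH)
    let ?b = "\<lambda>x. frechet_derivative b (at x) v -
        (\<Sum>i\<in>Basis. (z x \<bullet> i) *\<^sub>R frechet_derivative (\<lambda>x. A x i) (at x) v)"
    have "Ck_on k S (\<lambda>x. (z x \<bullet> i) *\<^sub>R frechet_derivative (\<lambda>x. A x i) (at x) v)" for i
    proof (rule Ck_on_bilinear[OF S bounded_bilinear_scaleR])
      show "Ck_on k S (\<lambda>x. z x \<bullet> i)"
        by (rule Ck_on_bounded_linear[OF S bounded_linear_inner_left zk])
      show "Ck_on k S (\<lambda>x. frechet_derivative (\<lambda>x. A x i) (at x) v)"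
        using A[of i] unfolding smooth_on_def by (metis Ck_on.simps(2))
    qed
    then have "Ck_on k S (\<lambda>x. \<Sum>i\<in>Basis. (z x \<bullet> i) *\<^sub>R frechet_derivative (\<lambda>x. A x i) (at x) v)"
      by (rule Ck_on_sum[OF S])
    moreover have "Ck_on k S (\<lambda>x. frechet_derivative b (at x) v)"
      using Suc.prems(1) by simp
    ultimately show "Ck_on k S ?b"
      by (intro Ck_on_diff[OF S])
    fix x assume x: "x \<in> S"
    have z': "(z has_derivative frechet_derivative z (at x)) (at x)"
      using zdiff[OF x] by (simp add: frechet_derivative_works)
    have A': "((\<lambda>x. A x i) has_derivative frechet_derivative (\<lambda>x. A x i) (at x)) (at x)" for i
      using A[of i] x Ck_on_SucD unfolding smooth_on_def by blast
    have "((\<lambda>x. \<Sum>i\<in>Basis. (z x \<bullet> i) *\<^sub>R A x i) has_derivative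
        (\<lambda>v. \<Sum>i\<in>Basis. (z x \<bullet> i) *\<^sub>R frechet_derivative (\<lambda>x. A x i) (at x) v +
           (frechet_derivative z (at x) v \<bullet> i) *\<^sub>R A x i)) (at x)"
      by (intro has_derivative_sum has_derivative_scaleR has_derivative_inner_left z' A')
    \<comment> \<open>Since \<open>b\<close> equals the expanded \<open>A x (z x)\<close> on all of
      the open set \<open>S\<close>, the product rule computes its derivative; solving for the term
      with the derivative of \<open>z\<close> gives the new system.\<close>
    then have "(b has_derivative
        (\<lambda>v. \<Sum>i\<in>Basis. (z x \<bullet> i) *\<^sub>R frechet_derivative (\<lambda>x. A x i) (at x) v +
           (frechet_derivative z (at x) v \<bullet> i) *\<^sub>R A x i)) (at x)"
    proof (rule has_derivative_transform_within_open[OF _ S x])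
      fix y assume y: "y \<in> S"
      show "(\<Sum>i\<in>Basis. (z y \<bullet> i) *\<^sub>R A y i) = b y"
        using Suc.prems(2)[OF y] linear_eq_sum_Basis[OF lin[OF y], of "z y"] by metis
    qed
    then have b': "frechet_derivative b (at x) v =
        (\<Sum>i\<in>Basis. (z x \<bullet> i) *\<^sub>R frechet_derivative (\<lambda>x. A x i) (at x) v +
           (frechet_derivative z (at x) v \<bullet> i) *\<^sub>R A x i)"
      by (metis (mono_tags, lifting) frechet_derivative_at)
    show "A x (frechet_derivative z (at x) v) = ?b x"
      unfolding b' linear_eq_sum_Basis[OF lin[OF x], of "frechet_derivative z (at x) v"]
      by (simp add: sum.distrib)
  qed
  then show ?case
    using zdiff by simp
qed

section \<open>The same calculus for \<open>smooth_on\<close>, and consequences of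
  smoothness\<close>

lemma smooth_on_cong:
  "open S \<Longrightarrow> (\<And>x. x \<in> S \<Longrightarrow> f x = g x) \<Longrightarrow> smooth_on S f \<Longrightarrow> smooth_on S g"
  unfolding smooth_on_def using Ck_on_cong by blast

lemma smooth_on_subset: "smooth_on S f \<Longrightarrow> T \<subseteq> S \<Longrightarrow> smooth_on T f"
  unfolding smooth_on_def using Ck_on_subset by blast

lemma smooth_on_local:
  assumes "\<And>x. x \<in> S \<Longrightarrow> \<exists>U. open U \<and> x \<in> U \<and> smooth_on U f"
  shows "smooth_on S f"
  using assms unfolding smooth_on_def by (meson Ck_on_local)

lemma smooth_on_const: "smooth_on S (\<lambda>x. c)"
  by (simp add: smooth_on_def Ck_on_const)

lemma smooth_on_bounded_linear:
  "open S \<Longrightarrow> bounded_linear L \<Longrightarrow> smooth_on S f \<Longrightarrow> smooth_on S (\<lambda>x. L (f x))"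
  by (simp add: smooth_on_def Ck_on_bounded_linear)

lemma smooth_on_linear: "open S \<Longrightarrow> bounded_linear L \<Longrightarrow> smooth_on S L"
  using smooth_on_bounded_linear[of S L "\<lambda>x. x"] by (simp add: smooth_on_def Ck_on_ident)

lemma smooth_on_add:
  "open S \<Longrightarrow> smooth_on S f \<Longrightarrow> smooth_on S g \<Longrightarrow> smooth_on S (\<lambda>x. f x + g x)"
  by (simp add: smooth_on_def Ck_on_add)

lemma smooth_on_diff:
  "open S \<Longrightarrow> smooth_on S f \<Longrightarrow> smooth_on S g \<Longrightarrow> smooth_on S (\<lambda>x. f x - g x)"
  by (simp add: smooth_on_def Ck_on_diff)

lemma smooth_on_minus:
  "open S \<Longrightarrow> smooth_on S f \<Longrightarrow> smooth_on S (\<lambda>x. - f x)"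
  using smooth_on_bounded_linear[OF _ bounded_linear_minus[OF bounded_linear_ident]] by blast

lemma smooth_on_scaleR:
  "open S \<Longrightarrow> smooth_on S f \<Longrightarrow> smooth_on S g \<Longrightarrow> smooth_on S (\<lambda>x. f x *\<^sub>R g x)"
  by (simp add: smooth_on_def Ck_on_bilinear[OF _ bounded_bilinear_scaleR])

lemma smooth_on_sum:
  "open S \<Longrightarrow> (\<And>i. i \<in> I \<Longrightarrow> smooth_on S (f i)) \<Longrightarrow> smooth_on S (\<lambda>x. \<Sum>i\<in>I. f i x)"
  by (simp add: smooth_on_def Ck_on_sum)

lemma smooth_on_compose:
  fixes f :: "'b::euclidean_space \<Rightarrow> 'c::real_normed_vector"
    and g :: "'a::real_normed_vector \<Rightarrow> 'b"
  shows "open S \<Longrightarrow> open T \<Longrightarrow> g ` S \<subseteq> T \<Longrightarrow> smooth_on T f \<Longrightarrow> smooth_on S g \<Longrightarrow> smooth_on S (f \<circ> g)"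
  by (simp add: smooth_on_def Ck_on_compose del: o_apply)

lemma smooth_on_linear_solve:
  fixes A :: "'a::euclidean_space \<Rightarrow> 'b::euclidean_space \<Rightarrow> 'c::euclidean_space"
  assumes "\<And>x. x \<in> S \<Longrightarrow> linear (A x)" "open S" "\<And>x. x \<in> S \<Longrightarrow> inj (A x)"
    and "\<And>y. smooth_on S (\<lambda>x. A x y)" "smooth_on S b" "\<And>x. x \<in> S \<Longrightarrow> A x (z x) = b x"
  shows "smooth_on S z"
  unfolding smooth_on_def
  using Ck_on_linear_solve[where A = A and b = b and z = z and S = S] assms
  by (auto simp: smooth_on_def)

lemma smooth_on_Pair:
  assumes "open S" "smooth_on S f" "smooth_on S g"
  shows "smooth_on S (\<lambda>x. (f x, g x))"
proof -
  have "bounded_linear (\<lambda>y::'b. (y, 0::'c))" "bounded_linear (\<lambda>y::'c. (0::'b, y))"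
    by (auto intro!: bounded_linear_intros)
  from smooth_on_add[OF assms(1) smooth_on_bounded_linear[OF assms(1) this(1) assms(2)]
      smooth_on_bounded_linear[OF assms(1) this(2) assms(3)]]
  show ?thesis
    by simp
qed

lemma smooth_on_vec:
  fixes f :: "'a::real_normed_vector \<Rightarrow> real ^ 'n::finite"
  assumes "open S" "\<And>i. smooth_on S (\<lambda>x. f x $ i)"
  shows "smooth_on S f"
proof -
  have "smooth_on S (\<lambda>x. \<Sum>i\<in>UNIV. (f x $ i) *\<^sub>R axis i 1)"
    using assms by (intro smooth_on_sum smooth_on_scaleR smooth_on_const)
  moreover have "(\<lambda>x. \<Sum>i\<in>UNIV. (f x $ i) *\<^sub>R axis i 1) = f"
    by (rule ext) (simp add: vec_eq_iff sum_component axis_def if_distrib sum.delta cong: if_cong)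
  ultimately show ?thesis
    by (rule back_subst[of "smooth_on S"])
qed

lemma smooth_on_has_derivative:
  "smooth_on S f \<Longrightarrow> x \<in> S \<Longrightarrow> (f has_derivative frechet_derivative f (at x)) (at x)"
  unfolding smooth_on_def using Ck_on_SucD by blast

lemma smooth_on_differentiable: "smooth_on S f \<Longrightarrow> x \<in> S \<Longrightarrow> f differentiable (at x)"
  using smooth_on_has_derivative by (auto simp: differentiable_def)

lemma smooth_on_imp_continuous_on: "smooth_on S f \<Longrightarrow> continuous_on S f"
  unfolding smooth_on_def using Ck_on.simps(1) by blast

lemma smooth_on_frechet_derivative:
  assumes "open S" "smooth_on S f"
  shows "smooth_on S (\<lambda>x. frechet_derivative f (at x) v)"
  using assms(2) unfolding smooth_on_def by (metis Ck_on.simps(2))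

text \<open>Smoothness provides derivatives in constant directions only; a variable direction
  \<open>Z x\<close> is expanded in the basis. Used for the derivative of the defect along
  \<open>G\<close>.\<close>

lemma smooth_on_derivative_along:
  fixes f :: "'a::euclidean_space \<Rightarrow> 'b::real_normed_vector"
  assumes "open S" "smooth_on S f" "smooth_on S Z"
  shows "smooth_on S (\<lambda>x. frechet_derivative f (at x) (Z x))"
proof (rule smooth_on_cong[OF assms(1)])
  show "smooth_on S (\<lambda>x. \<Sum>i\<in>Basis. (Z x \<bullet> i) *\<^sub>R frechet_derivative f (at x) i)"
    using assms
    by (intro smooth_on_sum smooth_on_scaleR smooth_on_frechet_derivative
        smooth_on_bounded_linear[OF assms(1) bounded_linear_inner_left])
  show "(\<Sum>i\<in>Basis. (Z x \<bullet> i) *\<^sub>R frechet_derivative f (at x) i) = frechet_derivative f (at x) (Z x)"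
    if "x \<in> S" for x
    using linear_eq_sum_Basis[of "frechet_derivative f (at x)" "Z x"]
      has_derivative_linear[OF smooth_on_has_derivative[OF assms(2) that]] by simp
qed

text \<open>On a compact ball the partial derivatives are bounded, their bounds add up to a bound of
  the operator norm, and convexity of the ball gives the mean value inequality.\<close>

lemma smooth_on_locally_lipschitz:
  fixes f :: "'a::euclidean_space \<Rightarrow> 'b::real_normed_vector"
  assumes "open S" "smooth_on S f" "x0 \<in> S"
  obtains \<rho> L where "\<rho> > 0" "L \<ge> 0" "cball x0 \<rho> \<subseteq> S"
    and "\<And>x y. x \<in> cball x0 \<rho> \<Longrightarrow> y \<in> cball x0 \<rho> \<Longrightarrow> norm (f x - f y) \<le> L * norm (x - y)"
proof -
  obtain \<rho> where \<rho>: "\<rho> > 0" "cball x0 \<rho> \<subseteq> S"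
    using assms(1,3) open_contains_cball_eq by blast
  let ?D = "\<lambda>x. frechet_derivative f (at x)"
  have "\<exists>K. \<forall>x\<in>cball x0 \<rho>. norm (?D x i) \<le> K" for i
  proof -
    have "continuous_on (cball x0 \<rho>) (\<lambda>x. ?D x i)"
      using smooth_on_imp_continuous_on[OF smooth_on_frechet_derivative[OF assms(1,2)]] \<rho>(2)
        continuous_on_subset by blast
    then have "bounded ((\<lambda>x. ?D x i) ` cball x0 \<rho>)"
      by (intro compact_imp_bounded compact_continuous_image) auto
    then show ?thesis
      by (auto simp: bounded_iff)
  qed
  then obtain K where K: "\<And>i x. x \<in> cball x0 \<rho> \<Longrightarrow> norm (?D x i) \<le> K i"
    by metis
  define L where "L = (\<Sum>i\<in>(Basis::'a set). K i)"
  have x0: "x0 \<in> cball x0 \<rho>"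
    using \<rho>(1) by simp
  have "0 \<le> L"
    unfolding L_def using K[OF x0] by (intro sum_nonneg) (meson norm_ge_zero order_trans)
  moreover have "norm (f x - f y) \<le> L * norm (x - y)" if "x \<in> cball x0 \<rho>" "y \<in> cball x0 \<rho>" for x y
  proof (rule differentiable_bound[OF convex_cball _ _ that])
    fix x assume x: "x \<in> cball x0 \<rho>"
    have d: "(f has_derivative ?D x) (at x)"
      using smooth_on_has_derivative[OF assms(2)] x \<rho>(2) by blast
    then show "(f has_derivative ?D x) (at x within cball x0 \<rho>)"
      by (rule has_derivative_at_withinI)
    have "onorm (?D x) \<le> (\<Sum>i\<in>Basis. norm (?D x i))"
      using d by (intro onorm_componentwise has_derivative_bounded_linear)
    also have "\<dots> \<le> L"
      unfolding L_def using K[OF x] by (intro sum_mono)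
    finally show "onorm (?D x) \<le> L" .
  qed
  ultimately show thesis
    using that \<rho> by blast
qed

section \<open>Estimates for curves and local solutions of differential equations\<close>

lemma norm_diff_le_of_bounded_derivative:
  fixes \<phi> :: "real \<Rightarrow> 'a::real_normed_vector"
  assumes "convex J" "\<And>t. t \<in> J \<Longrightarrow> (\<phi> has_vector_derivative \<phi>' t) (at t within J)"
    and "\<And>t. t \<in> J \<Longrightarrow> norm (\<phi>' t) \<le> B" "s \<in> J" "t \<in> J"
  shows "norm (\<phi> s - \<phi> t) \<le> B * \<bar>s - t\<bar>"
proof -
  have "norm (\<phi> s - \<phi> t) \<le> B * norm (s - t)"
  proof (rule differentiable_bound[OF assms(1) _ _ assms(4,5)])
    show "(\<phi> has_derivative (\<lambda>h. h *\<^sub>R \<phi>' u)) (at u within J)" if "u \<in> J" for u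
      using assms(2)[OF that] by (simp add: has_vector_derivative_def)
    show "onorm (\<lambda>h. h *\<^sub>R \<phi>' u) \<le> B" if "u \<in> J" for u
    proof (rule onorm_le)
      show "norm (h *\<^sub>R \<phi>' u) \<le> B * norm h" for h
        using mult_right_mono[OF assms(3)[OF that], of "norm h"] by (simp add: mult.commute)
    qed
  qed
  then show ?thesis
    by simp
qed

lemma gronwall_zero:
  fixes \<phi> :: "real \<Rightarrow> 'a::real_normed_vector"
  assumes "0 < e" "0 \<le> C" "\<And>t. \<bar>t - t0\<bar> < e \<Longrightarrow> (\<phi> has_vector_derivative \<phi>' t) (at t)"
    and "\<And>t. \<bar>t - t0\<bar> < e \<Longrightarrow> norm (\<phi>' t) \<le> C * norm (\<phi> t)" and "\<phi> t0 = 0"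
  obtains d where "0 < d" "\<And>t. \<bar>t - t0\<bar> < d \<Longrightarrow> \<phi> t = 0"
proof -
  \<comment> \<open>\<open>e/2\<close> keeps the closed interval of radius \<open>d\<close> inside
    the range of the hypotheses; the other bound gives \<open>C * d \<le> 1/2\<close> and is defined
    also for \<open>C = 0\<close>.\<close>
  define d where "d = min (e/2) (1 / (2 * (C + 1)))"
  have d: "0 < d" "d < e"
    using assms(1,2) by (auto simp: d_def)
  have Cd: "C * d \<le> 1/2"
  proof -
    have "C * d \<le> C * (1 / (2 * (C + 1)))"
      using assms(2) by (intro mult_left_mono) (auto simp: d_def)
    also have "\<dots> \<le> 1/2"
      using assms(2) by (simp add: field_simps)
    finally show ?thesis .
  qed
  let ?I = "cball t0 d"
  have I: "\<bar>t - t0\<bar> < e" if "t \<in> ?I" for t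
    using that d by (simp add: dist_real_def abs_minus_commute)
  have cont: "continuous_on ?I (\<lambda>t. norm (\<phi> t))"
    using assms(3)[OF I] has_vector_derivative_continuous
    by (intro continuous_on_norm continuous_at_imp_continuous_on) blast
  obtain s where s: "s \<in> ?I" "\<And>t. t \<in> ?I \<Longrightarrow> norm (\<phi> t) \<le> norm (\<phi> s)"
    using continuous_attains_sup[OF compact_cball _ cont] d(1) by auto
  have "norm (\<phi> s - \<phi> t0) \<le> (C * norm (\<phi> s)) * \<bar>s - t0\<bar>"
  proof (rule norm_diff_le_of_bounded_derivative[OF convex_cball _ _ s(1)])
    fix t assume t: "t \<in> ?I"
    show "(\<phi> has_vector_derivative \<phi>' t) (at t within ?I)"
      using assms(3)[OF I[OF t]] by (rule has_vector_derivative_at_within)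
    show "norm (\<phi>' t) \<le> C * norm (\<phi> s)"
      using assms(4)[OF I[OF t]] s(2)[OF t] assms(2) by (meson mult_left_mono order_trans)
  qed (use d in simp)
  also have "\<dots> \<le> (C * norm (\<phi> s)) * d"
    using s(1) assms(2) by (intro mult_left_mono) (auto simp: dist_real_def)
  also have "\<dots> = (C * d) * norm (\<phi> s)"
    by simp
  also have "\<dots> \<le> 1/2 * norm (\<phi> s)"
    using Cd by (intro mult_right_mono) auto
  finally have "norm (\<phi> s) = 0"
    using assms(5) by simp
  then have "\<phi> t = 0" if "\<bar>t - t0\<bar> < d" for t
    using s(2)[of t] that by (simp add: dist_real_def abs_minus_commute)
  then show thesis
    using that d(1) by blast
qed

text \<open>Composing with the nearest-point projection onto the ball makes the right-hand side globally
  Lipschitz, so the Picard operator contracts the whole space of bounded continuous curves.\<close>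

lemma picard_lindelof:
  fixes F :: "'a::euclidean_space \<Rightarrow> 'a"
  assumes "0 < \<rho>" "0 \<le> L"
    and lip: "\<And>x y. x \<in> cball x0 \<rho> \<Longrightarrow> y \<in> cball x0 \<rho> \<Longrightarrow> norm (F x - F y) \<le> L * norm (x - y)"
  obtains h x where "0 < h" "x 0 = x0"
    and "\<And>t. \<bar>t\<bar> < h \<Longrightarrow> x t \<in> cball x0 \<rho>"
    and "\<And>t. \<bar>t\<bar> < h \<Longrightarrow> (x has_vector_derivative F (x t)) (at t)"
proof -
  let ?B = "cball x0 \<rho>"
  have B: "convex ?B" "closed ?B" "?B \<noteq> {}" "x0 \<in> ?B"
    using assms(1) by auto
  define H where "H = F \<circ> closest_point ?B"
  have cp: "closest_point ?B x \<in> ?B" for x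
    using B by (intro closest_point_in_set)
  have H_lip: "norm (H x - H y) \<le> L * norm (x - y)" for x y
  proof -
    have "norm (H x - H y) \<le> L * norm (closest_point ?B x - closest_point ?B y)"
      unfolding H_def o_def by (intro lip cp)
    also have "\<dots> \<le> L * norm (x - y)"
      using closest_point_lipschitz[OF B(1-3), of x y] assms(2)
      by (intro mult_left_mono) (auto simp: dist_norm)
    finally show ?thesis .
  qed
  \<comment> \<open>A global bound for \<open>H\<close>: all its values are values of
    \<open>F\<close> on the ball, within \<open>L * \<rho>\<close> of \<open>F x0\<close>.\<close>
  define M where "M = norm (F x0) + L * \<rho>"
  have M_nn: "0 \<le> M"
    unfolding M_def using assms(1,2) by simp
  have H_bd: "norm (H x) \<le> M" for x
  proof -
    have "norm (H x - F x0) \<le> L * norm (closest_point ?B x - x0)"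
      unfolding H_def o_def by (intro lip cp B)
    also have "\<dots> \<le> L * \<rho>"
      using cp[of x] assms(2) by (intro mult_left_mono) (auto simp: dist_norm norm_minus_commute)
    finally show ?thesis
      unfolding M_def using norm_triangle_ineq2[of "H x" "F x0"] by linarith
  qed
  have H_cont: "continuous_on UNIV H"
    by (rule lipschitz_on_continuous_on[of L])
      (use H_lip assms(2) in \<open>auto simp: lipschitz_on_def dist_norm\<close>)
  \<comment> \<open>The first bound makes the Picard operator contract by the factor 1/2, the second
    keeps its values within distance \<open>\<rho>\<close> of \<open>x0\<close>. Adding 1 keeps the
    denominators positive.\<close>
  define h where "h = min (1 / (2 * (L + 1))) (\<rho> / (M + 1))"
  have h: "0 < h" "L * h \<le> 1/2" "M * h \<le> \<rho>"
  proof -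
    show "0 < h"
      using assms(1,2) M_nn by (simp add: h_def)
    have "L * h \<le> L * (1 / (2 * (L + 1)))"
      using assms(2) by (intro mult_left_mono) (auto simp: h_def)
    also have "\<dots> \<le> 1/2"
      using assms(2) by (simp add: field_simps)
    finally show "L * h \<le> 1/2" .
    have "M * h \<le> M * (\<rho> / (M + 1))"
      using M_nn by (intro mult_left_mono) (auto simp: h_def)
    also have "\<dots> \<le> \<rho>"
      using M_nn assms(1) by (simp add: field_simps)
    finally show "M * h \<le> \<rho>" .
  qed
  define I where "I = {-h..h}"
  have I0: "0 \<in> I"
    using h(1) by (simp add: I_def)
  \<comment> \<open>Clamping the time to \<open>I\<close> turns curves on \<open>I\<close> into
    bounded continuous functions on the whole line, the complete space in which the fixed point is
    found.\<close>
  define c where "c t = max (-h) (min h t)" for t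
  have c: "c t \<in> I" "continuous_on UNIV c" for t
    using h(1) by (auto simp: c_def I_def intro!: continuous_intros)
  have cI: "c t = t" if "t \<in> I" for t
    using that by (auto simp: c_def I_def)
  \<comment> \<open>This is \<open>x0\<close> plus the integral from 0 to \<open>t\<close>. Both
    integrals start at \<open>-h\<close> so that the formula also covers negative \<open>t\<close>,
    where \<open>{0..t}\<close> would be empty.\<close>
  define P where "P x t = x0 + integral {-h..t} (\<lambda>s. H (x s)) - integral {-h..0} (\<lambda>s. H (x s))"
    for x :: "real \<Rightarrow> 'a" and t
  have P_der: "(P x has_vector_derivative H (x t)) (at t within I)"
    if "continuous_on UNIV x" "t \<in> I" for x t
  proof -
    have "continuous_on {-h..h} (\<lambda>s. H (x s))"
      using continuous_on_compose2[OF H_cont that(1)] continuous_on_subset by blast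
    from integral_has_vector_derivative[OF this, of t] that(2)
    show ?thesis
      unfolding P_def I_def by (auto intro!: derivative_eq_intros)
  qed
  have P0: "P x 0 = x0" for x
    by (simp add: P_def)
  have P_bd: "norm (P x t - x0) \<le> \<rho>" if "continuous_on UNIV x" "t \<in> I" for x t
  proof -
    have "norm (P x t - P x 0) \<le> M * \<bar>t - 0\<bar>"
      by (rule norm_diff_le_of_bounded_derivative[OF _ P_der[OF that(1)] H_bd that(2) I0])
        (auto simp: I_def)
    also have "\<dots> \<le> M * h"
      using that(2) M_nn by (intro mult_left_mono) (auto simp: I_def)
    finally show ?thesis
      using h(3) P0 by simp
  qed
  have P_cont: "continuous_on I (P x)" if "continuous_on UNIV x" for x
    using P_der[OF that] has_vector_derivative_continuous continuous_on_eq_continuous_within by blast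
  have bc: "(\<lambda>t. P x (c t)) \<in> bcontfun" if "continuous_on UNIV x" for x
  proof (rule bcontfun_normI)
    show "continuous_on UNIV (\<lambda>t. P x (c t))"
      using continuous_on_compose2[OF P_cont[OF that] c(2)] c(1) by blast
    show "norm (P x (c t)) \<le> norm x0 + \<rho>" for t
      using P_bd[OF that c(1)[of t]] norm_triangle_ineq2[of "P x (c t)" x0] by linarith
  qed
  define T where "T x = Bcontfun (\<lambda>t. P (apply_bcontfun x) (c t))" for x
  have T_apply: "apply_bcontfun (T x) t = P (apply_bcontfun x) (c t)" for x t
    unfolding T_def using Bcontfun_inverse[OF bc] by simp
  have "dist (T x) (T y) \<le> 1/2 * dist x y" for x y
  proof (rule dist_bound)
    fix t
    let ?x = "apply_bcontfun x" and ?y = "apply_bcontfun y"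
    \<comment> \<open>Both images have the value \<open>x0\<close> at time 0, so the mean value
      inequality for their difference bounds their distance.\<close>
    have "norm ((P ?x (c t) - P ?y (c t)) - (P ?x 0 - P ?y 0)) \<le> (L * dist x y) * \<bar>c t - 0\<bar>"
    proof (rule norm_diff_le_of_bounded_derivative[OF _ _ _ c(1) I0])
      show "convex I"
        by (simp add: I_def)
      fix s assume "s \<in> I"
      then show "((\<lambda>t. P ?x t - P ?y t) has_vector_derivative H (?x s) - H (?y s)) (at s within I)"
        by (intro has_vector_derivative_diff P_der) auto
      show "norm (H (?x s) - H (?y s)) \<le> L * dist x y"
        using H_lip[of "?x s" "?y s"] dist_bounded[of x s y] assms(2)
        by (metis dist_norm mult_left_mono order_trans)
    qed
    also have "\<dots> \<le> (L * dist x y) * h"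
      using c(1)[of t] assms(2) by (intro mult_left_mono) (auto simp: I_def)
    also have "\<dots> = (L * h) * dist x y"
      by simp
    also have "\<dots> \<le> 1/2 * dist x y"
      using h(2) by (intro mult_right_mono) auto
    finally show "dist (apply_bcontfun (T x) t) (apply_bcontfun (T y) t) \<le> 1/2 * dist x y"
      by (simp add: T_apply P0 dist_norm)
  qed
  then obtain \<xi> where \<xi>: "T \<xi> = \<xi>"
    using banach_fix_type[of "1/2" T] by auto
  let ?x = "apply_bcontfun \<xi>"
  have x_eq: "?x t = P ?x (c t)" for t
    using T_apply[of \<xi> t] \<xi> by simp
  have x_eqI: "?x t = P ?x t" if "t \<in> I" for t
    using x_eq[of t] cI[OF that] by simp
  have x_ball: "?x t \<in> ?B" if "t \<in> I" for t
    using P_bd[OF _ that, of ?x] x_eqI[OF that] by (simp add: dist_norm norm_minus_commute)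
  show thesis
  proof (rule that[OF h(1)])
    show "?x 0 = x0"
      using x_eqI[OF I0] P0 by simp
    fix t :: real assume t: "\<bar>t\<bar> < h"
    then have tI: "t \<in> I"
      by (auto simp: I_def)
    show "?x t \<in> ?B"
      by (rule x_ball[OF tI])
    \<comment> \<open>The fixed point stays in the ball, where the projection is the identity, so it
      solves the original equation.\<close>
    have "H (?x t) = F (?x t)"
      using closest_point_self[OF x_ball[OF tI]] by (simp add: H_def)
    moreover have "at t within I = at t"
      using t by (intro at_within_interior) (auto simp: I_def)
    ultimately have "(P ?x has_vector_derivative F (?x t)) (at t)"
      using P_der[OF _ tI, of ?x] by simp
    then show "(?x has_vector_derivative F (?x t)) (at t)"
      by (rule has_vector_derivative_transform_within_open[of _ _ _ "{-h<..<h}"])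
        (use t x_eqI in \<open>auto simp: I_def\<close>)
  qed
qed

section \<open>Charts and tangent vectors\<close>

lemma sum_fun_apply: "(\<Sum>i\<in>I. f i) x = (\<Sum>i\<in>I. f i x)"
  by (induction I rule: infinite_finite_induct) auto

lemma scaleR_fun_apply [simp]: "(s *\<^sub>R f) x = s *\<^sub>R f x"
  by (simp add: scaleR_fun_def)

lemma chart_inv_in: "x \<in> snd c ` fst c \<Longrightarrow> chart_inv c x \<in> fst c"
  by (simp add: chart_inv_def inv_into_into)

lemma snd_chart_inv: "x \<in> snd c ` fst c \<Longrightarrow> snd c (chart_inv c x) = x"
  by (simp add: chart_inv_def f_inv_into_f)

abbreviation transition :: "('p, 'e) chart \<Rightarrow> ('p, 'e) chart \<Rightarrow> 'e \<Rightarrow> 'e" where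
  "transition c c' \<equiv> snd c' \<circ> chart_inv c"

abbreviation transition_deriv ::
  "('p, 'e::real_normed_vector) chart \<Rightarrow> ('p, 'e) chart \<Rightarrow> 'p \<Rightarrow> 'e \<Rightarrow> 'e" where
  "transition_deriv c c' q \<equiv> frechet_derivative (transition c c') (at (snd c q))"

text \<open>The tangent bundle will be shown to be an instance, so that every fact proved here
  serves both \<open>Q\<close> and \<open>TQ\<close>.\<close>

locale atlas =
  fixes M :: "('p, 'e::euclidean_space) chart set"
  assumes chart: "c \<in> M \<Longrightarrow> is_chart c"
    and compat: "c \<in> M \<Longrightarrow> c' \<in> M \<Longrightarrow> compatible c c'"
begin

lemma chart_inv_snd: "c \<in> M \<Longrightarrow> q \<in> fst c \<Longrightarrow> chart_inv c (snd c q) = q"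
  using chart by (auto simp: chart_inv_def is_chart_def)

lemma in_carrier: "c \<in> M \<Longrightarrow> q \<in> fst c \<Longrightarrow> q \<in> carrier M"
  by (auto simp: carrier_def)

lemma openin_iff:
  "openin (mtop M) W \<longleftrightarrow> W \<subseteq> carrier M \<and> (\<forall>c\<in>M. open (snd c ` (W \<inter> fst c)))"
  using chart by (simp add: openin_mtop)

lemma open_overlap: "c \<in> M \<Longrightarrow> c' \<in> M \<Longrightarrow> open (snd c ` (fst c \<inter> fst c'))"
  using compat by (auto simp: compatible_def)

lemma open_chart: "c \<in> M \<Longrightarrow> open (snd c ` fst c)"
  using chart by (auto simp: is_chart_def)

lemma open_chart_image: "openin (mtop M) W \<Longrightarrow> c \<in> M \<Longrightarrow> open (snd c ` (W \<inter> fst c))"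
  by (simp add: openin_iff)

lemma openin_carrier: "openin (mtop M) (carrier M)"
proof -
  have "carrier M \<inter> fst c = fst c" if "c \<in> M" for c
    using that by (auto simp: carrier_def)
  then show ?thesis
    using open_chart by (simp add: openin_iff)
qed

lemma smooth_transition:
  "c \<in> M \<Longrightarrow> c' \<in> M \<Longrightarrow> smooth_on (snd c ` (fst c \<inter> fst c')) (transition c c')"
  using compat by (auto simp: compatible_def)

lemma has_derivative_transition:
  assumes "c \<in> M" "c' \<in> M" "q \<in> fst c" "q \<in> fst c'"
  shows "(transition c c' has_derivative transition_deriv c c' q) (at (snd c q))"
  using smooth_transition[OF assms(1,2)] assms(3,4) by (intro smooth_on_has_derivative) auto

lemma linear_transition_deriv:
  assumes "c \<in> M" "c' \<in> M" "q \<in> fst c" "q \<in> fst c'"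
  shows "linear (transition_deriv c c' q)"
  using has_derivative_transition[OF assms] by (rule has_derivative_linear)

text \<open>The chain rule for \<open>h \<circ> chart_inv c'\<close> after the transition map. The
  composite agrees with \<open>h \<circ> chart_inv c\<close> only on the overlap, and that is enough
  because the overlap is open.\<close>

lemma frechet_derivative_change_chart:
  fixes h :: "'p \<Rightarrow> 'b::real_normed_vector"
  assumes c: "c \<in> M" "c' \<in> M" and q: "q \<in> fst c" "q \<in> fst c'"
    and h: "(h \<circ> chart_inv c') differentiable (at (snd c' q))"
  shows "frechet_derivative (h \<circ> chart_inv c) (at (snd c q)) y =
    frechet_derivative (h \<circ> chart_inv c') (at (snd c' q)) (transition_deriv c c' q y)"
proof -
  have "(h \<circ> chart_inv c' has_derivative frechet_derivative (h \<circ> chart_inv c') (at (snd c' q)))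
      (at (transition c c' (snd c q)))"
    using h chart_inv_snd[OF c(1) q(1)] by (simp add: frechet_derivative_works)
  from diff_chain_at[OF has_derivative_transition[OF c q] this]
  have "(h \<circ> chart_inv c has_derivative
      frechet_derivative (h \<circ> chart_inv c') (at (snd c' q)) \<circ> transition_deriv c c' q) (at (snd c q))"
  proof (rule has_derivative_transform_within_open[OF _ open_overlap[OF c]])
    show "snd c q \<in> snd c ` (fst c \<inter> fst c')"
      using q by blast
    fix x assume "x \<in> snd c ` (fst c \<inter> fst c')"
    then obtain p where "p \<in> fst c" "p \<in> fst c'" "x = snd c p"
      by blast
    then show "(h \<circ> chart_inv c' \<circ> transition c c') x = (h \<circ> chart_inv c) x"
      using chart_inv_snd[OF c(1)] chart_inv_snd[OF c(2)] by simp
  qed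
  from frechet_derivative_at[OF this] show ?thesis
    by (metis o_apply)
qed

lemma transition_deriv_self:
  assumes "c \<in> M" "q \<in> fst c"
  shows "transition_deriv c c q y = y"
proof -
  have "(transition c c has_derivative (\<lambda>y. y)) (at (snd c q))"
    by (rule has_derivative_transform_within_open[OF has_derivative_ident open_chart[OF assms(1)]])
      (use assms snd_chart_inv[of _ c] in simp_all)
  from frechet_derivative_at[OF this] show ?thesis
    by metis
qed

text \<open>The cocycle rule: the change of chart applied to the coordinate map
  \<open>snd c''\<close>.\<close>

lemma transition_deriv_compose:
  assumes "c \<in> M" "c' \<in> M" "c'' \<in> M" "q \<in> fst c" "q \<in> fst c'" "q \<in> fst c''"
  shows "transition_deriv c' c'' q (transition_deriv c c' q y) = transition_deriv c c'' q y"
  using frechet_derivative_change_chart[OF assms(1,2,4,5)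
      differentiableI[OF has_derivative_transition[OF assms(2,3,5,6)]], of y] by simp

section \<open>Tangent spaces in coordinates\<close>

lemma coord_vec_apply:
  "c' \<in> M \<Longrightarrow> q \<in> fst c' \<Longrightarrow> coord_vec M c q y c' = transition_deriv c c' q y"
  by (simp add: coord_vec_def)

lemma coord_vec_self: "c \<in> M \<Longrightarrow> q \<in> fst c \<Longrightarrow> coord_vec M c q y c = y"
  by (simp add: coord_vec_apply transition_deriv_self)

lemma coord_vec_in_tangent_space:
  assumes "c \<in> M" "q \<in> fst c"
  shows "coord_vec M c q y \<in> tangent_space M q"
  using assms by (auto simp: tangent_space_def coord_vec_def transition_deriv_compose)

lemma tangent_spaceI:
  assumes "\<And>c c'. c \<in> M \<Longrightarrow> c' \<in> M \<Longrightarrow> q \<in> fst c \<Longrightarrow> q \<in> fst c' \<Longrightarrow>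
      v c' = transition_deriv c c' q (v c)"
    and "\<And>c. \<not> (c \<in> M \<and> q \<in> fst c) \<Longrightarrow> v c = 0"
  shows "v \<in> tangent_space M q"
  using assms unfolding tangent_space_def by blast

lemma tangent_space_transition:
  "v \<in> tangent_space M q \<Longrightarrow> c \<in> M \<Longrightarrow> c' \<in> M \<Longrightarrow> q \<in> fst c \<Longrightarrow> q \<in> fst c' \<Longrightarrow>
    v c' = transition_deriv c c' q (v c)"
  unfolding tangent_space_def by blast

lemma tangent_space_outside:
  "v \<in> tangent_space M q \<Longrightarrow> \<not> (c \<in> M \<and> q \<in> fst c) \<Longrightarrow> v c = 0"
  unfolding tangent_space_def by blast

text \<open>A tangent vector is determined by its entry in a single chart: the transformation rule
  gives the other entries around \<open>q\<close>, and all remaining ones are 0 by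
  convention.\<close>

lemma coord_vec_of_tangent:
  assumes "c \<in> M" "q \<in> fst c" "v \<in> tangent_space M q"
  shows "coord_vec M c q (v c) = v"
proof
  fix c'
  show "coord_vec M c q (v c) c' = v c'"
  proof (cases "c' \<in> M \<and> q \<in> fst c'")
    case True
    then show ?thesis
      using tangent_space_transition[OF assms(3,1) _ assms(2), of c'] by (simp add: coord_vec_apply)
  next
    case False
    then show ?thesis
      using tangent_space_outside[OF assms(3) False] by (auto simp: coord_vec_def)
  qed
qed

lemma tangent_eqI:
  "c \<in> M \<Longrightarrow> q \<in> fst c \<Longrightarrow> v \<in> tangent_space M q \<Longrightarrow> w \<in> tangent_space M q \<Longrightarrow> v c = w c \<Longrightarrow> v = w"
  by (metis coord_vec_of_tangent)

lemma subspace_tangent_space: "subspace (tangent_space M q)"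
  unfolding subspace_def
proof (intro conjI ballI allI)
  show "0 \<in> tangent_space M q"
    using linear_0[OF linear_transition_deriv] by (intro tangent_spaceI) simp_all
  fix v w :: "('p, 'e) tvec" and s :: real
  assume v: "v \<in> tangent_space M q"
  show "s *\<^sub>R v \<in> tangent_space M q"
  proof (rule tangent_spaceI)
    fix c c' assume c: "c \<in> M" "c' \<in> M" "q \<in> fst c" "q \<in> fst c'"
    show "(s *\<^sub>R v) c' = transition_deriv c c' q ((s *\<^sub>R v) c)"
      using tangent_space_transition[OF v c] linear_cmul[OF linear_transition_deriv[OF c]]
      by (simp only: scaleR_fun_apply)
  qed (simp add: tangent_space_outside[OF v])
  assume w: "w \<in> tangent_space M q"
  show "v + w \<in> tangent_space M q"
  proof (rule tangent_spaceI)
    fix c c' assume c: "c \<in> M" "c' \<in> M" "q \<in> fst c" "q \<in> fst c'"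
    show "(v + w) c' = transition_deriv c c' q ((v + w) c)"
      using tangent_space_transition[OF v c] tangent_space_transition[OF w c]
        linear_add[OF linear_transition_deriv[OF c]]
      by (simp only: plus_fun_apply)
  qed (simp add: tangent_space_outside[OF v] tangent_space_outside[OF w])
qed

lemma linear_coord_vec:
  assumes "c \<in> M" "q \<in> fst c"
  shows "linear (coord_vec M c q)"
proof (rule linearI)
  show "coord_vec M c q (y + z) = coord_vec M c q y + coord_vec M c q z" for y z
    using linear_add[OF linear_transition_deriv[OF assms(1) _ assms(2)]]
    by (auto simp: coord_vec_def fun_eq_iff)
  show "coord_vec M c q (s *\<^sub>R y) = s *\<^sub>R coord_vec M c q y" for s y
    using linear_cmul[OF linear_transition_deriv[OF assms(1) _ assms(2)]]
    by (auto simp: coord_vec_def fun_eq_iff)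
qed

section \<open>Derivatives along tangent vectors and along curves\<close>

lemma derivative_along_chart_independent:
  fixes h :: "'p \<Rightarrow> 'b::real_normed_vector"
  assumes "c \<in> M" "c' \<in> M" "q \<in> fst c" "q \<in> fst c'"
    and "(h \<circ> chart_inv c') differentiable (at (snd c' q))" "v \<in> tangent_space M q"
  shows "frechet_derivative (h \<circ> chart_inv c) (at (snd c q)) (v c) =
    frechet_derivative (h \<circ> chart_inv c') (at (snd c' q)) (v c')"
  using frechet_derivative_change_chart[OF assms(1-5)] tangent_space_transition[OF assms(6,1-4)]
  by simp

text \<open>Derivatives exist only in coordinates, so \<open>h \<circ> \<gamma>\<close> is factored
  through a chart. The factorization is valid at the times at which the curve is in the chart
  domain, which is why it has to be there for all times near \<open>t\<close>.\<close>

lemma has_vector_derivative_along_curve: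
  fixes h :: "'p \<Rightarrow> 'b::real_normed_vector"
  assumes c: "c \<in> M" "\<forall>\<^sub>F s in nhds t. \<gamma> s \<in> fst c"
    and \<gamma>: "(snd c \<circ> \<gamma> has_vector_derivative y) (at t)"
    and h: "(h \<circ> chart_inv c) differentiable (at (snd c (\<gamma> t)))"
  shows "(h \<circ> \<gamma> has_vector_derivative frechet_derivative (h \<circ> chart_inv c) (at (snd c (\<gamma> t))) y) (at t)"
proof -
  have h': "(h \<circ> chart_inv c has_derivative frechet_derivative (h \<circ> chart_inv c) (at (snd c (\<gamma> t))))
      (at ((snd c \<circ> \<gamma>) t))"
    using h by (simp add: frechet_derivative_works)
  have der: "((h \<circ> chart_inv c) \<circ> (snd c \<circ> \<gamma>) has_vector_derivative
      frechet_derivative (h \<circ> chart_inv c) (at (snd c (\<gamma> t))) y) (at t)"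
    using diff_chain_at[OF \<gamma>[unfolded has_vector_derivative_def] h']
      linear_cmul[OF has_derivative_linear[OF h']]
    by (simp add: has_vector_derivative_def o_def)
  obtain U where U: "open U" "t \<in> U" "\<And>s. s \<in> U \<Longrightarrow> \<gamma> s \<in> fst c"
    using c(2) by (auto simp: eventually_nhds)
  show ?thesis
    by (rule has_vector_derivative_transform_within_open[OF der U(1,2)])
      (simp add: chart_inv_snd[OF c(1)] U(3))
qed

lemma has_vector_derivative_change_chart:
  assumes c: "c \<in> M" "c' \<in> M" "\<gamma> t \<in> fst c'" "\<forall>\<^sub>F s in nhds t. \<gamma> s \<in> fst c"
    and \<gamma>: "(snd c \<circ> \<gamma> has_vector_derivative y) (at t)"
  shows "(snd c' \<circ> \<gamma> has_vector_derivative transition_deriv c c' (\<gamma> t) y) (at t)"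
  by (rule has_vector_derivative_along_curve[OF c(1,4) \<gamma>
        differentiableI[OF has_derivative_transition[OF c(1,2) eventually_nhds_x_imp_x[OF c(4)] c(3)]]])

lemma velocity_eq:
  assumes "c \<in> M" "\<gamma> t \<in> fst c" "(snd c \<circ> \<gamma> has_vector_derivative y) (at t)"
  shows "velocity M \<gamma> t c = y"
  using assms by (simp add: velocity_def vector_derivative_at)

text \<open>\<open>velocity\<close> is formed separately in every chart. A derivative in one chart
  produces the derivatives in all others through the transition maps, so the entries fit
  together.\<close>

lemma velocity_in_tangent_space:
  assumes c: "c \<in> M" "\<forall>\<^sub>F s in nhds t. \<gamma> s \<in> fst c"
    and \<gamma>: "(snd c \<circ> \<gamma> has_vector_derivative y) (at t)"
  shows "velocity M \<gamma> t = coord_vec M c (\<gamma> t) y" "velocity M \<gamma> t \<in> tangent_space M (\<gamma> t)"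
proof -
  have q: "\<gamma> t \<in> fst c"
    using eventually_nhds_x_imp_x[OF c(2)] .
  show *: "velocity M \<gamma> t = coord_vec M c (\<gamma> t) y"
  proof
    fix c'
    show "velocity M \<gamma> t c' = coord_vec M c (\<gamma> t) y c'"
    proof (cases "c' \<in> M \<and> \<gamma> t \<in> fst c'")
      case True
      then show ?thesis
        using velocity_eq[OF _ _ has_vector_derivative_change_chart[OF c(1) _ _ c(2) \<gamma>, of c']]
        by (simp add: coord_vec_apply)
    qed (auto simp: velocity_def coord_vec_def)
  qed
  show "velocity M \<gamma> t \<in> tangent_space M (\<gamma> t)"
    unfolding * by (rule coord_vec_in_tangent_space[OF c(1) q])
qed

lemma integral_curve_in_chart:
  assumes "integral_curve M Z J \<gamma>" "t \<in> J" "c \<in> M" "\<gamma> t \<in> fst c"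
  shows "\<forall>\<^sub>F s in nhds t. s \<in> J \<and> \<gamma> s \<in> fst c"
    and "(snd c \<circ> \<gamma> has_vector_derivative Z (\<gamma> t) c) (at t)"
proof -
  let ?U = "{s \<in> J. \<gamma> s \<in> fst c}"
  have U: "open ?U" "(snd c \<circ> \<gamma>) differentiable_on ?U" "t \<in> ?U"
    using assms by (auto simp: integral_curve_def differentiable_curve_def)
  show "\<forall>\<^sub>F s in nhds t. s \<in> J \<and> \<gamma> s \<in> fst c"
    using eventually_nhds_in_open[OF U(1,3)] by simp
  have "(snd c \<circ> \<gamma>) differentiable (at t)"
    using U differentiable_on_eq_differentiable_at by blast
  moreover have "velocity M \<gamma> t c = Z (\<gamma> t) c"
    using assms(1,2) by (simp add: integral_curve_def)
  ultimately show "(snd c \<circ> \<gamma> has_vector_derivative Z (\<gamma> t) c) (at t)"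
    using assms(3,4) by (simp add: velocity_def vector_derivative_works)
qed

text \<open>Carries a coordinate solution back to the manifold. An integral curve must be
  differentiable in all charts of the atlas, not only in \<open>c\<close>; tangency of
  \<open>Z\<close> is what lets the equation in \<open>c\<close> determine the whole
  velocity.\<close>

lemma integral_curve_of_chart_solution:
  assumes c: "c \<in> M" and J: "open J" and \<xi>: "\<And>t. t \<in> J \<Longrightarrow> \<xi> t \<in> snd c ` fst c"
    and der: "\<And>t. t \<in> J \<Longrightarrow> (\<xi> has_vector_derivative Z (chart_inv c (\<xi> t)) c) (at t)"
    and Z: "\<And>t. t \<in> J \<Longrightarrow> Z (chart_inv c (\<xi> t)) \<in> tangent_space M (chart_inv c (\<xi> t))"
  shows "integral_curve M Z J (chart_inv c \<circ> \<xi>)"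
proof -
  let ?\<gamma> = "chart_inv c \<circ> \<xi>"
  have in_c: "?\<gamma> t \<in> fst c" if "t \<in> J" for t
    using chart_inv_in[OF \<xi>[OF that]] by simp
  have ev: "\<forall>\<^sub>F s in nhds t. ?\<gamma> s \<in> fst c" if "t \<in> J" for t
    using eventually_nhds_in_open[OF J that] by eventually_elim (rule in_c)
  have der': "(snd c \<circ> ?\<gamma> has_vector_derivative Z (?\<gamma> t) c) (at t)" if t: "t \<in> J" for t
  proof -
    have "(\<xi> has_vector_derivative Z (?\<gamma> t) c) (at t)"
      using der[OF t] by simp
    then show ?thesis
      by (rule has_vector_derivative_transform_within_open[OF _ J t]) (simp add: snd_chart_inv \<xi>)
  qed
  have open_J: "open {t \<in> J. ?\<gamma> t \<in> fst c'}" if c': "c' \<in> M" for c'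
  proof -
    have cont: "continuous_on J \<xi>"
      using der has_vector_derivative_continuous
      by (intro continuous_at_imp_continuous_on) blast
    have "{t \<in> J. ?\<gamma> t \<in> fst c'} = J \<inter> \<xi> -` (snd c ` (fst c \<inter> fst c'))"
    proof (intro set_eqI iffI)
      fix t assume t: "t \<in> {t \<in> J. ?\<gamma> t \<in> fst c'}"
      then have "\<xi> t = snd c (?\<gamma> t)"
        using snd_chart_inv[OF \<xi>] by simp
      then show "t \<in> J \<inter> \<xi> -` (snd c ` (fst c \<inter> fst c'))"
        using t in_c by auto
    next
      fix t assume "t \<in> J \<inter> \<xi> -` (snd c ` (fst c \<inter> fst c'))"
      then show "t \<in> {t \<in> J. ?\<gamma> t \<in> fst c'}"
        using chart_inv_snd[OF c] by auto
    qed
    then show ?thesis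
      using continuous_open_preimage[OF cont J open_overlap[OF c c']] by simp
  qed
  have "(snd c' \<circ> ?\<gamma>) differentiable_on {t \<in> J. ?\<gamma> t \<in> fst c'}" if c': "c' \<in> M" for c'
    unfolding differentiable_on_def
  proof
    fix t assume t: "t \<in> {t \<in> J. ?\<gamma> t \<in> fst c'}"
    have "(snd c' \<circ> ?\<gamma> has_vector_derivative transition_deriv c c' (?\<gamma> t) (Z (?\<gamma> t) c)) (at t)"
      using t by (intro has_vector_derivative_change_chart[OF c c' _ ev der']) auto
    then show "(snd c' \<circ> ?\<gamma>) differentiable (at t within {t \<in> J. ?\<gamma> t \<in> fst c'})"
      using differentiableI_vector differentiable_at_withinI by blast
  qed
  moreover have "velocity M ?\<gamma> t = Z (?\<gamma> t)" if "t \<in> J" for t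
    using velocity_in_tangent_space(1)[OF c ev[OF that] der'[OF that]]
      coord_vec_of_tangent[OF c in_c[OF that]] Z[OF that] by simp
  ultimately show ?thesis
    using open_J in_c c by (auto simp: integral_curve_def differentiable_curve_def carrier_def)
qed

section \<open>The tangent bundle as an atlas\<close>

lemma fst_tangent_chart: "fst (tangent_chart M c) = Sigma (fst c) (tangent_space M)"
  and snd_tangent_chart: "snd (tangent_chart M c) v = (snd c (fst v), snd v c)"
  by (simp_all add: tangent_chart_def)

lemma tangent_chart_image:
  assumes "c \<in> M" "U \<subseteq> fst c"
  shows "snd (tangent_chart M c) ` Sigma U (tangent_space M) = (snd c ` U) \<times> UNIV"
proof (intro set_eqI iffI)
  fix z assume "z \<in> (snd c ` U) \<times> (UNIV :: 'e set)"
  then obtain q where q: "q \<in> U" "z = (snd c q, snd z)"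
    by auto
  then have "(q, coord_vec M c q (snd z)) \<in> Sigma U (tangent_space M)"
    "z = snd (tangent_chart M c) (q, coord_vec M c q (snd z))"
    using assms coord_vec_in_tangent_space coord_vec_self by (auto simp: snd_tangent_chart subset_iff)
  then show "z \<in> snd (tangent_chart M c) ` Sigma U (tangent_space M)"
    by blast
qed (auto simp: snd_tangent_chart)

lemma inj_on_tangent_chart: "c \<in> M \<Longrightarrow> inj_on (snd (tangent_chart M c)) (fst (tangent_chart M c))"
proof (rule inj_onI)
  fix v w
  assume c: "c \<in> M" and v: "v \<in> fst (tangent_chart M c)" and w: "w \<in> fst (tangent_chart M c)"
    and eq: "snd (tangent_chart M c) v = snd (tangent_chart M c) w"
  have "fst v \<in> fst c" "fst w \<in> fst c"
    using v w by (auto simp: fst_tangent_chart)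
  moreover have "snd c (fst v) = snd c (fst w)"
    using eq by (simp add: snd_tangent_chart)
  ultimately have "fst v = fst w"
    using chart[OF c] by (meson inj_onD is_chart_def)
  moreover from this have "snd v = snd w"
    using c v w eq tangent_eqI[OF c] by (auto simp: fst_tangent_chart snd_tangent_chart)
  ultimately show "v = w"
    by (rule prod_eqI)
qed

lemma chart_inv_tangent_chart:
  assumes "c \<in> M" "x \<in> snd c ` fst c"
  shows "chart_inv (tangent_chart M c) (x, y) = (chart_inv c x, coord_vec M c (chart_inv c x) y)"
  unfolding chart_inv_def[of "tangent_chart M c"]
proof (rule inv_into_f_eq[OF inj_on_tangent_chart[OF assms(1)]])
  have q: "chart_inv c x \<in> fst c"
    by (rule chart_inv_in[OF assms(2)])
  show "(chart_inv c x, coord_vec M c (chart_inv c x) y) \<in> fst (tangent_chart M c)"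
    using q coord_vec_in_tangent_space[OF assms(1) q] by (simp add: fst_tangent_chart)
  show "snd (tangent_chart M c) (chart_inv c x, coord_vec M c (chart_inv c x) y) = (x, y)"
    using snd_chart_inv[OF assms(2)] coord_vec_self[OF assms(1) q] by (simp add: snd_tangent_chart)
qed

text \<open>In coordinates the transition is
  \<open>(x, y) \<mapsto> (\<tau> x, D\<tau>(x) y)\<close>. Expanding \<open>y\<close> in the basis
  turns the second component into a sum of products of smooth functions of \<open>y\<close> and of
  \<open>x\<close>.\<close>

lemma smooth_tangent_transition:
  assumes c: "c \<in> M" "c' \<in> M"
  shows "smooth_on ((snd c ` (fst c \<inter> fst c')) \<times> UNIV) (transition (tangent_chart M c) (tangent_chart M c'))"
proof -
  let ?U = "snd c ` (fst c \<inter> fst c')" and ?\<tau> = "transition c c'"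
  have U: "open (?U \<times> (UNIV :: 'e set))"
    using open_overlap[OF c] by (simp add: open_Times)
  have fst: "smooth_on (?U \<times> (UNIV :: 'e set)) fst" and snd: "smooth_on (?U \<times> (UNIV :: 'e set)) snd"
    using U by (auto intro: smooth_on_linear bounded_linear_fst bounded_linear_snd)
  have comp: "smooth_on (?U \<times> (UNIV :: 'e set)) (h \<circ> fst)" if "smooth_on ?U h" for h :: "'e \<Rightarrow> 'e"
    by (rule smooth_on_compose[OF U open_overlap[OF c] _ that fst]) auto
  show ?thesis
  proof (rule smooth_on_cong[OF U])
    have "smooth_on (?U \<times> (UNIV :: 'e set)) (\<lambda>z. (snd z \<bullet> i) *\<^sub>R (((\<lambda>x. frechet_derivative ?\<tau> (at x) i) \<circ> fst) z))"
      for i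
      using smooth_on_frechet_derivative[OF open_overlap[OF c] smooth_transition[OF c]]
      by (intro smooth_on_scaleR[OF U] comp smooth_on_bounded_linear[OF U bounded_linear_inner_left] snd)
    then have "smooth_on (?U \<times> (UNIV :: 'e set))
        (\<lambda>z. \<Sum>i\<in>Basis. (snd z \<bullet> i) *\<^sub>R (((\<lambda>x. frechet_derivative ?\<tau> (at x) i) \<circ> fst) z))"
      by (intro smooth_on_sum[OF U])
    then show "smooth_on (?U \<times> UNIV) (\<lambda>z. ((?\<tau> \<circ> fst) z,
        \<Sum>i\<in>Basis. (snd z \<bullet> i) *\<^sub>R (((\<lambda>x. frechet_derivative ?\<tau> (at x) i) \<circ> fst) z)))"
      by (intro smooth_on_Pair[OF U] comp[OF smooth_transition[OF c]])
    fix z assume "z \<in> ?U \<times> (UNIV :: 'e set)"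
    then obtain q y where z: "z = (snd c q, y)" "q \<in> fst c" "q \<in> fst c'"
      by auto
    have "transition (tangent_chart M c) (tangent_chart M c') z = (snd c' q, transition_deriv c c' q y)"
      using z c by (simp add: chart_inv_tangent_chart chart_inv_snd snd_tangent_chart coord_vec_apply)
    then show "((?\<tau> \<circ> fst) z,
        \<Sum>i\<in>Basis. (snd z \<bullet> i) *\<^sub>R (((\<lambda>x. frechet_derivative ?\<tau> (at x) i) \<circ> fst) z)) =
      transition (tangent_chart M c) (tangent_chart M c') z"
      using linear_eq_sum_Basis[OF linear_transition_deriv[OF c z(2,3)], of y] z c
      by (simp add: chart_inv_snd)
  qed
qed

lemma atlas_tangent_bundle: "atlas (tangent_bundle M)"
proof
  fix tc assume "tc \<in> tangent_bundle M"
  then obtain c where c: "c \<in> M" "tc = tangent_chart M c"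
    by (auto simp: tangent_bundle_def)
  show "is_chart tc"
    unfolding is_chart_def c(2)
    using inj_on_tangent_chart[OF c(1)] tangent_chart_image[OF c(1) subset_refl] open_chart[OF c(1)]
    by (simp add: fst_tangent_chart open_Times)
  fix tc' assume "tc' \<in> tangent_bundle M"
  then obtain c' where c': "c' \<in> M" "tc' = tangent_chart M c'"
    by (auto simp: tangent_bundle_def)
  have dom: "fst tc \<inter> fst tc' = Sigma (fst c \<inter> fst c') (tangent_space M)"
    "fst tc \<inter> fst tc' = Sigma (fst c' \<inter> fst c) (tangent_space M)"
    by (auto simp: c(2) c'(2) fst_tangent_chart)
  have img: "snd tc ` (fst tc \<inter> fst tc') = (snd c ` (fst c \<inter> fst c')) \<times> UNIV"
    "snd tc' ` (fst tc \<inter> fst tc') = (snd c' ` (fst c' \<inter> fst c)) \<times> UNIV"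
    using tangent_chart_image[OF c(1), of "fst c \<inter> fst c'"]
      tangent_chart_image[OF c'(1), of "fst c' \<inter> fst c"]
    unfolding c(2) c'(2) using dom by (simp_all add: c(2) c'(2))
  show "compatible tc tc'"
    unfolding compatible_def img
    using open_overlap[OF c(1) c'(1)] open_overlap[OF c'(1) c(1)]
      smooth_tangent_transition[OF c(1) c'(1)] smooth_tangent_transition[OF c'(1) c(1)]
    by (simp add: open_Times c(2) c'(2))
qed

lemma carrier_tangent_bundle: "carrier (tangent_bundle M) = Sigma (carrier M) (tangent_space M)"
  by (auto simp: carrier_def tangent_bundle_def fst_tangent_chart)

end

section \<open>Complements of a distribution\<close>

text \<open>Coefficients are attached to indices and not to vectors, since the family may repeat a
  vector.\<close>

lemma span_image_sum:
  fixes x :: "'i \<Rightarrow> 'v::real_vector"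
  assumes "finite I" "v \<in> span (x ` I)"
  obtains \<xi> where "v = (\<Sum>i\<in>I. \<xi> i *\<^sub>R x i)"
proof -
  have "\<exists>\<xi>. v = (\<Sum>i\<in>I. \<xi> i *\<^sub>R x i)"
    using assms(2)
  proof (induction rule: span_induct_alt)
    case base
    show ?case
      by (intro exI[of _ "\<lambda>_. 0"]) simp
  next
    case (step s w v)
    then obtain i \<xi> where i: "i \<in> I" "w = x i" and v: "v = (\<Sum>i\<in>I. \<xi> i *\<^sub>R x i)"
      by blast
    have "s *\<^sub>R w + v = (\<Sum>j\<in>I. ((if j = i then s else 0) + \<xi> j) *\<^sub>R x j)"
      using i assms(1)
      by (simp add: v scaleR_add_left sum.distrib if_distrib[of "\<lambda>s. s *\<^sub>R _"] sum.delta' cong: if_cong)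
    then show ?case
      by (rule exI[of _ "\<lambda>j. (if j = i then s else 0) + \<xi> j"])
  qed
  then show thesis
    using that by blast
qed

lemma smooth_fun_on_chart:
  "smooth_fun_on M W f \<Longrightarrow> c \<in> M \<Longrightarrow> smooth_on (snd c ` (W \<inter> fst c)) (\<lambda>x. f (chart_inv c x))"
  by (simp add: smooth_fun_on_def o_def)

section \<open>Covectors, the Gram matrix and smoothness of \<open>sharp\<close>\<close>

context atlas
begin

lemma linear_covector_coords:
  assumes "c \<in> M" "q \<in> fst c" "covector M q \<alpha>"
  shows "linear (\<lambda>y. \<alpha> (coord_vec M c q y))"
  using assms coord_vec_in_tangent_space[OF assms(1,2)]
  by (intro linearI)
    (simp_all add: covector_def linear_add[OF linear_coord_vec] linear_cmul[OF linear_coord_vec])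

text \<open>Covectors are linear on the tangent space only, so they are compared after being pulled
  back to the model space by \<open>coord_vec\<close>, where linear maps are determined on the
  basis.\<close>

lemma covector_eqI:
  assumes c: "c \<in> M" "q \<in> fst c" and "covector M q \<alpha>" "covector M q \<beta>"
    and eq: "\<And>b. b \<in> Basis \<Longrightarrow> \<alpha> (coord_vec M c q b) = \<beta> (coord_vec M c q b)"
    and v: "v \<in> tangent_space M q"
  shows "\<alpha> v = \<beta> v"
proof -
  have "(\<lambda>y. \<alpha> (coord_vec M c q y)) = (\<lambda>y. \<beta> (coord_vec M c q y))"
    using assms by (intro linear_eq_stdbasis linear_covector_coords)
  then show ?thesis
    using coord_vec_of_tangent[OF c v] by metis
qed

lemma covector_diff:
  assumes "covector M q \<alpha>" "v \<in> tangent_space M q" "w \<in> tangent_space M q"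
  shows "\<alpha> (v - w) = \<alpha> v - \<alpha> w"
proof -
  have "\<alpha> ((v - w) + w) = \<alpha> (v - w) + \<alpha> w"
    using assms subspace_diff[OF subspace_tangent_space] unfolding covector_def by blast
  then show ?thesis
    by simp
qed

text \<open>The Gram matrix of the metric in the chart \<open>c\<close>, as an endomorphism of the
  model space, so that injectivity implies surjectivity.\<close>

definition gram ::
  "('p \<Rightarrow> ('p, 'e) tvec \<Rightarrow> ('p, 'e) tvec \<Rightarrow> real) \<Rightarrow> ('p, 'e) chart \<Rightarrow> 'p \<Rightarrow> 'e \<Rightarrow> 'e" where
  "gram g c q y = (\<Sum>b\<in>Basis. g q (coord_vec M c q b) (coord_vec M c q y) *\<^sub>R b)"

lemma gram_inner: "b \<in> Basis \<Longrightarrow> gram g c q y \<bullet> b = g q (coord_vec M c q b) (coord_vec M c q y)"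
  by (simp add: gram_def inner_sum_left inner_Basis if_distrib sum.delta cong: if_cong)

context
  fixes g
  assumes g: "riemannian_metric M g"
begin

lemma metric_covector: "q \<in> carrier M \<Longrightarrow> v \<in> tangent_space M q \<Longrightarrow> covector M q (g q v)"
  and metric_sym: "q \<in> carrier M \<Longrightarrow> v \<in> tangent_space M q \<Longrightarrow> w \<in> tangent_space M q \<Longrightarrow> g q v w = g q w v"
  and metric_pos: "q \<in> carrier M \<Longrightarrow> v \<in> tangent_space M q \<Longrightarrow> v \<noteq> 0 \<Longrightarrow> 0 < g q v v"
  using g by (auto simp: riemannian_metric_def)

lemma linear_gram:
  assumes "c \<in> M" "q \<in> fst c"
  shows "linear (gram g c q)"
proof -
  have lin: "linear (\<lambda>y. g q (coord_vec M c q b) (coord_vec M c q y))" for b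
    using assms coord_vec_in_tangent_space[OF assms]
    by (intro linear_covector_coords metric_covector in_carrier)
  show ?thesis
    using linear_add[OF lin] linear_cmul[OF lin]
    by (intro linearI) (simp_all add: gram_def scaleR_add_left sum.distrib scaleR_sum_right)
qed

text \<open>If the image of \<open>y\<close> is 0, its vector is orthogonal to the coordinate basis,
  hence to itself, and positive definiteness makes it vanish.\<close>

lemma inj_gram:
  assumes "c \<in> M" "q \<in> fst c"
  shows "inj (gram g c q)"
proof (subst linear_injective_0[OF linear_gram[OF assms]], intro allI impI)
  fix y assume 0: "gram g c q y = 0"
  let ?v = "coord_vec M c q y"
  have v: "?v \<in> tangent_space M q"
    by (rule coord_vec_in_tangent_space[OF assms])
  have q: "q \<in> carrier M"
    by (rule in_carrier[OF assms])
  have "g q ?v ?v = (\<lambda>_. 0) ?v"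
  proof (rule covector_eqI[OF assms metric_covector[OF q v] _ _ v])
    show "covector M q (\<lambda>_. 0)"
      by (simp add: covector_def)
    fix b :: 'e assume "b \<in> Basis"
    then show "g q ?v (coord_vec M c q b) = 0"
      using gram_inner[of b g c q y] 0 metric_sym[OF q v coord_vec_in_tangent_space[OF assms, of b]]
      by simp
  qed
  then have "?v = 0"
    using metric_pos[OF q v] by auto
  then show "y = 0"
    using coord_vec_self[OF assms, of y] by simp
qed

lemma gram_tangent:
  assumes c: "c \<in> M" "q \<in> fst c" and v: "v \<in> tangent_space M q"
  shows "gram g c q (v c) = (\<Sum>b\<in>Basis. g q v (coord_vec M c q b) *\<^sub>R b)"
  unfolding gram_def coord_vec_of_tangent[OF c v]
  using metric_sym[OF in_carrier[OF c] coord_vec_in_tangent_space[OF c] v] by simp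

text \<open>Justifies the definite description in \<open>sharp\<close>: a representing vector exists
  because the Gram map is onto, and the difference of two of them is orthogonal to itself.\<close>

lemma sharp_props:
  assumes q: "q \<in> carrier M" and \<alpha>: "covector M q \<alpha>"
  shows "sharp M g q \<alpha> \<in> tangent_space M q"
    and "w \<in> tangent_space M q \<Longrightarrow> g q (sharp M g q \<alpha>) w = \<alpha> w"
proof -
  obtain c where c: "c \<in> M" "q \<in> fst c"
    using q by (auto simp: carrier_def)
  have "surj (gram g c q)"
    by (rule linear_injective_imp_surjective[OF linear_gram[OF c] inj_gram[OF c]]) (rule refl)
  then obtain y where y: "gram g c q y = (\<Sum>b\<in>Basis. \<alpha> (coord_vec M c q b) *\<^sub>R b)"
    by (metis surjD)
  let ?v = "coord_vec M c q y"
  have v: "?v \<in> tangent_space M q"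
    by (rule coord_vec_in_tangent_space[OF c])
  have ex: "g q ?v w = \<alpha> w" if w: "w \<in> tangent_space M q" for w
  proof (rule covector_eqI[OF c metric_covector[OF q v] \<alpha> _ w])
    fix b :: 'e assume b: "b \<in> Basis"
    have "(\<Sum>b\<in>Basis. \<alpha> (coord_vec M c q b) *\<^sub>R b) \<bullet> b = \<alpha> (coord_vec M c q b)"
      using b by (simp add: inner_sum_left inner_Basis if_distrib sum.delta cong: if_cong)
    then show "g q ?v (coord_vec M c q b) = \<alpha> (coord_vec M c q b)"
      using gram_inner[OF b, of g c q y] y metric_sym[OF q v coord_vec_in_tangent_space[OF c, of b]]
      by simp
  qed
  have "\<exists>!v. v \<in> tangent_space M q \<and> (\<forall>w\<in>tangent_space M q. g q v w = \<alpha> w)"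
  proof (rule ex1I[of _ ?v])
    fix v' assume v': "v' \<in> tangent_space M q \<and> (\<forall>w\<in>tangent_space M q. g q v' w = \<alpha> w)"
    let ?d = "v' - ?v"
    have d: "?d \<in> tangent_space M q"
      using v v' subspace_diff[OF subspace_tangent_space] by blast
    have "g q ?d ?d = g q ?d v' - g q ?d ?v"
      using v v' by (intro covector_diff[OF metric_covector[OF q d]]) blast+
    also have "\<dots> = g q v' ?d - g q ?v ?d"
      using metric_sym[OF q d] v v' by metis
    also have "\<dots> = 0"
      using v' ex[OF d] d by simp
    finally have "?d = 0"
      using metric_pos[OF q d] by force
    then show "v' = ?v"
      by simp
  qed (use v ex in auto)
  from theI'[OF this]
  show "sharp M g q \<alpha> \<in> tangent_space M q"
    and "w \<in> tangent_space M q \<Longrightarrow> g q (sharp M g q \<alpha>) w = \<alpha> w"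
    unfolding sharp_def by blast+
qed

text \<open>The coordinates of \<open>sharp\<close> solve the linear system given by the Gram map
  and the components of \<open>\<alpha>\<close>, both smooth in the base point.\<close>

lemma smooth_sharp:
  assumes \<alpha>: "one_form M \<alpha>" and c: "c \<in> M"
  shows "smooth_on (snd c ` fst c) (\<lambda>x. sharp M g (chart_inv c x) (\<alpha> (chart_inv c x)) c)"
proof (rule smooth_on_linear_solve[where A = "\<lambda>x. gram g c (chart_inv c x)"
      and b = "\<lambda>x. \<Sum>b\<in>Basis. \<alpha> (chart_inv c x) (coord_vec M c (chart_inv c x) b) *\<^sub>R b"])
  show U: "open (snd c ` fst c)"
    by (rule open_chart[OF c])
  show "smooth_on (snd c ` fst c) (\<lambda>x. gram g c (chart_inv c x) y)" for y
  proof -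
    have "smooth_on (snd c ` fst c) (\<lambda>x. g (chart_inv c x) (coord_vec M c (chart_inv c x) b)
        (coord_vec M c (chart_inv c x) y))" for b
    proof -
      have "smooth_fun_on M (fst c) (\<lambda>q. g q (coord_vec M c q b) (coord_vec M c q y))"
        using g c by (simp add: riemannian_metric_def)
      from smooth_fun_on_chart[OF this c] show ?thesis
        by simp
    qed
    then show ?thesis
      unfolding gram_def by (intro smooth_on_sum smooth_on_scaleR smooth_on_const U)
  qed
  have "smooth_on (snd c ` fst c) (\<lambda>x. \<alpha> (chart_inv c x) (coord_vec M c (chart_inv c x) b))" for b
  proof -
    have "smooth_fun_on M (fst c) (\<lambda>q. \<alpha> q (coord_vec M c q b))"
      using \<alpha> c by (simp add: one_form_def)
    from smooth_fun_on_chart[OF this c] show ?thesis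
      by simp
  qed
  then show "smooth_on (snd c ` fst c)
      (\<lambda>x. \<Sum>b\<in>Basis. \<alpha> (chart_inv c x) (coord_vec M c (chart_inv c x) b) *\<^sub>R b)"
    by (intro smooth_on_sum smooth_on_scaleR smooth_on_const U)
  fix x assume "x \<in> snd c ` fst c"
  then have q: "chart_inv c x \<in> fst c"
    by (rule chart_inv_in)
  show "linear (gram g c (chart_inv c x))" "inj (gram g c (chart_inv c x))"
    using linear_gram[OF c q] inj_gram[OF c q] .
  have q': "chart_inv c x \<in> carrier M"
    by (rule in_carrier[OF c q])
  have cov: "covector M (chart_inv c x) (\<alpha> (chart_inv c x))"
    using \<alpha> q' by (simp add: one_form_def)
  show "gram g c (chart_inv c x) (sharp M g (chart_inv c x) (\<alpha> (chart_inv c x)) c) =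
      (\<Sum>b\<in>Basis. \<alpha> (chart_inv c x) (coord_vec M c (chart_inv c x) b) *\<^sub>R b)"
    using gram_tangent[OF c q sharp_props(1)[OF q' cov]]
      sharp_props(2)[OF q' cov coord_vec_in_tangent_space[OF c q]] by simp
qed

end

end

section \<open>Frames adapted to the distribution and the inputs\<close>

lemma Basis_split:
  assumes "DIM('e::euclidean_space) = r + CARD('m::finite)"
  obtains j :: "nat \<Rightarrow> 'e::euclidean_space" and k :: "'m::finite \<Rightarrow> 'e" where "inj_on j {..<r}" "inj k"
    and "j ` {..<r} \<union> range k = Basis" "j ` {..<r} \<inter> range k = {}"
proof -
  obtain B where B: "B \<subseteq> (Basis :: 'e set)" "card B = r" "finite B"
    using obtain_subset_with_card_n[of r "Basis :: 'e set"] assms finite_Basis by (metis le_add1)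
  obtain j where j: "bij_betw j {..<r} B"
    using finite_same_card_bij[of "{..<r}" B] B by auto
  have "card (Basis - B :: 'e set) = CARD('m)"
    using B assms by (simp add: card_Diff_subset)
  then obtain k where k: "bij_betw k (UNIV :: 'm set) (Basis - B)"
    using finite_same_card_bij[of "UNIV :: 'm set" "Basis - B"] by auto
  show thesis
    using that[of j k] j k B(1) by (auto simp: bij_betw_def)
qed

text \<open>The linear content of transversality. By \<open>complement\<close> the distribution and
  the inputs together span every tangent space, and \<open>dims\<close> makes the number of spanning
  vectors equal to the dimension, so the sum is direct.\<close>

locale complemented_distribution = atlas M
  for M :: "('p, 'e::euclidean_space) chart set" +
  fixes r :: nat and D :: "'p \<Rightarrow> ('p, 'e) tvec set" and Y :: "'m::finite \<Rightarrow> ('p, 'e) vfield"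
  assumes D: "distribution M r D"
    and Y_tangent: "q \<in> carrier M \<Longrightarrow> Y a q \<in> tangent_space M q"
    and Y_smooth: "c \<in> M \<Longrightarrow> smooth_on (snd c ` fst c) (\<lambda>x. Y a (chart_inv c x) c)"
    and complement: "q \<in> carrier M \<Longrightarrow> v \<in> tangent_space M q \<Longrightarrow>
      \<exists>d\<in>D q. \<exists>w\<in>input_distribution Y q. v = d + w"
    and dims: "DIM('e) = r + CARD('m)"
begin

lemma D_subspace: "q \<in> carrier M \<Longrightarrow> subspace (D q)"
  and D_tangent: "q \<in> carrier M \<Longrightarrow> D q \<subseteq> tangent_space M q"
  using D by (auto simp: distribution_def)

lemma local_frame:
  assumes "q \<in> carrier M"
  obtains W X where "openin (mtop M) W" "q \<in> W" "\<And>i. i < r \<Longrightarrow> smooth_vfield_on M W (X i)"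
    and "\<And>p. p \<in> W \<Longrightarrow> D p = span ((\<lambda>i. X i p) ` {..<r})"
  using D assms unfolding distribution_def by metis

lemma input_tangent: "q \<in> carrier M \<Longrightarrow> (\<Sum>a\<in>UNIV. (\<eta> $ a) *\<^sub>R Y a q) \<in> tangent_space M q"
  by (intro subspace_sum subspace_scale Y_tangent subspace_tangent_space)

text \<open>As \<open>r\<close> is no type, coefficients in the frame \<open>X\<^sub>1, \<dots>, X\<^sub>r, Y\<^sup>1, \<dots>, Y\<^sup>m\<close> are stored as a vector
  of the model space, whose basis \<open>j\<close> and \<open>k\<close> enumerate.\<close>

definition frame_map where
  "frame_map X j k c q y =
    (\<Sum>i<r. (y \<bullet> j i) *\<^sub>R X i q c) + (\<Sum>a\<in>UNIV. (y \<bullet> k a) *\<^sub>R Y a q c)"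
  for X :: "nat \<Rightarrow> ('p, 'e) vfield" and j :: "nat \<Rightarrow> 'e" and k :: "'m \<Rightarrow> 'e"

lemma linear_frame_map: "linear (frame_map X j k c q)"
  by (rule linearI)
    (simp_all add: frame_map_def inner_add_left scaleR_add_left sum.distrib scaleR_sum_right algebra_simps)

context
  fixes q X and j :: "nat \<Rightarrow> 'e" and k :: "'m \<Rightarrow> 'e"
  assumes q: "q \<in> carrier M" and frame: "D q = span ((\<lambda>i. X i q) ` {..<r})"
    and jk: "inj_on j {..<r}" "inj k" "j ` {..<r} \<union> range k = (Basis :: 'e set)"
      "j ` {..<r} \<inter> range k = {}"
begin

lemma frame_map_coeffs:
  "frame_map X j k c q ((\<Sum>i<r. \<xi> i *\<^sub>R j i) + (\<Sum>a\<in>UNIV. \<eta> a *\<^sub>R k a)) =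
    ((\<Sum>i<r. \<xi> i *\<^sub>R X i q) + (\<Sum>a\<in>UNIV. \<eta> a *\<^sub>R Y a q)) c"
  and coeffs_inner:
  "((\<Sum>i<r. \<xi> i *\<^sub>R j i) + (\<Sum>a\<in>UNIV. \<eta> a *\<^sub>R k a)) \<bullet> k a = \<eta> a"
proof -
  have B: "j i \<in> Basis" "k a \<in> Basis" if "i < r" for i a
    using jk(3) that by auto
  have B': "k a \<in> Basis" for a
    using jk(3) by auto
  have jj: "j i \<bullet> j i' = (if i = i' then 1 else 0)" if "i < r" "i' < r" for i i'
    using B(1)[OF that(1)] B(1)[OF that(2)] inj_onD[OF jk(1), of i i'] that by (auto simp: inner_Basis)
  have kk: "k a \<bullet> k a' = (if a = a' then 1 else 0)" for a a'
    using B'[of a] B'[of a'] injD[OF jk(2), of a a'] by (auto simp: inner_Basis)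
  have jk0: "j i \<bullet> k a = 0" "k a \<bullet> j i = 0" if "i < r" for i a
    using B(1)[OF that] B'[of a] jk(4) that by (auto simp: inner_Basis)
  let ?y = "(\<Sum>i<r. \<xi> i *\<^sub>R j i) + (\<Sum>a\<in>UNIV. \<eta> a *\<^sub>R k a)"
  have yk: "?y \<bullet> k a = \<eta> a" for a
    by (simp add: inner_add_left inner_sum_left kk jk0 if_distrib sum.delta cong: if_cong)
  have yj: "?y \<bullet> j i = \<xi> i" if "i < r" for i
    using that by (simp add: inner_add_left inner_sum_left jj jk0 if_distrib sum.delta cong: if_cong)
  show "?y \<bullet> k a = \<eta> a"
    by (rule yk)
  show "frame_map X j k c q ?y = ((\<Sum>i<r. \<xi> i *\<^sub>R X i q) + (\<Sum>a\<in>UNIV. \<eta> a *\<^sub>R Y a q)) c"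
    unfolding frame_map_def yk using yj by (simp add: sum_fun_apply)
qed

lemma surj_frame_map:
  assumes "c \<in> M" "q \<in> fst c"
  shows "surj (frame_map X j k c q)"
proof -
  have "\<exists>y. z = frame_map X j k c q y" for z
  proof -
    obtain d w where dw: "d \<in> D q" "w \<in> input_distribution Y q" "coord_vec M c q z = d + w"
      using complement[OF q coord_vec_in_tangent_space[OF assms]] by blast
    obtain \<xi> where \<xi>: "d = (\<Sum>i<r. \<xi> i *\<^sub>R X i q)"
      by (rule span_image_sum[OF finite_lessThan dw(1)[unfolded frame]])
    obtain \<eta> where \<eta>: "w = (\<Sum>a\<in>UNIV. \<eta> a *\<^sub>R Y a q)"
      by (rule span_image_sum[OF finite_class.finite_UNIV dw(2)[unfolded input_distribution_def]])
    have "z = frame_map X j k c q ((\<Sum>i<r. \<xi> i *\<^sub>R j i) + (\<Sum>a\<in>UNIV. \<eta> a *\<^sub>R k a))"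
      unfolding frame_map_coeffs \<xi>[symmetric] \<eta>[symmetric] dw(3)[symmetric]
      by (rule coord_vec_self[OF assms, symmetric])
    then show ?thesis
      by blast
  qed
  then show ?thesis
    unfolding surj_def by blast
qed

text \<open>This is the dimension count: \<open>frame_map\<close> is an endomorphism of the model
  space, and a surjective one is injective. Directness of the sum comes from here.\<close>

lemma inj_frame_map:
  assumes "c \<in> M" "q \<in> fst c"
  shows "inj (frame_map X j k c q)"
  by (rule linear_surjective_imp_injective[OF linear_frame_map surj_frame_map[OF assms]]) simp

end

text \<open>The \<open>Y\<close>-component of \<open>v\<close> modulo \<open>D q\<close>. Membership
  in \<open>D q\<close> replaces any choice of frame or chart, which makes it a global function
  although frames exist only locally.\<close>

definition coeff :: "'p \<Rightarrow> ('p, 'e) tvec \<Rightarrow> real ^ 'm" where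
  "coeff q v = (THE \<eta>. v - (\<Sum>a\<in>UNIV. (\<eta> $ a) *\<^sub>R Y a q) \<in> D q)"

lemma coeff_exists:
  assumes q: "q \<in> carrier M" and v: "v \<in> tangent_space M q"
  shows "\<exists>\<eta> :: real ^ 'm. v - (\<Sum>a\<in>UNIV. (\<eta> $ a) *\<^sub>R Y a q) \<in> D q"
proof -
  obtain d w where dw: "d \<in> D q" "w \<in> input_distribution Y q" "v = d + w"
    using complement[OF q v] by blast
  obtain \<eta> where "w = (\<Sum>a\<in>UNIV. \<eta> a *\<^sub>R Y a q)"
    by (rule span_image_sum[OF finite_class.finite_UNIV dw(2)[unfolded input_distribution_def]])
  then show ?thesis
    using dw by (intro exI[of _ "\<chi> a. \<eta> a"]) simp
qed

lemma coeff_unique: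
  fixes \<eta> \<eta>' :: "real ^ 'm"
  assumes q: "q \<in> carrier M"
    and \<eta>: "v - (\<Sum>a\<in>UNIV. (\<eta> $ a) *\<^sub>R Y a q) \<in> D q"
    and \<eta>': "v - (\<Sum>a\<in>UNIV. (\<eta>' $ a) *\<^sub>R Y a q) \<in> D q"
  shows "\<eta> = \<eta>'"
proof -
  obtain c where c: "c \<in> M" "q \<in> fst c"
    using q by (auto simp: carrier_def)
  obtain W X where "q \<in> W" "\<And>p. p \<in> W \<Longrightarrow> D p = span ((\<lambda>i. X i p) ` {..<r})"
    using local_frame[OF q] by metis
  then have frame: "D q = span ((\<lambda>i. X i q) ` {..<r})"
    by blast
  obtain j k where jk: "inj_on j {..<r}" "inj (k :: 'm \<Rightarrow> 'e)" "j ` {..<r} \<union> range k = Basis"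
      "j ` {..<r} \<inter> range k = {}"
    using Basis_split[OF dims] by blast
  have "(\<Sum>a\<in>UNIV. ((\<eta>' - \<eta>) $ a) *\<^sub>R Y a q) =
      (v - (\<Sum>a\<in>UNIV. (\<eta> $ a) *\<^sub>R Y a q)) - (v - (\<Sum>a\<in>UNIV. (\<eta>' $ a) *\<^sub>R Y a q))"
    by (simp add: scaleR_diff_left sum_subtractf)
  then have "(\<Sum>a\<in>UNIV. ((\<eta>' - \<eta>) $ a) *\<^sub>R Y a q) \<in> span ((\<lambda>i. X i q) ` {..<r})"
    using subspace_diff[OF D_subspace[OF q] \<eta> \<eta>'] frame by simp
  then obtain \<xi> where \<xi>: "(\<Sum>a\<in>UNIV. ((\<eta>' - \<eta>) $ a) *\<^sub>R Y a q) = (\<Sum>i<r. \<xi> i *\<^sub>R X i q)"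
    by (rule span_image_sum[OF finite_lessThan])
  \<comment> \<open>Two coefficient vectors of \<open>v\<close> differ by an input combination that
    lies in \<open>D q\<close>; together with its frame coefficients it encodes a vector in the
    kernel of \<open>frame_map\<close>.\<close>
  let ?y = "(\<Sum>i<r. \<xi> i *\<^sub>R j i) + (\<Sum>a\<in>UNIV. ((\<eta> - \<eta>') $ a) *\<^sub>R k a)"
  have "(\<Sum>i<r. \<xi> i *\<^sub>R X i q) + (\<Sum>a\<in>UNIV. ((\<eta> - \<eta>') $ a) *\<^sub>R Y a q) = 0"
    unfolding \<xi>[symmetric] by (simp add: scaleR_diff_left sum_subtractf)
  then have "frame_map X j k c q ?y = 0"
    using frame_map_coeffs[where X = X, OF q frame jk, of c \<xi> "\<lambda>a. (\<eta> - \<eta>') $ a"] by simp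
  then have "?y = 0"
    using inj_frame_map[where X = X, OF q frame jk c] linear_injective_0[OF linear_frame_map] by blast
  then have "(\<eta> - \<eta>') $ a = 0" for a
    using coeffs_inner[where X = X, OF q frame jk, of \<xi> "\<lambda>a. (\<eta> - \<eta>') $ a" a] by (metis inner_zero_left)
  then show ?thesis
    by (simp add: vec_eq_iff)
qed

lemma coeff_in:
  assumes "q \<in> carrier M" "v \<in> tangent_space M q"
  shows "v - (\<Sum>a\<in>UNIV. (coeff q v $ a) *\<^sub>R Y a q) \<in> D q"
proof -
  have "\<exists>!\<eta> :: real ^ 'm. v - (\<Sum>a\<in>UNIV. (\<eta> $ a) *\<^sub>R Y a q) \<in> D q"
    using coeff_exists[OF assms] coeff_unique[OF assms(1)] by blast
  from theI'[OF this] show ?thesis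
    unfolding coeff_def .
qed

lemma coeff_eqI:
  assumes "q \<in> carrier M" "v \<in> tangent_space M q" "v - (\<Sum>a\<in>UNIV. (\<eta> $ a) *\<^sub>R Y a q) \<in> D q"
  shows "coeff q v = \<eta>"
  using coeff_unique[OF assms(1) coeff_in[OF assms(1,2)] assms(3)] .

lemma coeff_eq_0_iff:
  assumes "q \<in> carrier M" "v \<in> tangent_space M q"
  shows "coeff q v = 0 \<longleftrightarrow> v \<in> D q"
  using coeff_in[OF assms] coeff_eqI[OF assms, of 0] by auto

lemma coeff_add_input:
  assumes "q \<in> carrier M" "v \<in> tangent_space M q"
  shows "coeff q (v + (\<Sum>a\<in>UNIV. (\<eta> $ a) *\<^sub>R Y a q)) = coeff q v + \<eta>"
proof (rule coeff_eqI[OF assms(1)])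
  show "v + (\<Sum>a\<in>UNIV. (\<eta> $ a) *\<^sub>R Y a q) \<in> tangent_space M q"
    by (intro subspace_add[OF subspace_tangent_space] input_tangent assms)
  show "v + (\<Sum>a\<in>UNIV. (\<eta> $ a) *\<^sub>R Y a q) - (\<Sum>a\<in>UNIV. ((coeff q v + \<eta>) $ a) *\<^sub>R Y a q) \<in> D q"
    using coeff_in[OF assms] by (simp add: scaleR_add_left sum.distrib)
qed

text \<open>For \<open>b\<close> the coordinate expression of \<open>X\<close> this is
  \<open>\<Phi>\<close> in a tangent chart. Near each point a frame turns it into the
  \<open>k\<close>-components of the solution of a smooth linear system in the unknown frame
  coefficients.\<close>

lemma smooth_coeff:
  assumes c: "c \<in> M" and X0: "smooth_on (snd c ` fst c) b"
  shows "smooth_on ((snd c ` fst c) \<times> UNIV)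
    (\<lambda>z. coeff (chart_inv c (fst z)) (coord_vec M c (chart_inv c (fst z)) (snd z - b (fst z))))"
    (is "smooth_on _ ?f")
proof (rule smooth_on_local)
  fix z0 assume "z0 \<in> (snd c ` fst c) \<times> (UNIV :: 'e set)"
  then have x0: "fst z0 \<in> snd c ` fst c"
    by auto
  let ?q0 = "chart_inv c (fst z0)"
  have q0: "?q0 \<in> fst c" "?q0 \<in> carrier M"
    using chart_inv_in[OF x0] c by (auto simp: carrier_def)
  obtain W X where W: "openin (mtop M) W" "?q0 \<in> W" "\<And>i. i < r \<Longrightarrow> smooth_vfield_on M W (X i)"
    and frame: "\<And>p. p \<in> W \<Longrightarrow> D p = span ((\<lambda>i. X i p) ` {..<r})"
    using local_frame[OF q0(2)] by metis
  obtain j k where jk: "inj_on j {..<r}" "inj (k :: 'm \<Rightarrow> 'e)" "j ` {..<r} \<union> range k = Basis"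
      "j ` {..<r} \<inter> range k = {}"
    using Basis_split[OF dims] by blast
  define V where "V = snd c ` (W \<inter> fst c)"
  define U where "U = V \<times> (UNIV :: 'e set)"
  have V: "open V" "V \<subseteq> snd c ` fst c"
    unfolding V_def using open_chart_image[OF W(1) c] by auto
  have U: "open U"
    unfolding U_def using V(1) by (simp add: open_Times)
  have "fst z0 \<in> V"
    unfolding V_def using q0(1) W(2) snd_chart_inv[OF x0] by (metis IntI image_eqI)
  then have z0: "z0 \<in> U"
    unfolding U_def by (cases z0) simp
  have base: "chart_inv c (fst z) \<in> W" "chart_inv c (fst z) \<in> fst c" "chart_inv c (fst z) \<in> carrier M"
    if "z \<in> U" for z
    using that chart_inv_snd[OF c] c by (auto simp: U_def V_def carrier_def)
  have comp: "smooth_on U (\<lambda>z. h (fst z))" if "smooth_on V h" for h :: "'e \<Rightarrow> 'e"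
    using smooth_on_compose[OF U V(1) _ that smooth_on_linear[OF U bounded_linear_fst]]
    by (auto simp: U_def o_def)
  let ?A = "\<lambda>z. frame_map X j k c (chart_inv c (fst z))"
  have frame': "D (chart_inv c (fst z)) = span ((\<lambda>i. X i (chart_inv c (fst z))) ` {..<r})" if "z \<in> U" for z
    using frame base(1)[OF that] by blast
  have A: "surj (?A z)" "inj (?A z)" if "z \<in> U" for z
    using surj_frame_map[where X = X, OF base(3)[OF that] frame'[OF that] jk c base(2)[OF that]]
      inj_frame_map[where X = X, OF base(3)[OF that] frame'[OF that] jk c base(2)[OF that]] .
  \<comment> \<open>The frame coefficients of the vector with coordinates
    \<open>snd z - b (fst z)\<close>, chosen pointwise. Injectivity makes the solution unique and
    lets \<open>smooth_on_linear_solve\<close> prove this choice smooth.\<close>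
  define y where "y z = (SOME y. ?A z y = snd z - b (fst z))" for z
  have y: "?A z (y z) = snd z - b (fst z)" if z: "z \<in> U" for z
  proof -
    obtain y' where "snd z - b (fst z) = ?A z y'"
      using A(1)[OF z] unfolding surj_def by blast
    then show ?thesis
      unfolding y_def by (intro someI[of "\<lambda>y. ?A z y = snd z - b (fst z)" y']) (rule sym)
  qed
  have y_smooth: "smooth_on U y"
  proof (rule smooth_on_linear_solve[where A = ?A, OF linear_frame_map U A(2) _ _ y])
    have "smooth_on V (\<lambda>x. X i (chart_inv c x) c)" if "i < r" for i
    proof -
      have "smooth_fun_on M (W \<inter> fst c) (\<lambda>q. X i q c)"
        using W(3)[OF that] c by (simp add: smooth_vfield_on_def)
      from smooth_fun_on_chart[OF this c] show ?thesis
        by (simp add: V_def Int_assoc)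
    qed
    moreover have "smooth_on V (\<lambda>x. Y a (chart_inv c x) c)" for a
      using smooth_on_subset[OF Y_smooth[OF c] V(2)] .
    ultimately show "smooth_on U (\<lambda>z. ?A z y)" for y
      unfolding frame_map_def
      by (intro smooth_on_add[OF U] smooth_on_sum[OF U] smooth_on_scaleR[OF U] smooth_on_const comp) auto
    show "smooth_on U (\<lambda>z. snd z - b (fst z))"
      using smooth_on_subset[OF X0 V(2)]
      by (intro smooth_on_diff[OF U] comp smooth_on_linear[OF U bounded_linear_snd])
  qed
  have "smooth_on U ?f"
  proof (rule smooth_on_vec[OF U])
    fix a
    show "smooth_on U (\<lambda>z. ?f z $ a)"
    proof (rule smooth_on_cong[OF U])
      show "smooth_on U (\<lambda>z. y z \<bullet> k a)"
        by (rule smooth_on_bounded_linear[OF U bounded_linear_inner_left y_smooth])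
      fix z assume z: "z \<in> U"
      let ?q = "chart_inv c (fst z)"
      let ?v = "coord_vec M c ?q (snd z - b (fst z))"
      note q = base(3)[OF z] and qc = base(2)[OF z]
      have v: "?v \<in> tangent_space M ?q"
        by (rule coord_vec_in_tangent_space[OF c qc])
      have dist: "?v - (\<Sum>a\<in>UNIV. (coeff ?q ?v $ a) *\<^sub>R Y a ?q) \<in> span ((\<lambda>i. X i ?q) ` {..<r})"
        using coeff_in[OF q v] frame'[OF z] by simp
      then obtain \<xi> where \<xi>: "?v - (\<Sum>a\<in>UNIV. (coeff ?q ?v $ a) *\<^sub>R Y a ?q) = (\<Sum>i<r. \<xi> i *\<^sub>R X i ?q)"
        by (rule span_image_sum[OF finite_lessThan])
      \<comment> \<open>The decomposition that defines \<open>coeff\<close>, encoded as a model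
        vector. It solves the same system as \<open>y z\<close>, so the two agree and their
        \<open>k\<close>-components are the entries of \<open>coeff\<close>.\<close>
      let ?y = "(\<Sum>i<r. \<xi> i *\<^sub>R j i) + (\<Sum>a\<in>UNIV. (coeff ?q ?v $ a) *\<^sub>R k a)"
      have "?A z ?y = ?v c"
        unfolding frame_map_coeffs[where X = X, OF q frame'[OF z] jk] \<xi>[symmetric] by simp
      also have "\<dots> = ?A z (y z)"
        using y[OF z] coord_vec_self[OF c qc] by simp
      finally have "?y = y z"
        using A(2)[OF z] by (simp add: inj_eq)
      then show "y z \<bullet> k a = ?f z $ a"
        using coeffs_inner[where X = X, OF q frame'[OF z] jk, of \<xi> "\<lambda>a. coeff ?q ?v $ a" a] by simp
    qed
  qed
  then show "\<exists>U. open U \<and> z0 \<in> U \<and> smooth_on U ?f"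
    using U z0 by blast
qed

end

section \<open>The feedback control\<close>

locale affine_constraint = complemented_distribution M r D Y
  for M :: "('p, 'e::euclidean_space) chart set" and r D and Y :: "'m::finite \<Rightarrow> ('p, 'e) vfield" +
  fixes X :: "('p, 'e) vfield" and G :: "(('p, 'e) tpoint, 'e \<times> 'e) vfield"
  assumes X: "smooth_vfield M X" and G: "smooth_vfield (tangent_bundle M) G"
begin

section \<open>The defect, whose zero set is the affine distribution\<close>

interpretation T: atlas "tangent_bundle M"
  by (rule atlas_tangent_bundle)

abbreviation constraint_set :: "('p, 'e) tpoint set" where
  "constraint_set \<equiv> total_set M (affine_distribution X D)"

text \<open>The map \<open>\<Phi>\<close> of the overview.\<close>

definition defect :: "('p, 'e) tpoint \<Rightarrow> real ^ 'm" where
  "defect v = coeff (fst v) (snd v - X (fst v))"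

lemma X_tangent: "q \<in> carrier M \<Longrightarrow> X q \<in> tangent_space M q"
  using X by (simp add: smooth_vfield_on_def)

lemma carrier_TQ: "v \<in> carrier (tangent_bundle M) \<longleftrightarrow> fst v \<in> carrier M \<and> snd v \<in> tangent_space M (fst v)"
  by (cases v) (simp add: carrier_tangent_bundle)

lemma tangent_minus_X:
  "v \<in> carrier (tangent_bundle M) \<Longrightarrow> snd v - X (fst v) \<in> tangent_space M (fst v)"
  using carrier_TQ X_tangent subspace_diff[OF subspace_tangent_space] by blast

lemma constraint_set_subset: "constraint_set \<subseteq> carrier (tangent_bundle M)"
proof
  fix v assume "v \<in> constraint_set"
  then obtain d where "fst v \<in> carrier M" "d \<in> D (fst v)" "snd v = X (fst v) + d"
    by (auto simp: total_set_def affine_distribution_def)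
  then show "v \<in> carrier (tangent_bundle M)"
    using carrier_TQ[of v] X_tangent[of "fst v"] D_tangent[of "fst v"]
      subspace_add[OF subspace_tangent_space, of "X (fst v)" "fst v" d]
    by (simp only:) blast
qed

lemma defect_eq_0_iff:
  assumes "v \<in> carrier (tangent_bundle M)"
  shows "defect v = 0 \<longleftrightarrow> v \<in> constraint_set"
proof -
  have q: "fst v \<in> carrier M"
    using assms carrier_TQ by blast
  have "defect v = 0 \<longleftrightarrow> snd v - X (fst v) \<in> D (fst v)"
    unfolding defect_def by (rule coeff_eq_0_iff[OF q tangent_minus_X[OF assms]])
  also have "\<dots> \<longleftrightarrow> (\<exists>d\<in>D (fst v). snd v = X (fst v) + d)"
  proof
    assume "snd v - X (fst v) \<in> D (fst v)"
    then show "\<exists>d\<in>D (fst v). snd v = X (fst v) + d"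
      by (rule bexI[rotated]) simp
  next
    assume "\<exists>d\<in>D (fst v). snd v = X (fst v) + d"
    then show "snd v - X (fst v) \<in> D (fst v)"
      by (auto simp only: add_diff_cancel_left')
  qed
  also have "\<dots> \<longleftrightarrow> v \<in> constraint_set"
    using q by (cases v) (auto simp: total_set_def affine_distribution_def)
  finally show ?thesis .
qed

lemma defect_add_input:
  assumes "v \<in> carrier (tangent_bundle M)"
  shows "defect (fst v, snd v + (\<Sum>a\<in>UNIV. (\<eta> $ a) *\<^sub>R Y a (fst v))) = defect v + \<eta>"
proof -
  have "fst v \<in> carrier M"
    using assms carrier_TQ by blast
  from coeff_add_input[OF this tangent_minus_X[OF assms], of \<eta>] show ?thesis
    unfolding defect_def fst_conv snd_conv diff_add_eq .
qed

lemma tangent_bundleE: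
  assumes "tc \<in> tangent_bundle M"
  obtains c where "c \<in> M" "tc = tangent_chart M c"
  using assms by (auto simp: tangent_bundle_def)

lemma tangent_chart_range:
  "c \<in> M \<Longrightarrow> snd (tangent_chart M c) ` fst (tangent_chart M c) = (snd c ` fst c) \<times> UNIV"
  using tangent_chart_image[of c "fst c"] by (simp add: fst_tangent_chart)

lemma smooth_vfield_in_chart:
  assumes c: "c \<in> M"
  shows "smooth_on (snd c ` fst c) (\<lambda>x. X (chart_inv c x) c)"
proof -
  have "smooth_fun_on M (carrier M \<inter> fst c) (\<lambda>q. X q c)"
    using X c by (simp add: smooth_vfield_on_def)
  moreover have "carrier M \<inter> fst c \<inter> fst c = fst c"
    using c by (auto simp: carrier_def)
  ultimately show ?thesis
    using smooth_fun_on_chart[OF _ c, of "carrier M \<inter> fst c"] by simp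
qed

lemma smooth_defect:
  assumes "tc \<in> tangent_bundle M"
  shows "smooth_on (snd tc ` fst tc) (defect \<circ> chart_inv tc)"
proof -
  obtain c where c: "c \<in> M" "tc = tangent_chart M c"
    using assms by (rule tangent_bundleE)
  show ?thesis
    unfolding c(2)
  proof (rule smooth_on_cong)
    show "open (snd (tangent_chart M c) ` fst (tangent_chart M c))"
      unfolding c(2)[symmetric] by (rule T.open_chart[OF assms])
    show "smooth_on (snd (tangent_chart M c) ` fst (tangent_chart M c))
      (\<lambda>z. coeff (chart_inv c (fst z))
        (coord_vec M c (chart_inv c (fst z)) (snd z - X (chart_inv c (fst z)) c)))"
      unfolding tangent_chart_range[OF c(1)] by (rule smooth_coeff[OF c(1) smooth_vfield_in_chart[OF c(1)]])
    fix z assume "z \<in> snd (tangent_chart M c) ` fst (tangent_chart M c)"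
    then have z: "fst z \<in> snd c ` fst c"
      unfolding tangent_chart_range[OF c(1)] by auto
    let ?q = "chart_inv c (fst z)"
    have q: "?q \<in> fst c" "?q \<in> carrier M"
      using chart_inv_in[OF z] c(1) by (auto simp: carrier_def)
    show "coeff ?q (coord_vec M c ?q (snd z - X ?q c)) = (defect \<circ> chart_inv (tangent_chart M c)) z"
      using chart_inv_tangent_chart[OF c(1) z, of "snd z"] coord_vec_of_tangent[OF c(1) q(1) X_tangent[OF q(2)]]
        linear_diff[OF linear_coord_vec[OF c(1) q(1)]]
      by (simp add: defect_def)
  qed
qed

lemma differentiable_defect:
  "tc \<in> tangent_bundle M \<Longrightarrow> v \<in> fst tc \<Longrightarrow> (defect \<circ> chart_inv tc) differentiable (at (snd tc v))"
  using smooth_on_differentiable[OF smooth_defect] by blast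

lemma linear_defect_derivative:
  assumes "tc \<in> tangent_bundle M" "v \<in> fst tc"
  shows "linear (frechet_derivative (defect \<circ> chart_inv tc) (at (snd tc v)))"
  by (rule linear_frechet_derivative[OF differentiable_defect[OF assms]])

text \<open>This is \<open>- d\<Phi>(G)\<close>. The choice of a tangent chart is harmless by
  \<open>feedback_eq\<close>. It is taken on all of \<open>TQ\<close>, so that it can be compared
  with an extension \<open>w\<close> off the constraint set; restriction to the constraint set gives
  the control.\<close>

definition feedback :: "('p, 'e) tpoint \<Rightarrow> real ^ 'm" where
  "feedback v = - (let tc = SOME tc. tc \<in> tangent_bundle M \<and> v \<in> fst tc
     in frechet_derivative (defect \<circ> chart_inv tc) (at (snd tc v)) (G v tc))"

lemma G_tangent: "v \<in> carrier (tangent_bundle M) \<Longrightarrow> G v \<in> tangent_space (tangent_bundle M) v"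
  using G by (simp add: smooth_vfield_on_def)

lemma feedback_eq:
  assumes "tc \<in> tangent_bundle M" "v \<in> fst tc"
  shows "feedback v = - frechet_derivative (defect \<circ> chart_inv tc) (at (snd tc v)) (G v tc)"
proof -
  define tc' where "tc' = (SOME tc. tc \<in> tangent_bundle M \<and> v \<in> fst tc)"
  have tc': "tc' \<in> tangent_bundle M" "v \<in> fst tc'"
    using someI[of "\<lambda>tc. tc \<in> tangent_bundle M \<and> v \<in> fst tc" tc] assms unfolding tc'_def by blast+
  show ?thesis
    using T.derivative_along_chart_independent[OF tc'(1) assms(1) tc'(2) assms(2)
        differentiable_defect[OF assms] G_tangent[OF T.in_carrier[OF assms]]]
    by (simp add: feedback_def tc'_def[symmetric])
qed

lemma smooth_G:
  assumes "tc \<in> tangent_bundle M"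
  shows "smooth_on (snd tc ` fst tc) (\<lambda>z. G (chart_inv tc z) tc)"
proof -
  have "smooth_fun_on (tangent_bundle M) (carrier (tangent_bundle M) \<inter> fst tc) (\<lambda>q. G q tc)"
    using G assms by (simp add: smooth_vfield_on_def)
  moreover have "carrier (tangent_bundle M) \<inter> fst tc \<inter> fst tc = fst tc"
    using assms by (auto simp: carrier_def)
  ultimately show ?thesis
    using smooth_fun_on_chart[OF _ assms, of "carrier (tangent_bundle M) \<inter> fst tc"] by simp
qed

lemma smooth_feedback:
  assumes "tc \<in> tangent_bundle M"
  shows "smooth_on (snd tc ` fst tc) (\<lambda>z. feedback (chart_inv tc z))"
proof (rule smooth_on_cong[OF T.open_chart[OF assms]])
  show "smooth_on (snd tc ` fst tc)
      (\<lambda>z. - frechet_derivative (defect \<circ> chart_inv tc) (at z) (G (chart_inv tc z) tc))"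
    by (intro smooth_on_minus smooth_on_derivative_along smooth_defect smooth_G T.open_chart assms)
  show "- frechet_derivative (defect \<circ> chart_inv tc) (at z) (G (chart_inv tc z) tc) = feedback (chart_inv tc z)"
    if "z \<in> snd tc ` fst tc" for z
    using feedback_eq[OF assms chart_inv_in[OF that]] snd_chart_inv[OF that] by simp
qed

lemma control_function_feedback: "control_function M constraint_set (restrict feedback constraint_set)"
proof -
  have "smooth_fun_on (tangent_bundle M) (carrier (tangent_bundle M)) feedback"
    unfolding smooth_fun_on_def o_def
  proof
    fix tc assume tc: "tc \<in> tangent_bundle M"
    then have "carrier (tangent_bundle M) \<inter> fst tc = fst tc"
      by (auto simp: carrier_def)
    then show "smooth_on (snd tc ` (carrier (tangent_bundle M) \<inter> fst tc)) (\<lambda>z. feedback (chart_inv tc z))"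
      using smooth_feedback[OF tc] by simp
  qed
  then have "smooth_fun_on_subset (tangent_bundle M) constraint_set (restrict feedback constraint_set)"
    unfolding smooth_fun_on_subset_def using T.openin_carrier constraint_set_subset
    by (auto intro!: exI[of _ "carrier (tangent_bundle M)"] exI[of _ feedback])
  then show ?thesis
    by (simp add: control_function_def)
qed

text \<open>For the third claim, differentiate \<open>defect\<close> along the line
  \<open>snd v + t *\<^sub>R Y a (fst v)\<close> in two ways: by the chain rule in the chart, and
  directly, since adding multiples of \<open>Y a\<close> shifts the \<open>a\<close>-th component of
  the defect by the same amount.\<close>

lemma vertical_lift_in_chart:
  assumes c: "c \<in> M" and v: "v \<in> fst (tangent_chart M c)"
  shows "vertical_lift M (Y a) v (tangent_chart M c) = (0, Y a (fst v) c)"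
    and "vertical_lift M (Y a) v \<in> tangent_space (tangent_bundle M) v"
    and "frechet_derivative (defect \<circ> chart_inv (tangent_chart M c)) (at (snd (tangent_chart M c) v))
      (0, Y a (fst v) c) = axis a 1"
proof -
  let ?tc = "tangent_chart M c" and ?\<gamma> = "\<lambda>t. (fst v, snd v + t *\<^sub>R Y a (fst v))"
  have tc: "?tc \<in> tangent_bundle M"
    using c by (simp add: tangent_bundle_def)
  have v': "v \<in> carrier (tangent_bundle M)"
    by (rule T.in_carrier[OF tc v])
  have q: "fst v \<in> fst c" "fst v \<in> carrier M" "snd v \<in> tangent_space M (fst v)"
    using v v' carrier_TQ by (auto simp: fst_tangent_chart)
  have \<gamma>: "?\<gamma> t \<in> fst ?tc" for t
    using q Y_tangent by (auto simp: fst_tangent_chart intro!: subspace_add[OF subspace_tangent_space]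
        subspace_scale[OF subspace_tangent_space])
  have \<gamma>0: "?\<gamma> 0 = v"
    by simp
  have der: "(snd ?tc \<circ> ?\<gamma> has_vector_derivative (0, Y a (fst v) c)) (at 0)"
  proof -
    have "((\<lambda>t. snd v c + t *\<^sub>R Y a (fst v) c) has_vector_derivative Y a (fst v) c) (at 0)"
      by (auto intro!: derivative_eq_intros)
    from has_vector_derivative_Pair[OF has_vector_derivative_const this]
    show ?thesis
      by (simp add: o_def snd_tangent_chart)
  qed
  have ev: "\<forall>\<^sub>F s in nhds 0. ?\<gamma> s \<in> fst ?tc"
    by (intro always_eventually allI \<gamma>)
  show "vertical_lift M (Y a) v ?tc = (0, Y a (fst v) c)"
    unfolding vertical_lift_def using T.velocity_eq[OF tc \<gamma> der] .
  show "vertical_lift M (Y a) v \<in> tangent_space (tangent_bundle M) v"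
    unfolding vertical_lift_def using T.velocity_in_tangent_space(2)[OF tc ev der] \<gamma>0 by simp
  have d: "(defect \<circ> chart_inv ?tc) differentiable (at (snd ?tc (?\<gamma> 0)))"
    unfolding \<gamma>0 by (rule differentiable_defect[OF tc v])
  have "(defect \<circ> ?\<gamma>) t = defect v + t *\<^sub>R axis a 1" for t
  proof -
    have "(\<Sum>b\<in>UNIV. ((t *\<^sub>R axis a 1 :: real ^ 'm) $ b) *\<^sub>R Y b (fst v)) = t *\<^sub>R Y a (fst v)"
      by (simp add: axis_def if_distrib[of "\<lambda>s. s *\<^sub>R _"] if_distrib[of "\<lambda>s. t * s"] sum.delta' cong: if_cong)
    then show ?thesis
      using defect_add_input[OF v', of "t *\<^sub>R axis a 1"] by simp
  qed
  then have "defect \<circ> ?\<gamma> = (\<lambda>t. defect v + t *\<^sub>R axis a 1)"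
    by (rule ext)
  moreover have "((\<lambda>t. defect v + t *\<^sub>R axis a 1) has_vector_derivative axis a 1) (at 0)"
    by (auto intro!: derivative_eq_intros)
  ultimately have "(defect \<circ> ?\<gamma> has_vector_derivative axis a 1) (at 0)"
    by simp
  from vector_derivative_unique_at[OF T.has_vector_derivative_along_curve[OF tc ev der d] this]
  show "frechet_derivative (defect \<circ> chart_inv ?tc) (at (snd ?tc v)) (0, Y a (fst v) c) = axis a 1"
    unfolding \<gamma>0 .
qed

section \<open>Rate of change of the defect along the closed loop\<close>

lemma closed_loop_apply:
  "closed_loop M G Y w v tc = G v tc + (\<Sum>a\<in>UNIV. (w v $ a) *\<^sub>R vertical_lift M (Y a) v tc)"
  by (simp add: closed_loop_def sum_fun_apply)

lemma closed_loop_tangent: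
  assumes "v \<in> carrier (tangent_bundle M)"
  shows "closed_loop M G Y w v \<in> tangent_space (tangent_bundle M) v"
proof -
  obtain tc where "tc \<in> tangent_bundle M" "v \<in> fst tc"
    using assms by (auto simp: carrier_def)
  then obtain c where c: "c \<in> M" "v \<in> fst (tangent_chart M c)"
    using tangent_bundleE by metis
  show ?thesis
    unfolding closed_loop_def
    by (intro subspace_add subspace_sum subspace_scale T.subspace_tangent_space G_tangent assms
        vertical_lift_in_chart(2)[OF c])
qed

text \<open>\<open>G\<close> contributes \<open>- feedback v\<close> by definition, and the vertical
  lifts contribute the unit vectors weighted by \<open>w v\<close>. So the control enters the rate
  through the identity matrix.\<close>

lemma defect_derivative_closed_loop:
  assumes c: "c \<in> M" and v: "v \<in> fst (tangent_chart M c)"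
  shows "frechet_derivative (defect \<circ> chart_inv (tangent_chart M c)) (at (snd (tangent_chart M c) v))
    (closed_loop M G Y w v (tangent_chart M c)) = w v - feedback v"
proof -
  let ?tc = "tangent_chart M c"
  have tc: "?tc \<in> tangent_bundle M"
    using c by (simp add: tangent_bundle_def)
  note lin = linear_defect_derivative[OF tc v]
  have "(\<Sum>a\<in>UNIV. (w v $ a) *\<^sub>R axis a 1) = w v"
    by (simp add: vec_eq_iff sum_component axis_def if_distrib sum.delta cong: if_cong)
  then show ?thesis
    using feedback_eq[OF tc v]
    by (simp add: closed_loop_apply vertical_lift_in_chart[OF c v] linear_add[OF lin]
        linear_sum[OF lin] linear_cmul[OF lin] del: scaleR_Pair)
qed

lemma defect_along_integral_curve:
  assumes "integral_curve (tangent_bundle M) (closed_loop M G Y w) J \<gamma>" "t \<in> J"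
  shows "(defect \<circ> \<gamma> has_vector_derivative w (\<gamma> t) - feedback (\<gamma> t)) (at t)"
proof -
  have "\<gamma> t \<in> carrier (tangent_bundle M)"
    using assms by (auto simp: integral_curve_def differentiable_curve_def)
  then obtain tc where tc: "tc \<in> tangent_bundle M" "\<gamma> t \<in> fst tc"
    by (auto simp: carrier_def)
  obtain c where c: "c \<in> M" "tc = tangent_chart M c"
    using tc(1) by (rule tangent_bundleE)
  note ic = T.integral_curve_in_chart[OF assms tc]
  show ?thesis
    using T.has_vector_derivative_along_curve[OF tc(1) eventually_mono[OF ic(1) conjunct2] ic(2)
        differentiable_defect[OF tc]] defect_derivative_closed_loop[OF c(1) tc(2)[unfolded c(2)]]
    unfolding c(2) by simp
qed

text \<open>Subtracting the input directions weighted by the defect moves a tangent vector onto the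
  constraint set, where \<open>w\<close> and the feedback agree.\<close>

lemma feedback_error_bound:
  assumes W: "openin (mtop (tangent_bundle M)) W" and w: "smooth_fun_on (tangent_bundle M) W w"
    and agree: "\<And>v. v \<in> W \<Longrightarrow> v \<in> constraint_set \<Longrightarrow> w v = feedback v"
    and tc: "tc \<in> tangent_bundle M" and v0: "v0 \<in> fst tc" "v0 \<in> W" "v0 \<in> constraint_set"
  obtains C where "C \<ge> 0" "\<forall>\<^sub>F z in nhds (snd tc v0). norm (w (chart_inv tc z) - feedback (chart_inv tc z))
    \<le> C * norm (defect (chart_inv tc z))"
proof -
  obtain c where c: "c \<in> M" "tc = tangent_chart M c"
    using tc by (rule tangent_bundleE)
  define U where "U = snd tc ` (W \<inter> fst tc)"
  define R where "R = snd tc ` fst tc"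
  have U: "open U" "U \<subseteq> R" and R: "open R" "R = (snd c ` fst c) \<times> UNIV"
    using T.open_chart_image[OF W tc] T.open_chart[OF tc] tangent_chart_range[OF c(1)]
    by (auto simp: U_def R_def c(2))
  define z0 where "z0 = snd tc v0"
  have z0: "z0 \<in> U"
    using v0 by (auto simp: z0_def U_def)
  define \<delta> where "\<delta> z = w (chart_inv tc z) - feedback (chart_inv tc z)" for z
  have "smooth_on U \<delta>"
    unfolding \<delta>_def using smooth_fun_on_chart[OF w tc] smooth_on_subset[OF smooth_feedback[OF tc] U(2)[unfolded R_def]]
    by (intro smooth_on_diff[OF U(1)]) (auto simp: U_def)
  then obtain \<rho> L where \<rho>: "\<rho> > 0" and L: "L \<ge> 0" "cball z0 \<rho> \<subseteq> U"
    and lip: "\<And>x y. x \<in> cball z0 \<rho> \<Longrightarrow> y \<in> cball z0 \<rho> \<Longrightarrow> norm (\<delta> x - \<delta> y) \<le> L * norm (x - y)"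
    by (rule smooth_on_locally_lipschitz[OF U(1) _ z0]) blast
  define y where "y = (\<lambda>a (z :: 'e \<times> 'e). Y a (chart_inv c (fst z)) c)"
  define \<eta> where "\<eta> z = defect (chart_inv tc z)" for z
  \<comment> \<open>The weighted input directions in tangent coordinates. The first component is 0
    because the correction is vertical: the base point stays fixed.\<close>
  define V where "V z = (0 :: 'e, \<Sum>a\<in>UNIV. (\<eta> z $ a) *\<^sub>R y a z)" for z
  define N where "N z = (\<Sum>a\<in>UNIV. norm (y a z))" for z
  have "smooth_on R (y a)" for a
    using smooth_on_compose[OF R(1) open_chart[OF c(1)] _ Y_smooth[OF c(1)]
        smooth_on_linear[OF R(1) bounded_linear_fst]] R(2)
    by (auto simp: y_def o_def)
  then have cont_y: "continuous_on R (y a)" for a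
    by (rule smooth_on_imp_continuous_on)
  have cont_\<eta>: "continuous_on R \<eta>"
    using smooth_on_imp_continuous_on[OF smooth_defect[OF tc]] by (simp add: R_def \<eta>_def o_def)
  have cont: "continuous_on R V" "continuous_on R N"
    unfolding V_def N_def by (intro continuous_intros cont_y cont_\<eta>)+
  have \<eta>0: "\<eta> z0 = 0"
    using v0 defect_eq_0_iff[OF T.in_carrier[OF tc v0(1)]] T.chart_inv_snd[OF tc v0(1)]
    by (simp add: \<eta>_def z0_def)
  then have V0: "V z0 = 0"
    by (simp add: V_def zero_prod_def)
  have tend: "(V \<longlongrightarrow> 0) (nhds z0)" "(N \<longlongrightarrow> N z0) (nhds z0)"
    using cont continuous_on_eq_continuous_at[OF R(1)] z0 U(2) V0 unfolding isCont_def
    by (metis subsetD tendsto_at_iff_tendsto_nhds)+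
  \<comment> \<open>Half of the radius is for \<open>z\<close> and half for the correction
    \<open>V z\<close>, so that \<open>z - V z\<close> is still in the ball on which the Lipschitz
    estimate holds. The bound on \<open>N\<close> makes the constant independent of
    \<open>z\<close>.\<close>
  have ev: "\<forall>\<^sub>F z in nhds z0. dist z z0 < \<rho>/2 \<and> norm (V z) < \<rho>/2 \<and> N z < N z0 + 1"
    using eventually_nhds_ball[of "\<rho>/2" z0] \<rho> order_tendstoD(2)[OF tendsto_norm_zero[OF tend(1)], of "\<rho>/2"]
      order_tendstoD(2)[OF tend(2), of "N z0 + 1"]
    by (auto intro!: eventually_conj simp: dist_commute)
  have N_nn: "0 \<le> N z0 + 1"
    unfolding N_def by (simp add: sum_nonneg add_nonneg_nonneg)
  have "norm (\<delta> z) \<le> (L * (N z0 + 1)) * norm (\<eta> z)"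
    if z: "dist z z0 < \<rho>/2" "norm (V z) < \<rho>/2" "N z < N z0 + 1" for z
  proof -
    define z' where "z' = z - V z"
    have balls: "z \<in> cball z0 \<rho>" "z' \<in> cball z0 \<rho>"
    proof -
      show "z \<in> cball z0 \<rho>"
        using z(1) \<rho> by (simp add: dist_commute)
      have "dist z' z0 \<le> dist z z0 + norm (V z)"
        using norm_triangle_ineq4[of "z - z0" "V z"] by (simp add: dist_norm z'_def algebra_simps)
      then show "z' \<in> cball z0 \<rho>"
        using z by (simp add: dist_commute)
    qed
    have zU: "z \<in> U" "z' \<in> U"
      using balls L(2) by auto
    have x: "fst z \<in> snd c ` fst c" "fst z' = fst z"
      using zU U(2) R(2) by (auto simp: z'_def V_def)
    let ?q = "chart_inv c (fst z)"
    let ?v = "chart_inv tc z"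
    have q: "?q \<in> fst c" "?q \<in> carrier M"
      using chart_inv_in[OF x(1)] c(1) by (auto simp: carrier_def)
    have v: "?v = (?q, coord_vec M c ?q (snd z))"
      using chart_inv_tangent_chart[OF c(1) x(1), of "snd z"] by (simp add: c(2))
    have v': "chart_inv tc z' = (fst ?v, snd ?v + (\<Sum>a\<in>UNIV. ((- \<eta> z) $ a) *\<^sub>R Y a (fst ?v)))"
    proof -
      have "chart_inv tc z' = (?q, coord_vec M c ?q (snd z'))"
        using chart_inv_tangent_chart[OF c(1) x(1), of "snd z'"] x(2) c(2) by (metis prod.collapse)
      moreover have "snd z' = snd z - (\<Sum>a\<in>UNIV. (\<eta> z $ a) *\<^sub>R Y a ?q c)"
        by (simp add: z'_def V_def y_def)
      moreover have "coord_vec M c ?q (Y a ?q c) = Y a ?q" for a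
        by (rule coord_vec_of_tangent[OF c(1) q(1) Y_tangent[OF q(2)]])
      moreover note lin = linear_coord_vec[OF c(1) q(1)]
      ultimately show ?thesis
        by (simp add: v linear_diff[OF lin] linear_sum[OF lin] linear_cmul[OF lin] sum_negf)
    qed
    have vc: "?v \<in> fst tc" "chart_inv tc z' \<in> fst tc"
      using zU U(2) chart_inv_in[of z tc] chart_inv_in[of z' tc] unfolding R_def by blast+
    have "defect (chart_inv tc z') = 0"
      using defect_add_input[OF T.in_carrier[OF tc vc(1)], of "- \<eta> z"] unfolding v' by (simp add: \<eta>_def)
    then have "chart_inv tc z' \<in> constraint_set"
      using defect_eq_0_iff[OF T.in_carrier[OF tc vc(2)]] by blast
    moreover have "chart_inv tc z' \<in> W"
      using zU(2) T.chart_inv_snd[OF tc] by (auto simp: U_def)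
    ultimately have "\<delta> z' = 0"
      using agree by (simp add: \<delta>_def)
    \<comment> \<open>As \<open>\<delta>\<close> vanishes at the corrected point
      \<open>z - V z\<close>, the Lipschitz estimate bounds it at \<open>z\<close> by the length of
      the correction, which is proportional to the defect.\<close>
    then have "norm (\<delta> z) \<le> L * norm (V z)"
      using lip[OF balls] by (simp add: z'_def)
    also have "norm (V z) \<le> (N z0 + 1) * norm (\<eta> z)"
    proof -
      have "norm (V z) \<le> (\<Sum>a\<in>UNIV. norm ((\<eta> z $ a) *\<^sub>R y a z))"
        unfolding V_def by (simp add: norm_Pair sum_norm_le)
      also have "\<dots> \<le> (\<Sum>a\<in>UNIV. norm (\<eta> z) * norm (y a z))"
        by (intro sum_mono) (simp add: component_le_norm_cart mult_right_mono)
      also have "\<dots> = N z * norm (\<eta> z)"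
        by (simp add: N_def sum_distrib_left mult.commute)
      also have "\<dots> \<le> (N z0 + 1) * norm (\<eta> z)"
        using z(3) by (intro mult_right_mono) auto
      finally show ?thesis .
    qed
    finally show ?thesis
      using L(1) by (simp add: mult_left_mono mult.assoc)
  qed
  then have "\<forall>\<^sub>F z in nhds z0. norm (\<delta> z) \<le> (L * (N z0 + 1)) * norm (\<eta> z)"
    using ev by (auto elim!: eventually_mono)
  then show thesis
    using that[of "L * (N z0 + 1)"] L(1) N_nn by (simp add: \<delta>_def \<eta>_def z0_def)
qed

text \<open>The error bound holds only near points of the constraint set and its constant varies
  with the point. So the times at which the defect vanishes are shown to be closed in
  \<open>J\<close> by continuity and open by \<open>gronwall_zero\<close>; connectedness of
  \<open>J\<close> does the rest.\<close>

lemma makes_virtual_constraint_feedback: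
  "makes_virtual_constraint M G Y constraint_set (restrict feedback constraint_set)"
  unfolding makes_virtual_constraint_def
proof (intro allI impI)
  fix W w J \<gamma>
  assume W: "openin (mtop (tangent_bundle M)) W" and w: "smooth_fun_on (tangent_bundle M) W w"
    and "\<forall>v\<in>W \<inter> constraint_set. w v = restrict feedback constraint_set v"
    and J: "open_interval J" "0 \<in> J" "\<gamma> ` J \<subseteq> W"
    and \<gamma>: "integral_curve (tangent_bundle M) (closed_loop M G Y w) J \<gamma>" "\<gamma> 0 \<in> constraint_set"
  then have agree: "\<And>v. v \<in> W \<Longrightarrow> v \<in> constraint_set \<Longrightarrow> w v = feedback v"
    by auto
  let ?\<phi> = "defect \<circ> \<gamma>"
  have der: "(?\<phi> has_vector_derivative w (\<gamma> t) - feedback (\<gamma> t)) (at t)" if "t \<in> J" for t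
    by (rule defect_along_integral_curve[OF \<gamma>(1) that])
  have in_TQ: "\<gamma> t \<in> carrier (tangent_bundle M)" if "t \<in> J" for t
    using \<gamma>(1) that by (auto simp: integral_curve_def differentiable_curve_def)
  have oJ: "open J" "connected J"
    using J(1) by (auto simp: open_interval_def is_interval_connected)
  have cont: "continuous_on J ?\<phi>"
    using der has_vector_derivative_continuous by (intro continuous_at_imp_continuous_on) blast
  define K where "K = {t \<in> J. ?\<phi> t = 0}"
  have "closedin (top_of_set J) K"
    unfolding K_def using continuous_closedin_preimage_constant[OF cont] by simp
  moreover have "openin (top_of_set J) K"
  proof -
    have "open K"
      unfolding open_dist
    proof
      fix t0 assume "t0 \<in> K"
      then have t0: "t0 \<in> J" "?\<phi> t0 = 0"
        by (auto simp: K_def)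
      obtain tc where tc: "tc \<in> tangent_bundle M" "\<gamma> t0 \<in> fst tc"
        using in_TQ[OF t0(1)] by (auto simp: carrier_def)
      have "\<gamma> t0 \<in> constraint_set"
        using t0 defect_eq_0_iff[OF in_TQ[OF t0(1)]] by simp
      moreover have "\<gamma> t0 \<in> W"
        using J(3) t0(1) by auto
      ultimately obtain C where C: "C \<ge> 0" "\<forall>\<^sub>F z in nhds (snd tc (\<gamma> t0)).
          norm (w (chart_inv tc z) - feedback (chart_inv tc z)) \<le> C * norm (defect (chart_inv tc z))"
        using feedback_error_bound[OF W w agree tc] by blast
      note ic = T.integral_curve_in_chart[OF \<gamma>(1) t0(1) tc]
      have "isCont (snd tc \<circ> \<gamma>) t0"
        using ic(2) by (rule has_vector_derivative_continuous)
      then have "((snd tc \<circ> \<gamma>) \<longlongrightarrow> snd tc (\<gamma> t0)) (nhds t0)"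
        using tendsto_at_iff_tendsto_nhds[of "snd tc \<circ> \<gamma>" t0] by (simp add: isCont_def)
      \<comment> \<open>Pulls the coordinate estimate near \<open>\<gamma> t0\<close> back to times
        near \<open>t0\<close>, by continuity of the curve in the chart.\<close>
      from ic(1) filterlim_iff[THEN iffD1, OF this, rule_format, OF C(2)]
      have "\<forall>\<^sub>F t in nhds t0. t \<in> J \<and> norm (w (\<gamma> t) - feedback (\<gamma> t)) \<le> C * norm (?\<phi> t)"
        by eventually_elim (simp add: T.chart_inv_snd[OF tc(1)])
      then obtain e where e: "e > 0" "\<And>t. \<bar>t - t0\<bar> < e \<Longrightarrow>
          t \<in> J \<and> norm (w (\<gamma> t) - feedback (\<gamma> t)) \<le> C * norm (?\<phi> t)"
        by (auto simp: eventually_nhds_metric dist_real_def)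
      have bound: "(?\<phi> has_vector_derivative w (\<gamma> t) - feedback (\<gamma> t)) (at t)"
        "norm (w (\<gamma> t) - feedback (\<gamma> t)) \<le> C * norm (?\<phi> t)" if "\<bar>t - t0\<bar> < e" for t
        using der e(2)[OF that] by blast+
      show "\<exists>e>0. \<forall>t. dist t t0 < e \<longrightarrow> t \<in> K"
      proof (rule gronwall_zero[where \<phi> = ?\<phi>, OF e(1) C(1) bound t0(2)])
        fix d assume d: "0 < d" "\<And>t. \<bar>t - t0\<bar> < d \<Longrightarrow> ?\<phi> t = 0"
        \<comment> \<open>\<open>d\<close> gives a vanishing defect, while \<open>e\<close> ensures
          that \<open>t\<close> still belongs to \<open>J\<close>.\<close>
        have "t \<in> K" if "dist t t0 < min d e" for t
          using d(2)[of t] e(2)[of t] that by (simp add: K_def dist_real_def)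
        then show ?thesis
          using d(1) e(1) by (intro exI[of _ "min d e"]) simp
      qed
    qed
    then show ?thesis
      using oJ(1) by (simp add: openin_open_eq K_def)
  qed
  moreover have "0 \<in> K"
    using J(2) \<gamma>(2) defect_eq_0_iff[OF in_TQ[OF J(2)]] by (simp add: K_def)
  ultimately have "K = J"
    using oJ(2) connected_clopen by blast
  then have "defect (\<gamma> t) = 0" if "t \<in> J" for t
    using that by (auto simp: K_def)
  then show "\<gamma> ` J \<subseteq> constraint_set"
    using defect_eq_0_iff[OF in_TQ] by blast
qed

section \<open>Local closed-loop solutions and uniqueness of the control\<close>

lemma integral_curve_exists:
  assumes W: "openin (mtop (tangent_bundle M)) W" and w: "smooth_fun_on (tangent_bundle M) W w"
    and v0: "v0 \<in> W"
  obtains J \<gamma> where "open_interval J" "0 \<in> J" "\<gamma> ` J \<subseteq> W" "\<gamma> 0 = v0"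
    and "integral_curve (tangent_bundle M) (closed_loop M G Y w) J \<gamma>"
proof -
  have "v0 \<in> carrier (tangent_bundle M)"
    using W v0 T.openin_iff by blast
  then obtain tc where tc: "tc \<in> tangent_bundle M" "v0 \<in> fst tc"
    by (auto simp: carrier_def)
  obtain c where c: "c \<in> M" "tc = tangent_chart M c"
    using tc(1) by (rule tangent_bundleE)
  define U where "U = snd tc ` (W \<inter> fst tc)"
  define R where "R = snd tc ` fst tc"
  have U: "open U" "U \<subseteq> R" and R: "open R" "R = (snd c ` fst c) \<times> UNIV"
    using T.open_chart_image[OF W tc(1)] T.open_chart[OF tc(1)] tangent_chart_range[OF c(1)]
    by (auto simp: U_def R_def c(2))
  define z0 where "z0 = snd tc v0"
  have z0: "z0 \<in> U"
    using v0 tc by (auto simp: z0_def U_def)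
  define Z where "Z z = closed_loop M G Y w (chart_inv tc z) tc" for z
  have in_R: "chart_inv tc z \<in> fst tc" if "z \<in> R" for z
    using that unfolding R_def by (rule chart_inv_in)
  have in_U: "chart_inv tc z \<in> W" if "z \<in> U" for z
    using that T.chart_inv_snd[OF tc(1)] by (auto simp: U_def)
  \<comment> \<open>In tangent coordinates the closed loop is the representation of \<open>G\<close>
    plus smooth multiples of the vertical vectors \<open>(0, Y a)\<close>; smoothness gives the
    Lipschitz ball for the existence theorem. That ball lies in \<open>U\<close>, which keeps the
    solution in \<open>W\<close>.\<close>
  have "smooth_on U Z"
  proof (rule smooth_on_cong[OF U(1)])
    have y: "smooth_on R (\<lambda>z. Y a (chart_inv c (fst z)) c)" for a
      using smooth_on_compose[OF R(1) open_chart[OF c(1)] _ Y_smooth[OF c(1)]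
          smooth_on_linear[OF R(1) bounded_linear_fst]] R(2)
      by (auto simp: o_def)
    have wa: "smooth_on U (\<lambda>z. w (chart_inv tc z) $ a)" for a
      using smooth_fun_on_chart[OF w tc(1)] unfolding U_def[symmetric]
      by (rule smooth_on_bounded_linear[OF U(1) bounded_linear_vec_nth])
    show "smooth_on U (\<lambda>z. G (chart_inv tc z) tc +
        (\<Sum>a\<in>UNIV. (w (chart_inv tc z) $ a) *\<^sub>R (0, Y a (chart_inv c (fst z)) c)))"
      using smooth_G[OF tc(1)] U(2)
      by (intro smooth_on_add[OF U(1)] smooth_on_sum[OF U(1)] smooth_on_scaleR[OF U(1)] wa
          smooth_on_Pair[OF U(1) smooth_on_const] smooth_on_subset[OF y U(2)])
        (auto simp: R_def intro: smooth_on_subset)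
    fix z assume z: "z \<in> U"
    then have x: "fst z \<in> snd c ` fst c"
      using U(2) R(2) by auto
    have "fst (chart_inv tc z) = chart_inv c (fst z)"
      using chart_inv_tangent_chart[OF c(1) x, of "snd z"] by (simp add: c(2))
    then show "G (chart_inv tc z) tc +
        (\<Sum>a\<in>UNIV. (w (chart_inv tc z) $ a) *\<^sub>R (0, Y a (chart_inv c (fst z)) c)) = Z z"
      using vertical_lift_in_chart(1)[OF c(1) in_R[OF subsetD[OF U(2) z], unfolded c(2)]]
      by (simp add: Z_def closed_loop_apply c(2))
  qed
  then obtain \<rho> L where \<rho>: "\<rho> > 0" and L: "L \<ge> 0" "cball z0 \<rho> \<subseteq> U"
    and lip: "\<And>x y. x \<in> cball z0 \<rho> \<Longrightarrow> y \<in> cball z0 \<rho> \<Longrightarrow> norm (Z x - Z y) \<le> L * norm (x - y)"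
    by (rule smooth_on_locally_lipschitz[OF U(1) _ z0]) blast
  show thesis
  proof (rule picard_lindelof[OF \<rho> L(1) lip])
    fix h \<xi>
    assume h: "0 < h" and \<xi>0: "\<xi> 0 = z0"
      and \<xi>: "\<And>t. \<bar>t\<bar> < h \<Longrightarrow> \<xi> t \<in> cball z0 \<rho>"
      and der: "\<And>t. \<bar>t\<bar> < h \<Longrightarrow> (\<xi> has_vector_derivative Z (\<xi> t)) (at t)"
    let ?J = "{-h<..<h}"
    have \<xi>U: "\<xi> t \<in> U" if "t \<in> ?J" for t
      using \<xi>[of t] L(2) that by auto
    show thesis
    proof (rule that)
      show "open_interval ?J"
        by (simp add: open_interval_def is_interval_oo)
      show "0 \<in> ?J"
        using h by simp
      show "(chart_inv tc \<circ> \<xi>) ` ?J \<subseteq> W"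
        using in_U[OF \<xi>U] by (simp add: image_subset_iff)
      show "(chart_inv tc \<circ> \<xi>) 0 = v0"
        using \<xi>0 T.chart_inv_snd[OF tc] by (simp add: z0_def)
      show "integral_curve (tangent_bundle M) (closed_loop M G Y w) ?J (chart_inv tc \<circ> \<xi>)"
      proof (rule T.integral_curve_of_chart_solution[OF tc(1)])
        fix t assume t: "t \<in> ?J"
        show "\<xi> t \<in> snd tc ` fst tc"
          using subsetD[OF U(2) \<xi>U[OF t]] by (simp only: R_def)
        show "(\<xi> has_vector_derivative closed_loop M G Y w (chart_inv tc (\<xi> t)) tc) (at t)"
          using der[of t] t by (simp add: Z_def abs_less_iff)
        show "closed_loop M G Y w (chart_inv tc (\<xi> t)) \<in> tangent_space (tangent_bundle M) (chart_inv tc (\<xi> t))"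
          by (rule closed_loop_tangent[OF T.in_carrier[OF tc(1) in_R[OF subsetD[OF U(2) \<xi>U[OF t]]]]])
      qed simp
    qed
  qed
qed

text \<open>A single local extension and a single solution through each \<open>v\<close> suffice:
  along that solution the defect is constantly 0, so its rate \<open>w v - feedback v\<close> at
  time 0 vanishes. Outside the constraint set both functions are undefined in the sense of
  \<open>extensional\<close>.\<close>

lemma virtual_constraint_control_unique:
  assumes u: "control_function M constraint_set u" "makes_virtual_constraint M G Y constraint_set u"
  shows "u = restrict feedback constraint_set"
proof -
  have "u v = feedback v" if v: "v \<in> constraint_set" for v
  proof -
    obtain W w where W: "openin (mtop (tangent_bundle M)) W" "v \<in> W"
      and w: "smooth_fun_on (tangent_bundle M) W w" "\<forall>x\<in>W \<inter> constraint_set. w x = u x"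
      using u(1) v unfolding control_function_def smooth_fun_on_subset_def by metis
    obtain J \<gamma> where J: "open_interval J" "0 \<in> J" "\<gamma> ` J \<subseteq> W" "\<gamma> 0 = v"
      and \<gamma>: "integral_curve (tangent_bundle M) (closed_loop M G Y w) J \<gamma>"
      by (rule integral_curve_exists[OF W(1) w(1) W(2)]) blast
    have "\<gamma> ` J \<subseteq> constraint_set"
      using u(2)[unfolded makes_virtual_constraint_def, rule_format, OF W(1) w(1) _ J(1-3) \<gamma>] w(2) v J(4)
      by blast
    then have zero: "(defect \<circ> \<gamma>) t = 0" if "t \<in> J" for t
      using that defect_eq_0_iff[of "\<gamma> t"] constraint_set_subset by auto
    have der: "(defect \<circ> \<gamma> has_vector_derivative w (\<gamma> 0) - feedback (\<gamma> 0)) (at 0)"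
      by (rule defect_along_integral_curve[OF \<gamma> J(2)])
    have "open J"
      using J(1) by (simp add: open_interval_def)
    \<comment> \<open>The defect vanishes on the whole open interval around 0, and not just at 0, so
      its derivative is 0 as well.\<close>
    have "(defect \<circ> \<gamma> has_vector_derivative 0) (at 0)"
      by (rule has_vector_derivative_transform_within_open[OF has_vector_derivative_const[of 0] \<open>open J\<close> J(2)])
        (rule zero[symmetric])
    from vector_derivative_unique_at[OF der this] have "w v - feedback v = 0"
      by (simp add: J(4))
    then show ?thesis
      using w(2) W(2) v by auto
  qed
  moreover have "u \<in> extensional constraint_set"
    using u(1) by (simp add: control_function_def)
  ultimately show ?thesis
    by (intro extensionalityI[of _ constraint_set]) auto
qed

end

theorem theorem1:
  fixes Q :: "('p, 'e::euclidean_space) chart set"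
    and g :: "'p \<Rightarrow> ('p, 'e) tvec \<Rightarrow> ('p, 'e) tvec \<Rightarrow> real"
    and nabla :: "('p, 'e) vfield \<Rightarrow> ('p, 'e) vfield \<Rightarrow> ('p, 'e) vfield"
    and X :: "('p, 'e) vfield"
    and D :: "'p \<Rightarrow> ('p, 'e) tvec set"
    and F0 :: "('p, 'e) tpoint \<Rightarrow> ('p, 'e) tvec \<Rightarrow> real"
    and f :: "'m::finite \<Rightarrow> 'p \<Rightarrow> ('p, 'e) tvec \<Rightarrow> real"
    and G :: "(('p, 'e) tpoint, 'e \<times> 'e) vfield"
    and n r :: nat
  defines "Y0 \<equiv> \<lambda>v. sharp Q g (fst v) (F0 v)"
    and "Y \<equiv> \<lambda>a q. sharp Q g q (f a q)"
    and "A \<equiv> affine_distribution X D"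
  assumes "smooth_manifold Q" and "DIM('e) = n"
    and "riemannian_metric Q g" and "levi_civita Q g nabla"
    and "1 < r" and "r < n" and "CARD('m) = n - r"
    and "smooth_vfield Q X" and "distribution Q r D" and "\<not> integrable_distribution Q r D"
    and "external_force Q F0" and "\<forall>a. one_form Q (f a)"
    and "dynamics_field Q nabla Y0 G"
    and "transversal Q A (input_distribution Y)"
  shows "\<exists>!u :: ('p, 'e) tpoint \<Rightarrow> real ^ 'm.
    control_function Q (total_set Q A) u \<and> makes_virtual_constraint Q G Y (total_set Q A) u"
proof -
  interpret atlas Q
    using \<open>smooth_manifold Q\<close> by unfold_locales (auto simp: smooth_manifold_def)
  have cov: "covector Q q (f a q)" if "q \<in> carrier Q" for q a
    using \<open>\<forall>a. one_form Q (f a)\<close> that by (simp add: one_form_def)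
  interpret affine_constraint Q r D Y X G
  proof unfold_locales
    show "distribution Q r D" "smooth_vfield Q X" "smooth_vfield (tangent_bundle Q) G"
      using \<open>distribution Q r D\<close> \<open>smooth_vfield Q X\<close> \<open>dynamics_field Q nabla Y0 G\<close>
      by (auto simp: dynamics_field_def)
    show "Y a q \<in> tangent_space Q q" if "q \<in> carrier Q" for a q
      unfolding Y_def by (rule sharp_props(1)[OF \<open>riemannian_metric Q g\<close> that cov[OF that]])
    show "smooth_on (snd c ` fst c) (\<lambda>x. Y a (chart_inv c x) c)" if "c \<in> Q" for c a
      unfolding Y_def using \<open>\<forall>a. one_form Q (f a)\<close> by (intro smooth_sharp \<open>riemannian_metric Q g\<close> that) simp
    show "DIM('e) = r + CARD('m)"
      using \<open>DIM('e) = n\<close> \<open>r < n\<close> \<open>CARD('m) = n - r\<close> by simp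
    fix q v assume q: "q \<in> carrier Q" and v: "v \<in> tangent_space Q q"
    \<comment> \<open>Transversality decomposes vectors as an element of \<open>A q\<close> plus an
      input. Applied to the shifted vector \<open>X q + v\<close>, it yields a decomposition of
      \<open>v\<close> itself once \<open>X q\<close> is cancelled.\<close>
    have "X q + v \<in> tangent_space Q q"
      using \<open>smooth_vfield Q X\<close> q v
      by (intro subspace_add[OF subspace_tangent_space]) (simp_all add: smooth_vfield_on_def)
    moreover have "tangent_space Q q = {w1 + w2 |w1 w2. w1 \<in> A q \<and> w2 \<in> input_distribution Y q}"
      using \<open>transversal Q A (input_distribution Y)\<close> q
      unfolding transversal_def transversal_in_def by blast
    ultimately obtain d w where "d \<in> D q" "w \<in> input_distribution Y q" "X q + v = (X q + d) + w"
      unfolding A_def affine_distribution_def by blast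
    then show "\<exists>d\<in>D q. \<exists>w\<in>input_distribution Y q. v = d + w"
      by (metis add.assoc add_left_cancel)
  qed
  show ?thesis
    unfolding A_def
    using control_function_feedback makes_virtual_constraint_feedback virtual_constraint_control_unique
    by blast
qed

end
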